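(* Let $p$ be an odd prime, $k\in\mathbb{Z}_p^\times$, $l\ge1$, $n=2l-1$ and $d=2n=4l-2$. On the hypercubic lattice $\mathbb{Z}^{d}$ place one $\mathbb{Z}_p$ qudit on every $n$-cell. For each $n$-cell $c$ define $$A^{(k)}_c=X_c\prod_{c'}Z_{c'}^{\,k\int\boldsymbol c'\cup\boldsymbol c}\prod_{t}Z_{\partial t}^{\frac k2\int(\boldsymbol c\cup_1\boldsymbol t-\boldsymbol t\cup_1\boldsymbol c)},\qquad \overline A^{(k)}_c=A^{(-k)}_c,$$ where $c'$ runs over $n$-cells, $t$ over $(n+1)$-cells, $Z_{\partial t}=\prod_{c'}Z_{c'}^{(\delta\boldsymbol c')(t)}$, and $\frac12$ is the inverse of $2$ in $\mathbb{Z}_p$. Then the operators $A^{(k)}_c$ generate an invertible subalgebra: every $A^{(k)}_c$ commutes with every $\overline A^{(k)}_{c'}$, and every single-qudit Pauli operator $X_c,Z_c$ is, up to a phase, a product of finitely many (powers of) operators $A^{(k)}_{c'}$ and $\overline A^{(k)}_{c'}$ supported within a uniformly bounded distance of $c$.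
   Context: Generalized Pauli operators satisfy $X^p=Z^p=1$, $ZX=e^{2\pi i/p}XZ$ on each qudit. An invertible subalgebra $\mathcal A$ is a subalgebra of the algebra of local operators for which there is a constant $\ell$ such that every operator supported on a set $S$ is a sum of products $ab$ with $a\in\mathcal A$, $b$ in the commutant of $\mathcal A$, both supported in the $\ell$-neighbourhood of $S$. Phases are immaterial. An $n$-cell of $\mathbb{Z}^d$ is a pair $(v,I)$, $v\in\mathbb{Z}^d$, $I=\{i_1<\dots<i_n\}\subset[d]=\{1,\dots,d\}$, representing the cube $v+\{\sum_{i\in I}t_ie_i:t_i\in[0,1]\}$; bold denotes indicator cochains. The boundary is $\partial(v,I)=\sum_{r=1}^{n}(-1)^{r}\big[(v,I\setminus\{i_r\})-(v+e_{i_r},I\setminus\{i_r\})\big]$, and $\delta a(c)=a(\partial c)$. For disjoint $J,I$ put $\mathrm{inv}(J,I)=\#\{(j,i)\in J\times I:j<i\}$, and $e_I=\sum_{i\in I}e_i$. For cochains $a,b$ of degrees $p',q'$: if $p'+q'=d$, $(a\cup b)(v,[d])=\sum_{I\sqcup J=[d],|I|=p'}(-1)^{\mathrm{inv}(J,I)}a(v,I)\,b(v+e_I,J)$; if $p'+q'=d+1$, $(a\cup_1b)(v,[d])=\sum_{c_0\in[d]}\sum_{I'\sqcup J'=[d]\setminus\{c_0\},|I'|=p'-1}(-1)^{q'-1+\mathrm{inv}(J',I')}a\big(v+\sum_{j\in J',j>c_0}e_j,I'\cup\{c_0\}\big)\,b\big(v+\sum_{i\in I',i<c_0}e_i,J'\cup\{c_0\}\big)$.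 $\int$ is the sum of values over all $d$-cells; exponents are read mod $p$. *)

theory Defs
  imports
    Complex_Main
    "HOL-Library.FuncSet"
    "HOL-Library.Poly_Mapping"
    "Berlekamp_Zassenhaus.Finite_Field"
begin

section \<open>Operators on qudits\<close>

text \<open>
  Qudits of prime dimension \<open>p = CARD('p)\<close> sit on the elements of a type \<open>'a\<close>. A configuration
  assigns an element of \<open>\<int>\<^sub>p\<close> to every site, and operators act on complex functions of
  configurations. Operator multiplication is function composition.
\<close>

type_synonym ('a, 'p) config = "'a \<Rightarrow> 'p mod_ring"
type_synonym ('a, 'p) wave = "('a, 'p) config \<Rightarrow> complex"
type_synonym ('a, 'p) qop = "('a, 'p) wave \<Rightarrow> ('a, 'p) wave"

definition op_add :: "('a, 'p::prime_card) qop \<Rightarrow> ('a, 'p) qop \<Rightarrow> ('a, 'p) qop" where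
  "op_add S T = (\<lambda>\<psi> s. S \<psi> s + T \<psi> s)"

definition op_scale :: "complex \<Rightarrow> ('a, 'p::prime_card) qop \<Rightarrow> ('a, 'p) qop" where
  "op_scale z T = (\<lambda>\<psi> s. z * T \<psi> s)"

definition op_sum :: "('i \<Rightarrow> ('a, 'p::prime_card) qop) \<Rightarrow> 'i set \<Rightarrow> ('a, 'p) qop" where
  "op_sum F I = (\<lambda>\<psi> s. \<Sum>i\<in>I. F i \<psi> s)"

text \<open>Powers with exponent in \<open>\<int>\<^sub>p\<close>; meaningful for operators with \<open>T\<^sup>p = 1\<close>.\<close>

definition op_pow :: "('a, 'p::prime_card) qop \<Rightarrow> 'p mod_ring \<Rightarrow> ('a, 'p) qop" where
  "op_pow T m = T ^^ nat (to_int_mod_ring m)"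

text \<open>
  The product of a family of pairwise commuting operators of which only finitely many differ
  from the identity.
\<close>

definition op_prod :: "('i \<Rightarrow> ('a, 'p::prime_card) qop) \<Rightarrow> 'i set \<Rightarrow> ('a, 'p) qop" where
  "op_prod F I = Finite_Set.fold (\<lambda>i T. F i \<circ> T) id {i \<in> I. F i \<noteq> id}"

text \<open>
  \<open>T\<close> acts as a matrix \<open>M\<close> on the qudits of a finite subset \<open>F\<close> of \<open>S\<close> and as the identity on all
  others. For infinite \<open>S\<close> this describes the local operators supported on \<open>S\<close>.
\<close>

definition supported_on :: "'a set \<Rightarrow> ('a, 'p::prime_card) qop \<Rightarrow> bool" where
  "supported_on S T \<longleftrightarrow>
    (\<exists>F (M :: ('a, 'p) config \<Rightarrow> ('a, 'p) config \<Rightarrow> complex). finite F \<and> F \<subseteq> S \<and>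
      (\<forall>\<psi> s. T \<psi> s = (\<Sum>r \<in> F \<rightarrow>\<^sub>E UNIV. M (restrict s F) r * \<psi> (override_on s r F))))"

definition local_ops :: "'a set \<Rightarrow> ('a, 'p::prime_card) qop set" where
  "local_ops \<Lambda> = {T. supported_on \<Lambda> T}"

definition subalgebra :: "('a, 'p::prime_card) qop set \<Rightarrow> bool" where
  "subalgebra B \<longleftrightarrow> id \<in> B \<and> (\<forall>S\<in>B. \<forall>T\<in>B. op_add S T \<in> B \<and> S \<circ> T \<in> B) \<and>
    (\<forall>z. \<forall>T\<in>B. op_scale z T \<in> B)"

definition commutant :: "'a set \<Rightarrow> ('a, 'p::prime_card) qop set \<Rightarrow> ('a, 'p) qop set" where
  "commutant \<Lambda> B = {T \<in> local_ops \<Lambda>. \<forall>S\<in>B. S \<circ> T = T \<circ> S}"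

definition nbhd :: "'a set \<Rightarrow> ('a \<Rightarrow> 'a \<Rightarrow> int) \<Rightarrow> int \<Rightarrow> 'a set \<Rightarrow> 'a set" where
  "nbhd \<Lambda> D \<rho> S = {x \<in> \<Lambda>. \<exists>y\<in>S. D x y \<le> \<rho>}"

definition invertible_subalgebra ::
    "'a set \<Rightarrow> ('a \<Rightarrow> 'a \<Rightarrow> int) \<Rightarrow> ('a, 'p::prime_card) qop set \<Rightarrow> bool" where
  "invertible_subalgebra \<Lambda> D B \<longleftrightarrow> subalgebra B \<and> B \<subseteq> local_ops \<Lambda> \<and>
    (\<exists>\<rho>. \<forall>S T. S \<subseteq> \<Lambda> \<and> supported_on S T \<longrightarrow>
      (\<exists>(N::nat) a b. T = op_sum (\<lambda>i. a i \<circ> b i) {..<N} \<and>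
        (\<forall>i<N. a i \<in> B \<and> b i \<in> commutant \<Lambda> B \<and>
          supported_on (nbhd \<Lambda> D \<rho> S) (a i) \<and> supported_on (nbhd \<Lambda> D \<rho> S) (b i))))"

text \<open>On basis states \<open>X\<close> maps \<open>|s\<rangle>\<close> to \<open>|s + 1\<rangle>\<close> and \<open>Z\<close> maps \<open>|s\<rangle>\<close> to \<open>e\<^bsup>2\<pi>is/p\<^esup>|s\<rangle>\<close>.\<close>

definition pauli_X :: "'a \<Rightarrow> ('a, 'p::prime_card) qop" where
  "pauli_X c = (\<lambda>\<psi> s. \<psi> (s(c := s c - 1)))"

definition pauli_Z :: "'a \<Rightarrow> ('a, 'p::prime_card) qop" where
  "pauli_Z c = (\<lambda>\<psi> s. cis (2 * pi * of_int (to_int_mod_ring (s c)) / of_nat CARD('p)) * \<psi> s)"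


section \<open>Cells and cochains of the hypercubic lattice\<close>

text \<open>Points of \<open>\<int>\<^sup>d\<close> are functions that vanish outside \<open>{1..d}\<close>.\<close>

type_synonym point = "nat \<Rightarrow> int"
type_synonym cell = "point \<times> nat set"
type_synonym cochain = "cell \<Rightarrow> int"

definition cells :: "nat \<Rightarrow> nat \<Rightarrow> cell set" where
  "cells d n = {(v, I). (\<forall>i. i \<notin> {1..d} \<longrightarrow> v i = 0) \<and> I \<subseteq> {1..d} \<and> card I = n}"

definition cell_dist :: "nat \<Rightarrow> cell \<Rightarrow> cell \<Rightarrow> int" where
  "cell_dist d c c' = (\<Sum>i=1..d. \<bar>fst c i - fst c' i\<bar>)"

definition indic :: "cell \<Rightarrow> cochain" where
  "indic c = (\<lambda>c'. of_bool (c' = c))"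

text \<open>\<open>shift v I\<close> is \<open>v + e\<^sub>I\<close>.\<close>

definition shift :: "point \<Rightarrow> nat set \<Rightarrow> point" where
  "shift v I = (\<lambda>i. v i + of_bool (i \<in> I))"

text \<open>The position of \<open>i\<close> in \<open>I\<close>, counted from \<open>1\<close>, is \<open>card {j \<in> I. j \<le> i}\<close>.\<close>

definition boundary :: "cell \<Rightarrow> cell \<Rightarrow>\<^sub>0 int" where
  "boundary = (\<lambda>(v, I). \<Sum>i\<in>I. frag_cmul ((- 1) ^ card {j \<in> I. j \<le> i})
     (frag_of (v, I - {i}) - frag_of (shift v {i}, I - {i})))"

definition coboundary :: "cochain \<Rightarrow> cochain" where
  "coboundary a c =
    (\<Sum>f \<in> Poly_Mapping.keys (boundary c). Poly_Mapping.lookup (boundary c) f * a f)"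

definition inversions :: "nat set \<Rightarrow> nat set \<Rightarrow> nat" where
  "inversions J I = card {(j, i). j \<in> J \<and> i \<in> I \<and> j < i}"

text \<open>
  The degrees of the arguments (\<open>r\<close> and \<open>q\<close>) are explicit parameters. Only the values on
  top-dimensional cells, that is for \<open>K = {1..d}\<close>, are used.
\<close>

definition cup :: "nat \<Rightarrow> cochain \<Rightarrow> cochain \<Rightarrow> cochain" where
  "cup r a b = (\<lambda>(v, K). \<Sum>I | I \<subseteq> K \<and> card I = r.
     (- 1) ^ inversions (K - I) I * a (v, I) * b (shift v I, K - I))"

definition cup1 :: "nat \<Rightarrow> nat \<Rightarrow> cochain \<Rightarrow> cochain \<Rightarrow> cochain" where
  "cup1 r q a b = (\<lambda>(v, K). \<Sum>c\<in>K. \<Sum>I | I \<subseteq> K - {c} \<and> card I = r - 1.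
     (let J = K - {c} - I in
      (- 1) ^ (q - 1 + inversions J I) *
      a (shift v {j \<in> J. c < j}, insert c I) * b (shift v {i \<in> I. i < c}, insert c J)))"

definition integral_cochain :: "nat \<Rightarrow> cochain \<Rightarrow> int" where
  "integral_cochain d a = (\<Sum>c | c \<in> cells d d \<and> a c \<noteq> 0. a c)"


section \<open>The generators\<close>

definition Z_boundary :: "nat \<Rightarrow> nat \<Rightarrow> cell \<Rightarrow> (cell, 'p::prime_card) qop" where
  "Z_boundary d n t =
    op_prod (\<lambda>c'. op_pow (pauli_Z c') (of_int (coboundary (indic c') t))) (cells d n)"

definition A_op :: "nat \<Rightarrow> nat \<Rightarrow> 'p::prime_card mod_ring \<Rightarrow> cell \<Rightarrow> (cell, 'p) qop" where
  "A_op d n k c = pauli_X c \<circ>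
    op_prod (\<lambda>c'. op_pow (pauli_Z c')
      (k * of_int (integral_cochain d (cup n (indic c') (indic c))))) (cells d n) \<circ>
    op_prod (\<lambda>t. op_pow (Z_boundary d n t)
      (k / 2 * of_int (integral_cochain d
        (\<lambda>x. cup1 n (n + 1) (indic c) (indic t) x - cup1 (n + 1) n (indic t) (indic c) x))))
      (cells d (n + 1))"

abbreviation A_bar :: "nat \<Rightarrow> nat \<Rightarrow> 'p::prime_card mod_ring \<Rightarrow> cell \<Rightarrow> (cell, 'p) qop" where
  "A_bar d n k \<equiv> A_op d n (- k)"

end

theory Submission
  imports Defs
begin

text \<open>
  Up to a phase, every operator in the statement is a Weyl operator \<open>X\<^sup>x Z\<^sup>z\<close>, where \<open>x\<close> and \<open>z\<close> are
  finitely supported functions of the qudits. The generator \<open>A\<^sub>a\<close> is \<open>X\<^sub>a Z\<^sup>w\<close> with \<open>w = w\<^sub>a\<close>, where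
  \<open>w\<^sub>a(b)\<close> is the exponent of \<open>Z\<^sub>b\<close>, and its partner with \<open>-k\<close> in place of \<open>k\<close> is \<open>X\<^sub>a Z\<^sup>-\<^sup>w\<close>. The two
  families commute as soon as the matrix \<open>w\<close> is antisymmetric. For odd \<open>p\<close> they generate everything
  locally as soon as \<open>w\<close> has a local inverse: a product of the \<open>A\<^sub>a\<close> with exponents \<open>u\<close> and of their partners
  with exponents \<open>v\<close> is \<open>X\<^sup>x Z\<^sup>z\<close> with \<open>x = u + v\<close> and \<open>z = w(u - v)\<close>, and these equations can be
  solved for \<open>u\<close> and \<open>v\<close>. Since Weyl operators span the local operators
  (\<open>acts_on_expansion\<close>), this gives the invertible subalgebra (\<open>invertible_weyl_subalgebra\<close>).

  Both properties of \<open>w\<close> come from one computation on cochains. Let \<open>\<delta>\<close> be the coboundary and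
  \<open>\<tau>\<close> the translation by \<open>(1, \<dots>, 1)\<close>. A \<open>\<union>\<^sub>1\<close>-integral is a \<open>\<union>\<close>-integral of a homotopy:
  \<open>\<integral> t \<union>\<^sub>1 a = \<integral> h t \<union> a\<close> and \<open>\<integral> a \<union>\<^sub>1 t = - \<integral> h' t \<union> a\<close>. Both \<open>h\<close> and \<open>h'\<close> sweep a cell along
  one coordinate direction after the other; they differ in the order of the directions. In either
  order the steps telescope to \<open>\<delta> h + h \<delta> = 1 - \<tau> = \<delta> h' + h' \<delta>\<close> (\<open>homotopy_above\<close>,
  \<open>homotopy_below\<close>). With \<open>g = (h + h') / 2\<close> the exponents become
  \<open>w\<^sub>a(b) = k \<integral> (1 - g \<delta>) b \<union> a\<close> (\<open>exponent_map_via_integrals\<close>).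

  Because \<open>\<delta> \<delta> = 0\<close>, the homotopy formula gives \<open>(1 - g \<delta>) (1 - \<delta> g) = 1 - g \<delta> - \<delta> g = \<tau>\<close>, and
  \<open>a \<mapsto> \<integral> - \<union> a\<close> is a signed permutation of cells; this is the local inverse
  (\<open>exponent_map_solve\<close>). For antisymmetry, write \<open>1 - g \<delta> = \<tau> + \<delta> g\<close>. In dimension \<open>d = 2n\<close> with \<open>n\<close>
  odd, transposition with respect to the cup product turns \<open>\<tau>\<close> into \<open>-1\<close> and \<open>\<delta> g\<close> into \<open>g \<delta>\<close>,
  exchanging \<open>h\<close> and \<open>h'\<close> (\<open>cup_dual_swap\<close>, \<open>cup_dual_cobd_homotopy_swap\<close>). Hence the transpose of
  \<open>\<tau> + \<delta> g\<close> is \<open>-(1 - g \<delta>)\<close> (\<open>exponent_map_antisym\<close>).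
\<close>

section \<open>Signs of cells\<close>

text \<open>
  The sign with which the pair of faces orthogonal to direction \<open>i\<close> enters the boundary of a cell.
\<close>

definition pos_sign :: "nat \<Rightarrow> nat set \<Rightarrow> 'r::comm_ring_1" where
  "pos_sign i I = (- 1) ^ card {j \<in> I. j \<le> i}"

lemma pos_sign_insert_self:
  assumes "finite I" "c \<notin> I"
  shows "pos_sign c (insert c I) = - ((- 1) ^ card {j \<in> I. j < c} :: 'r::comm_ring_1)"
proof -
  have "{j \<in> insert c I. j \<le> c} = insert c {j \<in> I. j < c}" using assms by auto
  thus ?thesis using assms by (simp add: pos_sign_def)
qed

lemma pos_sign_insert_other:
  assumes "finite I" "c \<notin> I"
  shows "pos_sign i (insert c I) = (if c \<le> i then - 1 else 1) * (pos_sign i I :: 'r::comm_ring_1)"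
proof -
  have "{j \<in> insert c I. j \<le> i} = (if c \<le> i then insert c {j \<in> I. j \<le> i} else {j \<in> I. j \<le> i})"
    by auto
  thus ?thesis using assms by (simp add: pos_sign_def)
qed

lemma pos_sign_remove:
  assumes "finite I" "i \<in> I"
  shows "pos_sign j (I - {i}) = (if i \<le> j then - 1 else 1) * (pos_sign j I :: 'r::comm_ring_1)"
proof -
  have "pos_sign j I = (if i \<le> j then - 1 else 1) * (pos_sign j (I - {i}) :: 'r)"
    using pos_sign_insert_other[of "I - {i}" i j, where ?'r = 'r] assms by (simp add: insert_absorb)
  thus ?thesis by simp
qed

lemma pos_sign_square [simp]: "pos_sign i I * pos_sign i I = (1 :: 'r::comm_ring_1)"
  by (simp add: pos_sign_def flip: power_mult_distrib)

lemma card_less_greater: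
  assumes "finite (I :: nat set)" "c \<notin> I"
  shows "card {i \<in> I. i < c} + card {i \<in> I. c < i} = card I"
proof -
  have "I = {i \<in> I. i < c} \<union> {i \<in> I. c < i}" using assms by (auto simp: not_less le_less)
  thus ?thesis using assms
    by (metis (no_types, lifting) card_Un_disjoint disjoint_iff finite_Un mem_Collect_eq not_less_iff_gr_or_eq)
qed

lemma finite_pairs: "finite J \<Longrightarrow> finite I \<Longrightarrow> finite {(j, i). j \<in> J \<and> i \<in> I \<and> P j i}"
  by (rule finite_subset[of _ "J \<times> I"]) auto

lemma inversions_insert_left:
  assumes "finite J" "finite I" "c \<notin> J"
  shows "inversions (insert c J) I = inversions J I + card {i \<in> I. c < i}"
proof -
  have "{(j, i). j \<in> insert c J \<and> i \<in> I \<and> j < i} =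
      {(j, i). j \<in> J \<and> i \<in> I \<and> j < i} \<union> Pair c ` {i \<in> I. c < i}" by auto
  moreover have "{(j, i). j \<in> J \<and> i \<in> I \<and> j < i} \<inter> Pair c ` {i \<in> I. c < i} = {}"
    using assms by auto
  ultimately show ?thesis unfolding inversions_def
    using assms finite_pairs[of J I "(<)"] by (simp add: card_Un_disjoint card_image inj_on_def)
qed

lemma inversions_insert_right:
  assumes "finite J" "finite I" "c \<notin> I"
  shows "inversions J (insert c I) = inversions J I + card {j \<in> J. j < c}"
proof -
  have "{(j, i). j \<in> J \<and> i \<in> insert c I \<and> j < i} =
      {(j, i). j \<in> J \<and> i \<in> I \<and> j < i} \<union> (\<lambda>j. (j, c)) ` {j \<in> J. j < c}" by auto
  moreover have "{(j, i). j \<in> J \<and> i \<in> I \<and> j < i} \<inter> (\<lambda>j. (j, c)) ` {j \<in> J. j < c} = {}"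
    using assms by auto
  ultimately show ?thesis unfolding inversions_def
    using assms finite_pairs[of J I "(<)"] by (simp add: card_Un_disjoint card_image inj_on_def)
qed

lemma inversions_swap:
  assumes "finite J" "finite I" "J \<inter> I = {}"
  shows "inversions J I + inversions I J = card J * card I"
proof -
  have "bij_betw (\<lambda>(i, j). (j, i)) {(i, j). i \<in> I \<and> j \<in> J \<and> i < j} {(j, i). j \<in> J \<and> i \<in> I \<and> i < j}"
    by (rule bij_betw_byWitness[of _ "\<lambda>(i, j). (j, i)"]) auto
  hence 1: "inversions I J = card {(j, i). j \<in> J \<and> i \<in> I \<and> i < j}"
    unfolding inversions_def by (rule bij_betw_same_card)
  have "J \<times> I = {(j, i). j \<in> J \<and> i \<in> I \<and> j < i} \<union> {(j, i). j \<in> J \<and> i \<in> I \<and> i < j}"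
    using assms by (auto simp: neq_iff)
  moreover have "{(j, i). j \<in> J \<and> i \<in> I \<and> j < i} \<inter> {(j, i). j \<in> J \<and> i \<in> I \<and> i < j} = {}" by auto
  ultimately have "card (J \<times> I) = inversions J I + inversions I J"
    unfolding 1 unfolding inversions_def
    using assms finite_pairs[of J I] by (simp add: card_Un_disjoint)
  thus ?thesis by (simp add: card_cartesian_product)
qed

lemma minus_one_power_cong:
  "even (m + n) \<Longrightarrow> (- 1) ^ m = ((- 1) ^ n :: 'r::comm_ring_1)"
  by (simp add: minus_one_power_iff)

section \<open>Operations on cochains\<close>

definition unshift :: "point \<Rightarrow> nat set \<Rightarrow> point" where
  "unshift v I = (\<lambda>i. v i - of_bool (i \<in> I))"

lemma shift_shift: "A \<inter> B = {} \<Longrightarrow> shift (shift v A) B = shift v (A \<union> B)"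
  by (auto simp: shift_def fun_eq_iff)

lemma shift_unshift [simp]: "shift (unshift v A) A = v" "unshift (shift v A) A = v"
  by (auto simp: shift_def unshift_def fun_eq_iff)

lemma shift_commute: "shift (shift v A) B = shift (shift v B) A"
  by (auto simp: shift_def fun_eq_iff)

lemma shift_eq_iff: "shift v A = u \<longleftrightarrow> v = unshift u A"
  by (auto simp: shift_def unshift_def fun_eq_iff algebra_simps)

lemma sum_telescope_pred:
  fixes f :: "nat \<Rightarrow> 'r::ab_group_add"
  shows "(\<Sum>c\<in>{1..d}. f c - f (c - 1)) = f d - f 0"
  by (induction d) auto

lemma sum_off_diagonal_antisym:
  fixes f :: "nat \<Rightarrow> nat \<Rightarrow> 'r::field"
  assumes "finite I" "(2::'r) \<noteq> 0" "\<And>i j. i \<in> I \<Longrightarrow> j \<in> I \<Longrightarrow> i \<noteq> j \<Longrightarrow> f i j = - f j i"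
  shows "(\<Sum>i\<in>I. \<Sum>j\<in>I - {i}. f i j) = 0"
proof -
  let ?g = "\<lambda>i j. if i = j then 0 else f i j"
  have e: "(\<Sum>j\<in>I - {i}. f i j) = (\<Sum>j\<in>I. ?g i j)" if "i \<in> I" for i
    using assms(1) by (intro sum.mono_neutral_cong_left) auto
  have "(\<Sum>i\<in>I. \<Sum>j\<in>I. ?g i j) = (\<Sum>j\<in>I. \<Sum>i\<in>I. ?g i j)" by (rule sum.swap)
  also have "\<dots> = - (\<Sum>j\<in>I. \<Sum>i\<in>I. ?g j i)"
    unfolding sum_negf[symmetric]
  proof (intro sum.cong refl)
    fix i j assume "i \<in> I" "j \<in> I"
    thus "?g i j = - ?g j i" using assms(3)[of i j] by (cases "i = j") simp_all
  qed
  finally have "2 * (\<Sum>i\<in>I. \<Sum>j\<in>I. ?g i j) = 0" by (simp only: mult_2) simp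
  hence "(\<Sum>i\<in>I. \<Sum>j\<in>I. ?g i j) = 0" using assms(2) by (simp only: mult_eq_0_iff) simp
  thus ?thesis by (simp only: e cong: sum.cong)
qed

abbreviation chi :: "cell \<Rightarrow> cell \<Rightarrow> 'r::comm_ring_1" where
  "chi b \<equiv> (\<lambda>c. of_bool (c = b))"

text \<open>
  The coboundary as an explicit sum over faces. Like the other operations below it is defined for all
  cochains, of finite support or not, because each value is a finite sum.
\<close>

definition cobd :: "(cell \<Rightarrow> 'r::comm_ring_1) \<Rightarrow> cell \<Rightarrow> 'r" where
  "cobd x = (\<lambda>(v, I). \<Sum>i\<in>I. pos_sign i I * (x (v, I - {i}) - x (shift v {i}, I - {i})))"

text \<open>
  The value at \<open>(v, I)\<close> collects the cells that contain one more direction \<open>c\<close>, moved by the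
  directions in \<open>E c\<close>. If \<open>E c\<close> consists of all directions after (or all before) \<open>c\<close>, this is the
  part of the \<open>\<union>\<^sub>1\<close>-product that remains when the cup product with the other factor is split off.
\<close>

definition homotopy :: "nat \<Rightarrow> (nat \<Rightarrow> nat set) \<Rightarrow> (cell \<Rightarrow> 'r::comm_ring_1) \<Rightarrow> cell \<Rightarrow> 'r" where
  "homotopy d E x = (\<lambda>(v, I). \<Sum>c\<in>{1..d} - I. pos_sign c (insert c I) * x (shift v (E c), insert c I))"

text \<open>
  In \<open>\<integral> x \<union> a\<close> an indicator cochain \<open>a\<close> on the cell \<open>(u, J)\<close> selects the single
  cell \<open>(u - e\<^sub>I, I)\<close> with \<open>I\<close> complementary to \<open>J\<close>. The map \<open>cup_dual d x\<close> sends \<open>(u, J)\<close> to that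
  integral, which makes the pairing available without sums over an infinite lattice.
\<close>

definition cup_dual :: "nat \<Rightarrow> (cell \<Rightarrow> 'r::comm_ring_1) \<Rightarrow> cell \<Rightarrow> 'r" where
  "cup_dual d x = (\<lambda>(v, J). (- 1) ^ inversions J ({1..d} - J) * x (unshift v ({1..d} - J), {1..d} - J))"

lemma cobd_cobd:
  fixes x :: "cell \<Rightarrow> 'r::field"
  assumes "finite I" "(2::'r) \<noteq> 0"
  shows "cobd (cobd x) (v, I) = 0"
proof -
  let ?f = "\<lambda>i j. pos_sign i I * pos_sign j (I - {i}) *
      (x (v, I - {i} - {j}) - x (shift v {j}, I - {i} - {j})
       - (x (shift v {i}, I - {i} - {j}) - x (shift (shift v {i}) {j}, I - {i} - {j})))"
  have "cobd (cobd x) (v, I) = (\<Sum>i\<in>I. \<Sum>j\<in>I - {i}. ?f i j)"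
    by (simp add: cobd_def sum_distrib_left mult.assoc flip: sum_subtractf right_diff_distrib)
  also have "\<dots> = 0"
  proof (rule sum_off_diagonal_antisym[OF assms])
    fix i j assume ij: "i \<in> I" "j \<in> I" "i \<noteq> j"
    have "I - {j} - {i} = I - {i} - {j}" by auto
    moreover have "pos_sign i I * pos_sign j (I - {i}) = - (pos_sign j I * (pos_sign i (I - {j}) :: 'r))"
      using ij assms by (auto simp: pos_sign_remove)
    ultimately show "?f i j = - ?f j i"
      by (simp add: shift_commute[of v "{j}"] algebra_simps)
  qed
  finally show ?thesis .
qed

section \<open>Two chain homotopies from the identity to a translation\<close>

text \<open>
  Removing a direction \<open>i\<close> and adding another direction \<open>c\<close> can be done in either order, and the two
  orders have opposite signs. So only the terms survive in which the direction that was added is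
  removed again, for every choice of the shifts \<open>E\<close>.
\<close>

lemma homotopy_anticommute:
  fixes x :: "cell \<Rightarrow> 'r::comm_ring_1"
  assumes I: "I \<subseteq> {1..d}"
  shows "cobd (homotopy d E x) (v, I) + homotopy d E (cobd x) (v, I)
       = (\<Sum>c\<in>{1..d}. x (shift v (E c), I) - x (shift (shift v (E c)) {c}, I))"
proof -
  note fin = finite_subset[OF I finite_atLeastAtMost]
  let ?D = "\<lambda>i. x (shift v (E i), I) - x (shift (shift v (E i)) {i}, I)"
  let ?X = "\<lambda>i c. x (shift v (E c), insert c (I - {i})) - x (shift (shift v (E c)) {i}, insert c (I - {i}))"
  let ?g = "\<lambda>i c. pos_sign i I * pos_sign c (insert c (I - {i})) * ?X i c"
  have 1: "cobd (homotopy d E x) (v, I) = (\<Sum>i\<in>I. ?D i + (\<Sum>c\<in>{1..d} - I. ?g i c))"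
  proof -
    have "cobd (homotopy d E x) (v, I) = (\<Sum>i\<in>I. \<Sum>c\<in>{1..d} - (I - {i}). ?g i c)"
      unfolding cobd_def homotopy_def
      by (simp add: sum_distrib_left mult.assoc shift_commute[of v _ "E _"]
          flip: sum_subtractf right_diff_distrib)
    also have "\<dots> = (\<Sum>i\<in>I. ?D i + (\<Sum>c\<in>{1..d} - I. ?g i c))"
    proof (intro sum.cong refl)
      fix i assume i: "i \<in> I"
      hence "{1..d} - (I - {i}) = insert i ({1..d} - I)" using I by auto
      moreover have "insert i I = I" using i by auto
      ultimately show "(\<Sum>c\<in>{1..d} - (I - {i}). ?g i c) = ?D i + (\<Sum>c\<in>{1..d} - I. ?g i c)"
        using i by (simp add: insert_Diff)
    qed
    finally show ?thesis .
  qed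
  have 2: "homotopy d E (cobd x) (v, I) = (\<Sum>c\<in>{1..d} - I. ?D c - (\<Sum>i\<in>I. ?g i c))"
    unfolding homotopy_def cobd_def prod.case
  proof (intro sum.cong refl)
    fix c assume c: "c \<in> {1..d} - I"
    have "(\<Sum>i\<in>I. pos_sign c (insert c I) * (pos_sign i (insert c I) *
         (x (shift v (E c), insert c I - {i}) - x (shift (shift v (E c)) {i}, insert c I - {i}))))
        = (\<Sum>i\<in>I. - ?g i c)"
    proof (intro sum.cong refl)
      fix i assume i: "i \<in> I"
      hence ic: "i \<noteq> c" using c by auto
      have s: "insert c I - {i} = insert c (I - {i})" using ic by auto
      have "pos_sign c (insert c I) * pos_sign i (insert c I)
          = - (pos_sign i I * (pos_sign c (insert c (I - {i})) :: 'r))"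
        using i c fin ic by (auto simp: pos_sign_insert_other pos_sign_remove)
      thus "pos_sign c (insert c I) * (pos_sign i (insert c I) *
         (x (shift v (E c), insert c I - {i}) - x (shift (shift v (E c)) {i}, insert c I - {i}))) = - ?g i c"
        unfolding s mult.assoc[symmetric] by simp
    qed
    moreover have "pos_sign c (insert c I) * (pos_sign c (insert c I) * ?D c) = ?D c"
      by (simp flip: mult.assoc)
    ultimately show "pos_sign c (insert c I) * (\<Sum>i\<in>insert c I. pos_sign i (insert c I) *
         (x (shift v (E c), insert c I - {i}) - x (shift (shift v (E c)) {i}, insert c I - {i})))
        = ?D c - (\<Sum>i\<in>I. ?g i c)"
      using c fin by (simp add: distrib_left sum_distrib_left sum_negf)
  qed
  have "(\<Sum>i\<in>I. \<Sum>c\<in>{1..d} - I. ?g i c) = (\<Sum>c\<in>{1..d} - I. \<Sum>i\<in>I. ?g i c)" by (rule sum.swap)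
  hence "cobd (homotopy d E x) (v, I) + homotopy d E (cobd x) (v, I) = sum ?D I + sum ?D ({1..d} - I)"
    unfolding 1 2 by (simp add: sum.distrib sum_subtractf)
  also have "\<dots> = sum ?D {1..d}"
    using sum.subset_diff[OF I finite_atLeastAtMost, of ?D] by (simp add: add.commute)
  finally show ?thesis .
qed

abbreviation above :: "nat \<Rightarrow> nat \<Rightarrow> nat set" where "above d c \<equiv> {c<..d}"
abbreviation below :: "nat \<Rightarrow> nat set" where "below c \<equiv> {1..<c}"

text \<open>
  The surviving terms move \<open>v + e\<^bsub>{c+1..d}\<^esub>\<close> to \<open>v + e\<^bsub>{c..d}\<^esub>\<close> and telescope over \<open>c\<close>.
\<close>

lemma homotopy_above:
  fixes x :: "cell \<Rightarrow> 'r::comm_ring_1"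
  assumes I: "I \<subseteq> {1..d}"
  shows "cobd (homotopy d (above d) x) (v, I) + homotopy d (above d) (cobd x) (v, I)
       = x (v, I) - x (shift v {1..d}, I)"
proof -
  have "(\<Sum>c\<in>{1..d}. x (shift v (above d c), I) - x (shift (shift v (above d c)) {c}, I))
      = (\<Sum>c\<in>{1..d}. x (shift v {c<..d}, I) - x (shift v {c - 1<..d}, I))"
  proof (intro sum.cong refl)
    fix c assume "c \<in> {1..d}"
    hence "above d c \<union> {c} = {c - 1<..d}" "above d c \<inter> {c} = {}" by auto
    thus "x (shift v (above d c), I) - x (shift (shift v (above d c)) {c}, I)
      = x (shift v {c<..d}, I) - x (shift v {c - 1<..d}, I)" by (simp only: shift_shift)
  qed
  also have "\<dots> = x (shift v {d<..d}, I) - x (shift v {0<..d}, I)"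
    by (rule sum_telescope_pred)
  also have "{0<..d} = {1..d}" by auto
  finally show ?thesis unfolding homotopy_anticommute[OF I] by (simp add: shift_def)
qed

text \<open>
  The same telescoping, with the directions taken in increasing order.
\<close>

lemma homotopy_below:
  fixes x :: "cell \<Rightarrow> 'r::comm_ring_1"
  assumes I: "I \<subseteq> {1..d}"
  shows "cobd (homotopy d below x) (v, I) + homotopy d below (cobd x) (v, I)
       = x (v, I) - x (shift v {1..d}, I)"
proof -
  have "(\<Sum>c\<in>{1..d}. x (shift v (below c), I) - x (shift (shift v (below c)) {c}, I))
      = (\<Sum>c\<in>{1..d}. - (x (shift v {1..c}, I) - x (shift v {1..c - 1}, I)))"
  proof (intro sum.cong refl)
    fix c assume c: "c \<in> {1..d}"
    hence "below c = {1..c - 1}" by auto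
    moreover have "{1..c - 1} \<union> {c} = {1..c}" "{1..c - 1} \<inter> {c} = {}" using c by auto
    ultimately show "x (shift v (below c), I) - x (shift (shift v (below c)) {c}, I)
      = - (x (shift v {1..c}, I) - x (shift v {1..c - 1}, I))" by (simp add: shift_shift)
  qed
  also have "\<dots> = - (x (shift v {1..d}, I) - x (shift v {1..0}, I))"
    unfolding sum_negf
    by (rule arg_cong[OF sum_telescope_pred])
  finally show ?thesis unfolding homotopy_anticommute[OF I] by (simp add: shift_def)
qed

section \<open>Transposition with respect to the cup product\<close>

text \<open>
  Passing to the complementary cell twice is the translation by \<open>(1, \<dots>, 1)\<close>, with the sign
  \<open>(-1)\<^bsup>inv(J,I) + inv(I,J)\<^esup> = (-1)\<^bsup>n n\<^esup> = -1\<close>.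
\<close>

lemma cup_dual_swap:
  assumes a: "a \<in> cells d n" and b: "b \<in> cells d n" and d: "d = 2 * n" and n: "odd n"
  shows "cup_dual d (chi a) b = - (cup_dual d (\<lambda>(v, I). chi b (shift v {1..d}, I)) a :: 'r::comm_ring_1)"
proof -
  obtain u J where a': "a = (u, J)" by (cases a)
  obtain v K where b': "b = (v, K)" by (cases b)
  let ?I = "{1..d} - J" and ?L = "{1..d} - K"
  have J: "J \<subseteq> {1..d}" "card J = n" and K: "K \<subseteq> {1..d}" "card K = n" using a b a' b'
    by (auto simp: cells_def)
  have fin: "finite J" "finite K" using J K finite_subset by blast+
  have cI: "card ?I = n" using J d fin by (simp add: card_Diff_subset)
  have eq: "unshift v ?L = u \<and> ?L = J \<longleftrightarrow> shift (unshift u ?I) {1..d} = v \<and> ?I = K"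
  proof -
    have "?L = J \<longleftrightarrow> ?I = K" using J K by auto
    moreover have "unshift v J = u \<longleftrightarrow> shift (unshift u ?I) {1..d} = v"
    proof -
      have "shift (unshift u ?I) {1..d} = shift u J" using J
        by (auto simp: shift_def unshift_def fun_eq_iff)
      thus ?thesis using shift_eq_iff[of u J v] by auto
    qed
    ultimately show ?thesis by metis
  qed
  show ?thesis
  proof (cases "?I = K")
    case True
    have "inversions J K + inversions K J = n * n"
      using inversions_swap[OF fin] J K True by auto
    hence "odd (inversions J K + inversions K J)" using n by simp
    hence "(- 1) ^ inversions K J = - ((- 1) ^ inversions J K :: 'r)"
      by (metis even_add minus_one_power_iff minus_minus)
    moreover have "?L = J" using True J by auto
    ultimately show ?thesis using eq True by (auto simp: cup_dual_def a' b')
  next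
    case False
    thus ?thesis using eq by (auto simp: cup_dual_def a' b')
  qed
qed

text \<open>
  The right-hand side does not depend on \<open>i\<close>. This is what makes the cup product compatible with the
  coboundary: moving an index from one factor to the other costs a sign determined by the union and
  the common part alone.
\<close>

lemma sign_move_index:
  assumes "finite M" "finite I0" "i \<in> M" "i \<notin> I0"
  shows "(- 1) ^ inversions (M - {i}) (insert i I0) * pos_sign i (insert i I0) * pos_sign i M
      = ((- 1) ^ (inversions M I0 + card I0) :: 'r::comm_ring_1)"
proof -
  let ?J = "M - {i}"
  have M: "M = insert i ?J" using assms by auto
  have f: "finite ?J" using assms by simp
  have 1: "inversions M I0 = inversions ?J I0 + card {m \<in> I0. i < m}"
    by (subst M) (rule inversions_insert_left, use assms f in auto)
  have 2: "inversions ?J (insert i I0) = inversions ?J I0 + card {j \<in> ?J. j < i}"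
    by (rule inversions_insert_right) (use assms f in auto)
  have 3: "pos_sign i M = - ((- 1) ^ card {j \<in> ?J. j < i} :: 'r)"
    by (subst M) (rule pos_sign_insert_self, use f in auto)
  have 4: "pos_sign i (insert i I0) = - ((- 1) ^ card {j \<in> I0. j < i} :: 'r)"
    by (rule pos_sign_insert_self) (use assms in auto)
  have 5: "card {j \<in> I0. j < i} + card {j \<in> I0. i < j} = card I0"
    by (rule card_less_greater) (use assms in auto)
  show ?thesis unfolding 1 2 3 4 5[symmetric]
    by (simp add: power_add[symmetric]) (rule minus_one_power_cong, simp, argo)
qed

text \<open>
  Both sides are sums over pairs: a direction \<open>i\<close> is moved from the complement of \<open>J\<close> to \<open>J\<close>, and a
  direction \<open>c\<close> the other way. The terms match one to one. The two end points of the edge in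
  direction \<open>i\<close> trade places, which gives a minus sign, and exchanging \<open>K\<close> with its complement gives
  another, because \<open>n n\<close> is odd.
  The shifts are compatible because \<open>E c\<close>, \<open>E' c\<close> and \<open>c\<close> together make up all directions.
\<close>

lemma cup_dual_cobd_homotopy_swap:
  fixes d n :: nat
  assumes a: "a \<in> cells d n" and b: "b \<in> cells d n" and d: "d = 2 * n" and n: "odd n"
    and E: "\<And>c. c \<in> {1..d} \<Longrightarrow> E c \<union> E' c \<union> {c} = {1..d} \<and> E c \<inter> E' c = {} \<and> c \<notin> E c \<and> c \<notin> E' c"
  shows "cup_dual d (cobd (homotopy d E (chi b))) a = (cup_dual d (homotopy d E' (cobd (chi a))) b :: 'r::comm_ring_1)"
proof -
  obtain u J where a': "a = (u, J)" by (cases a)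
  obtain v K where b': "b = (v, K)" by (cases b)
  let ?N = "{1..d}"
  let ?I = "?N - J" and ?L = "?N - K"
  have J: "J \<subseteq> ?N" "card J = n" and K: "K \<subseteq> ?N" "card K = n" using a b a' b' by (auto simp: cells_def)
  have fin: "finite J" "finite K" using J K finite_subset by blast+
  let ?P = "\<lambda>i c. i \<in> ?I \<and> c \<in> ?N \<and> c \<notin> ?I - {i} \<and> K = insert c (?I - {i})"
  let ?V = "\<lambda>i c. of_bool (v = shift (unshift u ?I) (E c)) - of_bool (v = shift (shift (unshift u ?I) {i}) (E c)) :: 'r"
  let ?s = "\<lambda>i c. (- 1) ^ inversions J ?I * pos_sign i ?I * pos_sign c (insert c (?I - {i})) * ?V i c"
  let ?Q = "\<lambda>i c. c \<in> K \<and> i \<in> ?N \<and> i \<notin> K - {c} \<and> J = insert c ?L - {i}"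
  let ?V' = "\<lambda>i c. of_bool (u = shift (unshift v ?L) (E' c)) - of_bool (u = shift (shift (unshift v ?L) (E' c)) {i}) :: 'r"
  let ?t = "\<lambda>i c. (- 1) ^ inversions K ?L * pos_sign c (insert c ?L) * pos_sign i (insert c ?L) * ?V' i c"
  have l: "cup_dual d (cobd (homotopy d E (chi b))) a = (\<Sum>i\<in>?N. \<Sum>c\<in>?N. if ?P i c then ?s i c else 0)"
  proof -
    have "cup_dual d (cobd (homotopy d E (chi b))) a = (\<Sum>i\<in>?I. \<Sum>c\<in>?N - (?I - {i}).
        if K = insert c (?I - {i}) then ?s i c else 0)"
      unfolding a' b' cup_dual_def cobd_def homotopy_def prod.case sum_distrib_left sum_subtractf[symmetric]
      by (intro sum.cong refl) (auto simp: algebra_simps)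
    also have "\<dots> = (\<Sum>i\<in>?I. \<Sum>c\<in>?N. if ?P i c then ?s i c else 0)"
      by (intro sum.cong[OF refl] sum.mono_neutral_cong_left) auto
    also have "\<dots> = (\<Sum>i\<in>?N. \<Sum>c\<in>?N. if ?P i c then ?s i c else 0)"
      by (intro sum.mono_neutral_left) auto
    finally show ?thesis .
  qed
  have r: "cup_dual d (homotopy d E' (cobd (chi a))) b = (\<Sum>c\<in>?N. \<Sum>i\<in>?N. if ?Q i c then ?t i c else 0)"
  proof -
    have "cup_dual d (homotopy d E' (cobd (chi a))) b = (\<Sum>c\<in>?N - ?L. \<Sum>i\<in>insert c ?L.
        if J = insert c ?L - {i} then ?t i c else 0)"
      unfolding a' b' cup_dual_def cobd_def homotopy_def prod.case sum_distrib_left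
      by (intro sum.cong refl) (auto simp: algebra_simps)
    also have "\<dots> = (\<Sum>c\<in>?N - ?L. \<Sum>i\<in>?N. if ?Q i c then ?t i c else 0)"
      by (intro sum.cong[OF refl] sum.mono_neutral_cong_left) auto
    also have "\<dots> = (\<Sum>c\<in>?N. \<Sum>i\<in>?N. if ?Q i c then ?t i c else 0)"
      by (intro sum.mono_neutral_left) auto
    finally show ?thesis .
  qed
  have "(if ?P i c then ?s i c else 0) = (if ?Q i c then ?t i c else 0)" if N: "i \<in> ?N" "c \<in> ?N" for i c
  proof -
    \<comment> \<open>The two sums select the same pairs, those with \<open>K = (I - i) + c\<close>.\<close>
    have PQ: "?P i c \<longleftrightarrow> ?Q i c"
    proof
      assume P: "?P i c"
      hence "J = insert c ?L - {i}" using J N by auto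
      thus "?Q i c" using P N by auto
    next
      assume Q: "?Q i c"
      hence "K = insert c (?I - {i})" using K N by auto
      thus "?P i c" using Q N by auto
    qed
    have st: "?s i c = ?t i c" if P: "?P i c"
    proof -
      \<comment> \<open>The union \<open>M\<close> and the common part \<open>I0\<close> are the same for \<open>(J, i)\<close> and for the complement of \<open>K\<close> and \<open>c\<close>.\<close>
      define M I0 where "M = insert i J" and "I0 = ?I - {i}"
      note Q = iffD1[OF PQ P]
      have iI: "i \<in> ?I" and cI: "c \<notin> ?I - {i}"
        by (rule P[THEN conjunct1], rule P[THEN conjunct2, THEN conjunct2, THEN conjunct1])
      have cK: "c \<in> K" and iK: "i \<notin> K - {c}"
        by (rule Q[THEN conjunct1], rule Q[THEN conjunct2, THEN conjunct2, THEN conjunct1])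
      have Keq: "K = insert c (?I - {i})" and Jeq: "J = insert c ?L - {i}"
        by (rule P[THEN conjunct2, THEN conjunct2, THEN conjunct2], rule Q[THEN conjunct2, THEN conjunct2, THEN conjunct2])
      have "i \<in> insert c ?L" using iK N by auto
      hence M': "M = insert c ?L" unfolding M_def by (subst Jeq) (rule insert_Diff)
      have K': "K = insert c I0" unfolding I0_def by (rule Keq)
      have c: "c \<notin> I0" using cI unfolding I0_def .
      have cM: "c \<in> M" unfolding M' by simp
      have i: "i \<notin> I0" "i \<in> M" "i \<notin> J" using iI unfolding I0_def M_def by auto
      have I': "?I = insert i I0" using iI unfolding I0_def by auto
      have J': "J = M - {i}" using M_def i by auto
      have L': "?L = M - {c}" using cK by (simp add: M')
      have f: "finite M" "finite I0" using M_def I0_def fin by auto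
      have si: "(- 1) ^ inversions J ?I * pos_sign i ?I * pos_sign i M = ((- 1) ^ (inversions M I0 + card I0) :: 'r)"
        using sign_move_index[of M I0 i] f i J' I' by simp
      have sc: "(- 1) ^ inversions ?L K * pos_sign c K * pos_sign c M = ((- 1) ^ (inversions M I0 + card I0) :: 'r)"
        using sign_move_index[of M I0 c] f c cM L' K' by simp
      have cL: "card ?L = n" using K d fin by (simp add: card_Diff_subset)
      have "inversions ?L K + inversions K ?L = n * n"
        using inversions_swap[of ?L K] fin K cL by auto
      hence "odd (inversions ?L K + inversions K ?L)" using n by simp
      hence sw: "(- 1) ^ inversions ?L K = - ((- 1) ^ inversions K ?L :: 'r)"
        by (metis even_add minus_one_power_iff minus_minus)
      have "(- 1) ^ inversions J ?I * pos_sign i ?I * (pos_sign c K :: 'r)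
          = (- 1) ^ inversions J ?I * pos_sign i ?I * (pos_sign i M * pos_sign i M) * (pos_sign c K :: 'r)" by simp
      also have "\<dots> = ((- 1) ^ inversions J ?I * pos_sign i ?I * pos_sign i M) * (pos_sign i M * (pos_sign c K :: 'r))"
        by (simp only: mult_ac)
      also have "\<dots> = (- 1) ^ inversions ?L K * pos_sign c K * pos_sign c M * (pos_sign i M * (pos_sign c K :: 'r))"
        by (simp only: si sc)
      also have "\<dots> = (- 1) ^ inversions ?L K * pos_sign c M * pos_sign i M * (pos_sign c K * pos_sign c K)"
        by (simp only: mult_ac)
      finally have s: "(- 1) ^ inversions J ?I * pos_sign i ?I * (pos_sign c K :: 'r)
          = - ((- 1) ^ inversions K ?L * pos_sign c M * pos_sign i M)" by (simp only: sw mult_minus_left pos_sign_square mult_1_right)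
      have Ec: "E c \<union> E' c \<union> {c} = ?N" "E c \<inter> E' c = {}" "c \<notin> E c" "c \<notin> E' c" using E N by auto
      have pt: "of_bool (q \<in> ?I) + of_bool (q \<in> ?L) = of_bool (q \<in> ?N) + of_bool (q = i) - (of_bool (q = c) :: int)" for q
      proof -
        have "c \<in> insert i J" using cM unfolding M_def .
        thus ?thesis using J(1) N i(3) unfolding L' unfolding M_def
          by (cases "q = i"; cases "q = c"; cases "q \<in> J") auto
      qed
      have pE: "of_bool (q \<in> E c) + of_bool (q \<in> E' c) + of_bool (q = c) = (of_bool (q \<in> ?N) :: int)" for q
        using Ec by auto
      have 1: "v = shift (unshift u ?I) (E c) \<longleftrightarrow> u = shift (shift (unshift v ?L) (E' c)) {i}"
      proof -
        have "v q = u q - of_bool (q \<in> ?I) + of_bool (q \<in> E c) \<longleftrightarrow>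
            u q = v q - of_bool (q \<in> ?L) + of_bool (q \<in> E' c) + of_bool (q = i)" for q
          using pt[of q] pE[of q] by linarith
        thus ?thesis by (simp add: fun_eq_iff shift_def unshift_def)
      qed
      have 2: "v = shift (shift (unshift u ?I) {i}) (E c) \<longleftrightarrow> u = shift (unshift v ?L) (E' c)"
      proof -
        have "v q = u q - of_bool (q \<in> ?I) + of_bool (q = i) + of_bool (q \<in> E c) \<longleftrightarrow>
            u q = v q - of_bool (q \<in> ?L) + of_bool (q \<in> E' c)" for q
          using pt[of q] pE[of q] by linarith
        thus ?thesis by (simp add: fun_eq_iff shift_def unshift_def)
      qed
      show ?thesis unfolding 1 2 M'[symmetric] K'[symmetric, unfolded I0_def] s by (simp add: algebra_simps)
    qed
    show ?thesis by (rule if_cong[OF PQ st[OF iffD2[OF PQ]] refl])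
  qed
  hence "(\<Sum>i\<in>?N. \<Sum>c\<in>?N. if ?P i c then ?s i c else 0) = (\<Sum>i\<in>?N. \<Sum>c\<in>?N. if ?Q i c then ?t i c else 0)"
    by (intro sum.cong refl)
  also have "\<dots> = (\<Sum>c\<in>?N. \<Sum>i\<in>?N. if ?Q i c then ?t i c else 0)" by (rule sum.swap)
  finally show ?thesis using l r by simp
qed

section \<open>The exponents of the generators as a linear map on cochains\<close>

definition cochain_linear :: "((cell \<Rightarrow> 'r) \<Rightarrow> cell \<Rightarrow> 'r::field) \<Rightarrow> bool" where
  "cochain_linear T \<longleftrightarrow> (\<forall>x y k. T (\<lambda>c. x c + k * y c) = (\<lambda>c. T x c + k * T y c))"

lemma cochain_linear_comp: "cochain_linear S \<Longrightarrow> cochain_linear T \<Longrightarrow> cochain_linear (\<lambda>x. S (T x))"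
  by (simp add: cochain_linear_def)

lemma cochain_linear_mult: "cochain_linear T \<Longrightarrow> cochain_linear (\<lambda>x c. k * T x c)"
  by (simp add: cochain_linear_def algebra_simps)

lemma cochain_linear_add: "cochain_linear T \<Longrightarrow> T (\<lambda>c. x c + y c) = (\<lambda>c. T x c + T y c)"
  unfolding cochain_linear_def by (erule allE[of _ x], erule allE[of _ y], erule allE[of _ 1]) simp

lemma cochain_linear_diff: "cochain_linear T \<Longrightarrow> T (\<lambda>c. x c - y c) = (\<lambda>c. T x c - T y c)"
  unfolding cochain_linear_def by (erule allE[of _ x], erule allE[of _ y], erule allE[of _ "- 1"]) simp

lemma cochain_linear_zero: "cochain_linear T \<Longrightarrow> T (\<lambda>c. 0) = (\<lambda>c. 0)"
  using cochain_linear_diff[of T "\<lambda>c. 0" "\<lambda>c. 0"] by simp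

lemma cochain_linear_scale:
  assumes "cochain_linear T"
  shows "T (\<lambda>c. k * y c) = (\<lambda>c. k * T y c)"
proof -
  have "T (\<lambda>c. 0 + k * y c) = (\<lambda>c. T (\<lambda>c. 0) c + k * T y c)"
    using assms unfolding cochain_linear_def by (elim allE)
  thus ?thesis by (simp add: cochain_linear_zero[OF assms])
qed

lemma cochain_linear_sum:
  assumes "cochain_linear T" "finite F"
  shows "T (\<lambda>c. \<Sum>i\<in>F. k i * y i c) = (\<lambda>c. \<Sum>i\<in>F. k i * T (y i) c)"
  using assms(2)
proof (induction F rule: finite_induct)
  case (insert j F)
  have "T (\<lambda>c. \<Sum>i\<in>insert j F. k i * y i c) = T (\<lambda>c. k j * y j c + (\<Sum>i\<in>F. k i * y i c))"
    using insert.hyps by simp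
  also have "\<dots> = (\<lambda>c. \<Sum>i\<in>insert j F. k i * T (y i) c)"
    unfolding cochain_linear_add[OF assms(1)] cochain_linear_scale[OF assms(1)] insert.IH using insert.hyps
      by simp
  finally show ?case .
qed (simp add: cochain_linear_zero[OF assms(1)])

lemma cochain_linear_cobd: "cochain_linear cobd"
  unfolding cochain_linear_def
proof (intro allI ext)
  fix x y :: "cell \<Rightarrow> 'a" and k c
  show "cobd (\<lambda>c. x c + k * y c) c = cobd x c + k * cobd y c"
    by (cases c) (simp add: cobd_def sum_distrib_left ring_distribs mult.left_commute[of k] sum.distrib sum_subtractf)
qed

lemma cochain_linear_homotopy: "cochain_linear (homotopy d E)"
  unfolding cochain_linear_def
proof (intro allI ext)
  fix x y :: "cell \<Rightarrow> 'a" and k c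
  show "homotopy d E (\<lambda>c. x c + k * y c) c = homotopy d E x c + k * homotopy d E y c"
    by (cases c) (simp add: homotopy_def sum_distrib_left ring_distribs mult.left_commute[of k] sum.distrib)
qed

lemma cochain_linear_cup_dual: "cochain_linear (cup_dual d)"
  by (auto simp: cochain_linear_def cup_dual_def fun_eq_iff algebra_simps)

text \<open>
  Transposition with respect to the cup product exchanges the two homotopies
  (\<open>cup_dual_cobd_homotopy_swap\<close>), so it preserves their average. The average comes from the difference
  of the two \<open>\<union>\<^sub>1\<close>-products, with coefficient \<open>1/2\<close>, in the generators.
\<close>

definition mean_homotopy :: "nat \<Rightarrow> (cell \<Rightarrow> 'r::field) \<Rightarrow> cell \<Rightarrow> 'r" where
  "mean_homotopy d x = (\<lambda>c. (homotopy d (above d) x c + homotopy d below x c) / 2)"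

lemma mean_homotopy_eq: "mean_homotopy d x = (\<lambda>c. inverse 2 * (homotopy d (above d) x c + homotopy d below x c))"
  unfolding mean_homotopy_def by (simp only: divide_inverse mult.commute)

lemma cochain_linear_mean_homotopy: "cochain_linear (mean_homotopy d)"
  unfolding mean_homotopy_eq
    using cochain_linear_homotopy[of d "above d", where ?'a = 'a] cochain_linear_homotopy[of d below, where ?'a = 'a]
  by (intro cochain_linear_mult) (simp add: cochain_linear_def algebra_simps)

definition homotopy_correction :: "nat \<Rightarrow> (cell \<Rightarrow> 'r::field) \<Rightarrow> cell \<Rightarrow> 'r" where
  "homotopy_correction d x = (\<lambda>c. x c - mean_homotopy d (cobd x) c)"

lemma cochain_linear_homotopy_correction: "cochain_linear (homotopy_correction d)"
proof -
  have "cochain_linear (\<lambda>x. mean_homotopy d (cobd x) :: cell \<Rightarrow> 'a)"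
    by (rule cochain_linear_comp[OF cochain_linear_mean_homotopy cochain_linear_cobd])
  thus ?thesis by (simp add: cochain_linear_def homotopy_correction_def algebra_simps)
qed

text \<open>
  \<open>exponent_map d k (chi b) a\<close> is the exponent \<open>w\<^sub>a(b)\<close> of \<open>Z\<^sub>b\<close> in the generator at \<open>a\<close>, for
  \<open>n\<close>-cells \<open>a\<close> and \<open>b\<close> in dimension \<open>d = 2n\<close>.
\<close>

definition exponent_map :: "nat \<Rightarrow> 'r::field \<Rightarrow> (cell \<Rightarrow> 'r) \<Rightarrow> cell \<Rightarrow> 'r" where
  "exponent_map d k x = (\<lambda>c. k * cup_dual d (homotopy_correction d x) c)"

lemma cochain_linear_exponent_map: "cochain_linear (exponent_map d k)"
proof -
  have "cochain_linear (\<lambda>x. cup_dual d (homotopy_correction d x) :: cell \<Rightarrow> 'a)"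
    by (rule cochain_linear_comp[OF cochain_linear_cup_dual cochain_linear_homotopy_correction])
  thus ?thesis by (simp add: cochain_linear_def exponent_map_def distrib_left mult.left_commute)
qed

section \<open>Locality\<close>

text \<open>
  A bound on the range of an operation from \<open>m\<close>-cochains to \<open>m'\<close>-cochains, phrased by supports. It
  composes by adding radii and, for linear operations, also says that a value depends only
  on nearby values on genuine \<open>m\<close>-cells; the last point matters because cochains are defined on all
  pairs \<open>(v, I)\<close>.
\<close>

definition cochain_local :: "nat \<Rightarrow> int \<Rightarrow> nat \<Rightarrow> nat \<Rightarrow> ((cell \<Rightarrow> 'r) \<Rightarrow> cell \<Rightarrow> 'r::field) \<Rightarrow> bool" where
  "cochain_local d R m m' T \<longleftrightarrow> (\<forall>x. \<forall>b\<in>cells d m'. T x b \<noteq> 0 \<longrightarrow> (\<exists>a\<in>cells d m. cell_dist d b a \<le> R \<and> x a \<noteq> 0))"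

lemma cell_dist_commute: "cell_dist d a b = cell_dist d b a"
  unfolding cell_dist_def by (intro sum.cong refl) linarith

lemma cell_dist_triangle: "cell_dist d a c \<le> cell_dist d a b + cell_dist d b c"
  unfolding cell_dist_def sum.distrib[symmetric] by (intro sum_mono) linarith

lemma cell_dist_self [simp]: "cell_dist d a a = 0"
  by (simp add: cell_dist_def)

lemma cell_dist_near:
  assumes "\<And>i. \<bar>fst a i - fst b i\<bar> \<le> 1"
  shows "cell_dist d a b \<le> int d"
proof -
  have "cell_dist d a b \<le> (\<Sum>i=1..d. 1)" unfolding cell_dist_def by (intro sum_mono assms)
  thus ?thesis by simp
qed

lemma cochain_local_comp:
  assumes "cochain_local d R m' m'' S" "cochain_local d Q m m' T"
  shows "cochain_local d (R + Q) m m'' (\<lambda>x. S (T x))"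
  unfolding cochain_local_def
proof (intro allI ballI impI)
  fix x b assume "b \<in> cells d m''" "S (T x) b \<noteq> 0"
  then obtain c where c: "c \<in> cells d m'" "cell_dist d b c \<le> R" "T x c \<noteq> 0"
    using assms(1) unfolding cochain_local_def by blast
  then obtain a where "a \<in> cells d m" "cell_dist d c a \<le> Q" "x a \<noteq> 0"
    using assms(2) unfolding cochain_local_def by blast
  thus "\<exists>a\<in>cells d m. cell_dist d b a \<le> R + Q \<and> x a \<noteq> 0"
    using c cell_dist_triangle[of d b a c] by (intro bexI[of _ a]) auto
qed

lemma cochain_local_diff_fun:
  assumes "cochain_local d R m m' S" "cochain_local d R m m' T"
  shows "cochain_local d R m m' (\<lambda>x c. S x c - T x c)"
  unfolding cochain_local_def
proof (intro allI ballI impI)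
  fix x b assume b: "b \<in> cells d m'" "S x b - T x b \<noteq> 0"
  hence "S x b \<noteq> 0 \<or> T x b \<noteq> 0" by auto
  thus "\<exists>a\<in>cells d m. cell_dist d b a \<le> R \<and> x a \<noteq> 0"
    using assms b(1) unfolding cochain_local_def by blast
qed

lemma cochain_local_id: "0 \<le> R \<Longrightarrow> cochain_local d R m m (\<lambda>x. x)"
  unfolding cochain_local_def by (metis cell_dist_self)

lemma cochain_local_cong:
  assumes "cochain_linear T" "cochain_local d R m m' T" "b \<in> cells d m'" "\<And>a. a \<in> cells d m \<Longrightarrow> x a = y a"
  shows "T x b = T y b"
proof (rule ccontr)
  assume "T x b \<noteq> T y b"
  hence "T (\<lambda>c. x c - y c) b \<noteq> 0" by (simp add: cochain_linear_diff[OF assms(1)])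
  then obtain a where "a \<in> cells d m" "x a - y a \<noteq> 0"
    using assms(2,3) unfolding cochain_local_def by blast
  thus False using assms(4) by simp
qed

lemma finite_ball: "finite {a \<in> cells d m. cell_dist d a c \<le> R}"
proof -
  let ?B = "\<Union>i\<in>{1..d}. {fst c i - R..fst c i + R}"
  have "{a \<in> cells d m. cell_dist d a c \<le> R} \<subseteq>
      {v. \<forall>i. (i \<in> {1..d} \<longrightarrow> v i \<in> ?B) \<and> (i \<notin> {1..d} \<longrightarrow> v i = 0)} \<times> Pow {1..d}"
  proof
    fix a assume "a \<in> {a \<in> cells d m. cell_dist d a c \<le> R}"
    then obtain v I where a: "a = (v, I)" "(v, I) \<in> cells d m" and D: "cell_dist d (v, I) c \<le> R"
      by (cases a) auto
    have "v i \<in> ?B" if i: "i \<in> {1..d}" for i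
    proof -
      have "\<bar>v i - fst c i\<bar> \<le> cell_dist d (v, I) c"
        unfolding cell_dist_def fst_conv using i by (intro member_le_sum) auto
      hence "v i \<in> {fst c i - R..fst c i + R}" using D by auto
      thus "v i \<in> ?B" using i by blast
    qed
    thus "a \<in> {v. \<forall>i. (i \<in> {1..d} \<longrightarrow> v i \<in> ?B) \<and> (i \<notin> {1..d} \<longrightarrow> v i = 0)} \<times> Pow {1..d}"
      using a unfolding cells_def by blast
  qed
  moreover have "finite ({v. \<forall>i. (i \<in> {1..d} \<longrightarrow> v i \<in> ?B) \<and> (i \<notin> {1..d} \<longrightarrow> v i = 0)} \<times> Pow {1..d})"
    by (intro finite_cartesian_product finite_set_of_finite_funs) auto
  ultimately show ?thesis by (rule finite_subset)
qed

lemma finite_ball': "finite {a \<in> cells d m. cell_dist d c a \<le> R}"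
  using finite_ball[of d m c R] by (simp add: cell_dist_commute[of d c])

text \<open>
  A linear local operation is determined by its matrix: near a given cell the argument can be replaced
  by a finite combination of indicators.
\<close>

lemma local_linear_expand:
  assumes "cochain_linear T" "cochain_local d R m m' T" "b \<in> cells d m'" "finite F" "F \<subseteq> cells d m"
    and "\<And>a. a \<in> cells d m \<Longrightarrow> cell_dist d b a \<le> R \<Longrightarrow> x a \<noteq> 0 \<Longrightarrow> a \<in> F"
  shows "T x b = (\<Sum>a\<in>F. x a * T (chi a) b)"
proof -
  let ?y = "\<lambda>c. \<Sum>a\<in>F. x a * chi a c"
  have y: "?y c = (if c \<in> F then x c else 0)" for c
    using assms(4) by (simp add: of_bool_def if_distrib[of "\<lambda>u. _ * u"] sum.delta cong: if_cong)
  have "T x b = T ?y b"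
  proof (rule ccontr)
    assume "T x b \<noteq> T ?y b"
    hence "T (\<lambda>c. x c - ?y c) b \<noteq> 0" by (simp add: cochain_linear_diff[OF assms(1)])
    then obtain a where "a \<in> cells d m" "cell_dist d b a \<le> R" "x a - ?y a \<noteq> 0"
      using assms(2,3) unfolding cochain_local_def by blast
    thus False using assms(6) y[of a] by (cases "a \<in> F") auto
  qed
  also have "\<dots> = (\<Sum>a\<in>F. x a * T (chi a) b)" by (simp add: cochain_linear_sum[OF assms(1,4)])
  finally show ?thesis .
qed

lemma cells_shift [simp]: "A \<subseteq> {1..d} \<Longrightarrow> (shift v A, I) \<in> cells d m \<longleftrightarrow> (v, I) \<in> cells d m"
  by (auto simp: cells_def shift_def subset_iff)

lemma cells_unshift [simp]: "A \<subseteq> {1..d} \<Longrightarrow> (unshift v A, I) \<in> cells d m \<longleftrightarrow> (v, I) \<in> cells d m"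
  by (auto simp: cells_def unshift_def subset_iff)

lemma cells_finite: "(v, I) \<in> cells d m \<Longrightarrow> finite I"
  by (auto simp: cells_def intro: finite_subset[OF _ finite_atLeastAtMost])

lemma cells_remove: "(v, I) \<in> cells d (Suc m) \<Longrightarrow> i \<in> I \<Longrightarrow> (v, I - {i}) \<in> cells d m"
  using cells_finite[of v I d "Suc m"] by (auto simp: cells_def)

lemma cells_insert: "(v, I) \<in> cells d m \<Longrightarrow> i \<in> {1..d} - I \<Longrightarrow> (v, insert i I) \<in> cells d (Suc m)"
  using cells_finite[of v I d m] by (auto simp: cells_def)

lemma cells_complement: "(v, I) \<in> cells (2 * m) m \<Longrightarrow> (v, {1..2 * m} - I) \<in> cells (2 * m) m"
  using cells_finite[of v I "2 * m" m] by (auto simp: cells_def card_Diff_subset)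

lemma cochain_local_cobd: "cochain_local d (int d) m (Suc m) cobd"
  unfolding cochain_local_def
proof (intro allI ballI impI)
  fix x :: "cell \<Rightarrow> 'a" and b assume b: "b \<in> cells d (Suc m)" and nz: "cobd x b \<noteq> 0"
  obtain v I where b': "b = (v, I)" by (cases b)
  from nz obtain i where i: "i \<in> I" "x (v, I - {i}) - x (shift v {i}, I - {i}) \<noteq> 0"
    unfolding b' cobd_def prod.case using sum.not_neutral_contains_not_neutral
    by (metis (no_types, lifting) mult_zero_right)
  have "{i} \<subseteq> {1..d}" using b b' i by (auto simp: cells_def)
  hence c: "(v, I - {i}) \<in> cells d m" "(shift v {i}, I - {i}) \<in> cells d m"
    using cells_remove[of v I d m i] b b' i by auto
  have "cell_dist d b (v, I - {i}) \<le> int d" "cell_dist d b (shift v {i}, I - {i}) \<le> int d"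
    by (intro cell_dist_near, simp add: b' shift_def)+
  moreover have "x (v, I - {i}) \<noteq> 0 \<or> x (shift v {i}, I - {i}) \<noteq> 0" using i(2) by auto
  ultimately show "\<exists>a\<in>cells d m. cell_dist d b a \<le> int d \<and> x a \<noteq> 0" using c by blast
qed

lemma cochain_local_homotopy:
  assumes "\<And>c. c \<in> {1..d} \<Longrightarrow> E c \<subseteq> {1..d}"
  shows "cochain_local d (int d) (Suc m) m (homotopy d E)"
  unfolding cochain_local_def
proof (intro allI ballI impI)
  fix x :: "cell \<Rightarrow> 'a" and b assume b: "b \<in> cells d m" and nz: "homotopy d E x b \<noteq> 0"
  obtain v I where b': "b = (v, I)" by (cases b)
  from nz obtain c where c: "c \<in> {1..d} - I" "x (shift v (E c), insert c I) \<noteq> 0"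
    unfolding b' homotopy_def prod.case using sum.not_neutral_contains_not_neutral
    by (metis (no_types, lifting) mult_zero_right)
  have "(shift v (E c), insert c I) \<in> cells d (Suc m)"
    using cells_insert[of v I d m c] b b' c assms[of c] by auto
  moreover have "cell_dist d b (shift v (E c), insert c I) \<le> int d"
    by (intro cell_dist_near) (simp add: b' shift_def)
  ultimately show "\<exists>a\<in>cells d (Suc m). cell_dist d b a \<le> int d \<and> x a \<noteq> 0" using c by blast
qed

lemma cochain_local_mean_homotopy: "cochain_local d (int d) (Suc m) m (mean_homotopy d)"
proof -
  have 1: "cochain_local d (int d) (Suc m) m (homotopy d (above d) :: (cell \<Rightarrow> 'a) \<Rightarrow> _)"
    by (rule cochain_local_homotopy) auto
  have 2: "cochain_local d (int d) (Suc m) m (homotopy d below :: (cell \<Rightarrow> 'a) \<Rightarrow> _)"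
    by (rule cochain_local_homotopy) auto
  show ?thesis unfolding cochain_local_def
  proof (intro allI ballI impI)
    fix x :: "cell \<Rightarrow> 'a" and b assume b: "b \<in> cells d m" and "mean_homotopy d x b \<noteq> 0"
    hence "homotopy d (above d) x b \<noteq> 0 \<or> homotopy d below x b \<noteq> 0" by (auto simp: mean_homotopy_def)
    thus "\<exists>a\<in>cells d (Suc m). cell_dist d b a \<le> int d \<and> x a \<noteq> 0"
      using 1 2 b unfolding cochain_local_def by blast
  qed
qed

lemma cochain_local_cup_dual:
  assumes "d = 2 * n"
  shows "cochain_local d (int d) n n (cup_dual d)"
  unfolding cochain_local_def
proof (intro allI ballI impI)
  fix x :: "cell \<Rightarrow> 'a" and b assume b: "b \<in> cells d n" and nz: "cup_dual d x b \<noteq> 0"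
  obtain u J where b': "b = (u, J)" by (cases b)
  let ?a = "(unshift u ({1..d} - J), {1..d} - J)"
  have "x ?a \<noteq> 0" using nz by (auto simp: b' cup_dual_def)
  moreover have "?a \<in> cells d n" using cells_complement[of u J n] b b' assms by auto
  moreover have "cell_dist d b ?a \<le> int d" by (intro cell_dist_near) (simp add: b' unshift_def)
  ultimately show "\<exists>a\<in>cells d n. cell_dist d b a \<le> int d \<and> x a \<noteq> 0" by blast
qed

lemma cochain_local_mono: "cochain_local d R m m' T \<Longrightarrow> R \<le> R' \<Longrightarrow> cochain_local d R' m m' T"
  unfolding cochain_local_def by (meson order_trans)

lemma cochain_local_homotopy_correction: "cochain_local d (2 * int d) n n (homotopy_correction d)"
proof -
  have "cochain_local d (int d + int d) n n (\<lambda>x. mean_homotopy d (cobd x) :: cell \<Rightarrow> 'a)"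
    by (rule cochain_local_comp[OF cochain_local_mean_homotopy cochain_local_cobd])
  hence "cochain_local d (2 * int d) n n (\<lambda>x a. x a - mean_homotopy d (cobd x) a :: 'a)"
    by (intro cochain_local_diff_fun cochain_local_id) (simp_all flip: mult_2)
  thus ?thesis by (simp add: cochain_local_def homotopy_correction_def)
qed

lemma cochain_local_exponent_map:
  assumes "d = 2 * n"
  shows "cochain_local d (3 * int d) n n (exponent_map d k)"
proof -
  have "cochain_local d (3 * int d) n n (\<lambda>x. cup_dual d (homotopy_correction d x) :: cell \<Rightarrow> 'a)"
    by (rule cochain_local_mono[OF cochain_local_comp[OF cochain_local_cup_dual[OF assms] cochain_local_homotopy_correction]]) simp
  thus ?thesis unfolding exponent_map_def cochain_local_def by (metis mult_zero_right)
qed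

section \<open>Inverse and antisymmetry of the exponent matrix\<close>

lemma mean_homotopy_formula:
  fixes x :: "cell \<Rightarrow> 'r::field"
  assumes "(2::'r) \<noteq> 0" "I \<subseteq> {1..d}"
  shows "cobd (mean_homotopy d x) (v, I) + mean_homotopy d (cobd x) (v, I) = x (v, I) - x (shift v {1..d}, I)"
proof -
  have "cobd (mean_homotopy d x) = (\<lambda>c. inverse 2 * (cobd (homotopy d (above d) x) c + cobd (homotopy d below x) c))"
    by (simp only: mean_homotopy_eq cochain_linear_scale[OF cochain_linear_cobd] cochain_linear_add[OF cochain_linear_cobd])
  hence "2 * (cobd (mean_homotopy d x) (v, I) + mean_homotopy d (cobd x) (v, I))
      = (cobd (homotopy d (above d) x) (v, I) + homotopy d (above d) (cobd x) (v, I))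
      + (cobd (homotopy d below x) (v, I) + homotopy d below (cobd x) (v, I))"
    by (simp only: mean_homotopy_eq[of d "cobd x"] distrib_left mult.assoc[symmetric] right_inverse[OF assms(1)] mult_1_left)
      (simp only: add_ac)
  also have "\<dots> = 2 * (x (v, I) - x (shift v {1..d}, I))"
    unfolding homotopy_above[OF assms(2)] homotopy_below[OF assms(2)] by simp
  finally show ?thesis by (simp only: mult_left_cancel[OF assms(1)])
qed

text \<open>
  \<open>(1 - g \<delta>) (1 - \<delta> g) y = y - \<delta> g y - g \<delta> y + g \<delta> \<delta> g y\<close>. The last term vanishes, and the homotopy
  formula leaves \<open>\<tau> y\<close>.
\<close>

lemma homotopy_correction_inverse:
  fixes y :: "cell \<Rightarrow> 'r::field"
  assumes 2: "(2::'r) \<noteq> 0" and I: "I \<subseteq> {1..d}"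
  shows "homotopy_correction d (\<lambda>c. y c - cobd (mean_homotopy d y) c) (v, I) = y (shift v {1..d}, I)"
proof -
  let ?x = "\<lambda>c. y c - cobd (mean_homotopy d y) c"
  have "finite I" using I finite_subset by blast
  have "cobd ?x (v', insert c I) = cobd y (v', insert c I)" for v' c
    using cobd_cobd[of "insert c I", OF _ 2] \<open>finite I\<close>
      by (simp add: cochain_linear_diff[OF cochain_linear_cobd])
  hence "mean_homotopy d (cobd ?x) (v, I) = mean_homotopy d (cobd y) (v, I)"
    by (simp add: mean_homotopy_def homotopy_def)
  hence "homotopy_correction d ?x (v, I) = y (v, I) - (cobd (mean_homotopy d y) (v, I) + mean_homotopy d (cobd y) (v, I))"
    by (simp add: homotopy_correction_def)
  thus ?thesis by (simp add: mean_homotopy_formula[OF 2 I])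
qed

text \<open>
  \<open>(1 - g \<delta>) b = \<tau> b + \<delta> g b\<close>. Transposing the two summands gives \<open>- a\<close> and \<open>g \<delta> a\<close>.
\<close>

lemma exponent_map_antisym:
  fixes k :: "'r::field"
  assumes 2: "(2::'r) \<noteq> 0" and a: "a \<in> cells d n" and b: "b \<in> cells d n" and d: "d = 2 * n" and n: "odd n"
  shows "exponent_map d k (chi b) a = - exponent_map d k (chi a) b"
proof -
  let ?t = "\<lambda>(v, I). (chi b (shift v {1..d}, I) :: 'r)"
  have tw: "homotopy_correction d (chi b) (v, I) = ?t (v, I) + cobd (mean_homotopy d (chi b)) (v, I)" if "I \<subseteq> {1..d}" for v I
    using mean_homotopy_formula[OF 2 that, of "chi b" v] unfolding homotopy_correction_def
      by (simp add: algebra_simps)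
  have "cup_dual d (homotopy_correction d (chi b)) a = cup_dual d (\<lambda>c. ?t c + cobd (mean_homotopy d (chi b)) c) a"
    by (cases a) (simp add: cup_dual_def tw)
  also have "\<dots> = cup_dual d ?t a + cup_dual d (cobd (mean_homotopy d (chi b))) a"
    by (simp only: cochain_linear_add[OF cochain_linear_cup_dual])
  also have "cup_dual d ?t a = - cup_dual d (chi a) b" using cup_dual_swap[OF a b d n, where ?'r = 'r]
    by simp
  also have "cup_dual d (cobd (mean_homotopy d (chi b))) a = (cup_dual d (mean_homotopy d (cobd (chi a))) b :: 'r)"
  proof -
    have 1: "cup_dual d (cobd (homotopy d (above d) (chi b))) a = (cup_dual d (homotopy d below (cobd (chi a))) b :: 'r)"
      by (rule cup_dual_cobd_homotopy_swap[OF a b d n]) auto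
    have 2: "cup_dual d (cobd (homotopy d below (chi b))) a = (cup_dual d (homotopy d (above d) (cobd (chi a))) b :: 'r)"
      by (rule cup_dual_cobd_homotopy_swap[OF a b d n]) auto
    show ?thesis unfolding mean_homotopy_eq
      by (simp only: cochain_linear_scale[OF cochain_linear_cobd] cochain_linear_add[OF cochain_linear_cobd]
          cochain_linear_scale[OF cochain_linear_cup_dual] cochain_linear_add[OF cochain_linear_cup_dual] 1 2
          add.commute)
  qed
  finally have "cup_dual d (homotopy_correction d (chi b)) a = - (cup_dual d (chi a) b - (cup_dual d (mean_homotopy d (cobd (chi a))) b :: 'r))"
    by simp
  also have "\<dots> = - cup_dual d (homotopy_correction d (chi a)) b"
    by (simp only: homotopy_correction_def cochain_linear_diff[OF cochain_linear_cup_dual])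
  finally show ?thesis by (simp add: exponent_map_def)
qed

text \<open>
  The solution is explicit. By \<open>homotopy_correction_inverse\<close> the cochain \<open>x = y - \<delta> g y\<close> is mapped to
  the translate of \<open>y\<close>, so it suffices to take for \<open>y\<close> a multiple of the indicator of
  the one cell \<open>q\<close> that is paired with \<open>c\<close>. Antisymmetry turns this into a statement about
  rows instead of columns of the matrix.
\<close>

lemma exponent_map_solve:
  fixes k :: "'r::field"
  assumes 2: "(2::'r) \<noteq> 0" and k: "k \<noteq> 0" and d: "d = 2 * n" and n: "odd n" and c: "c \<in> cells d n"
  shows "\<exists>r. (\<forall>a. r a \<noteq> 0 \<longrightarrow> a \<in> cells d n \<and> cell_dist d a c \<le> 3 * int d) \<and>
    (\<forall>b\<in>cells d n. (\<Sum>a | a \<in> cells d n \<and> cell_dist d a c \<le> 3 * int d. r a * exponent_map d k (chi b) a) = chi c b)"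
proof -
  obtain w M where c': "c = (w, M)" by (cases c)
  have M: "M \<subseteq> {1..d}" using c c' by (auto simp: cells_def)
  define q where "q = (shift w M, {1..d} - M)"
  \<comment> \<open>The factor inverts \<open>k\<close> and the pairing sign; the minus sign makes up for antisymmetry.\<close>
  define e :: 'r where "e = - (1 / k) * (- 1) ^ inversions M ({1..d} - M)"
  define y where "y = (\<lambda>a. e * chi q a)"
  define x where "x = (\<lambda>a. y a - cobd (mean_homotopy d y) a)"
  \<comment> \<open>Values of \<open>x\<close> outside the \<open>n\<close>-cells carry no meaning and are discarded.\<close>
  define r where "r = (\<lambda>a. if a \<in> cells d n then x a else 0)"
  let ?B = "{a \<in> cells d n. cell_dist d a c \<le> 3 * int d}"
  obtain n' where n': "n = Suc n'" using n by (cases n) auto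
  have "cochain_local d (int d + int d) n n (\<lambda>y. cobd (mean_homotopy d y) :: cell \<Rightarrow> 'r)"
    unfolding n' by (rule cochain_local_comp[OF cochain_local_cobd cochain_local_mean_homotopy])
  hence cochain_local: "cochain_local d (2 * int d) n n (\<lambda>y a. y a - cobd (mean_homotopy d y) a :: 'r)"
    by (intro cochain_local_diff_fun cochain_local_id) (simp_all flip: mult_2)
  have qc: "cell_dist d q c \<le> int d" unfolding q_def c'
    by (rule cell_dist_near) (simp add: shift_def)
  have supp: "a \<in> ?B" if "r a \<noteq> 0" for a
  proof -
    have a: "a \<in> cells d n" "x a \<noteq> 0" using that by (auto simp: r_def split: if_splits)
    then obtain b where b: "cell_dist d a b \<le> 2 * int d" "y b \<noteq> 0"
      using cochain_local unfolding cochain_local_def x_def by blast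
    hence "b = q" by (auto simp: y_def)
    thus ?thesis using a b qc cell_dist_triangle[of d a c q] by auto
  qed
  have "(\<Sum>a\<in>?B. r a * exponent_map d k (chi b) a) = chi c b" if b: "b \<in> cells d n" for b
  proof -
    have "(\<Sum>a\<in>?B. r a * exponent_map d k (chi b) a) = - (\<Sum>a\<in>?B. r a * exponent_map d k (chi a) b)"
      unfolding sum_negf[symmetric]
      by (intro sum.cong refl) (use exponent_map_antisym[OF 2 _ b d n] in auto)
    also have "(\<Sum>a\<in>?B. r a * exponent_map d k (chi a) b) = exponent_map d k r b"
      by (rule local_linear_expand[OF cochain_linear_exponent_map cochain_local_exponent_map[OF d] b, symmetric])
        (use supp finite_ball in auto)
    also have "\<dots> = exponent_map d k x b"
      by (rule cochain_local_cong[OF cochain_linear_exponent_map cochain_local_exponent_map[OF d] b]) (simp add: r_def)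
    also have "\<dots> = - chi c b"
    proof -
      obtain v K where b': "b = (v, K)" by (cases b)
      have K: "K \<subseteq> {1..d}" using b b' by (auto simp: cells_def)
      have "shift (unshift v ({1..d} - K)) {1..d} = shift v K"
        using K by (auto simp: shift_def unshift_def fun_eq_iff)
      hence "exponent_map d k x b = k * ((- 1) ^ inversions K ({1..d} - K) * y (shift v K, {1..d} - K))"
        unfolding exponent_map_def x_def b' cup_dual_def by (simp add: homotopy_correction_inverse[OF 2])
      moreover have "(shift v K, {1..d} - K) = q \<longleftrightarrow> b = c"
      proof
        assume eq: "(shift v K, {1..d} - K) = q"
        hence "{1..d} - K = {1..d} - M" by (simp add: q_def)
        hence "K = M" using K M by (metis double_diff order_refl)
        moreover have "v = w" using eq \<open>K = M\<close> unfolding q_def by (metis fst_conv shift_unshift(2))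
        ultimately show "b = c" by (simp add: b' c')
      qed (simp add: b' c' q_def)
      ultimately show ?thesis using k by (auto simp: y_def e_def b' c' simp flip: power_mult_distrib)
    qed
    finally show ?thesis by simp
  qed
  thus ?thesis using supp by (intro exI[of _ r]) auto
qed

section \<open>Cup and cup-1 integrals of indicator cochains\<close>

lemma lookup_boundary:
  "Poly_Mapping.lookup (boundary (v, I)) b =
     (\<Sum>i\<in>I. pos_sign i I * (of_bool (b = (v, I - {i})) - of_bool (b = (shift v {i}, I - {i}))))"
  by (simp add: boundary_def lookup_sum lookup_minus pos_sign_def of_bool_def)

lemma coboundary_indic: "of_int (coboundary (indic b) t) = (cobd (chi b) t :: 'r::comm_ring_1)"
proof -
  obtain v I where t: "t = (v, I)" by (cases t)
  have "coboundary (indic b) t = (\<Sum>f\<in>Poly_Mapping.keys (boundary t). if f = b then Poly_Mapping.lookup (boundary t) f else 0)"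
    unfolding coboundary_def indic_def by (intro sum.cong) auto
  also have "\<dots> = Poly_Mapping.lookup (boundary t) b"
    by (simp add: sum.delta in_keys_iff)
  finally show ?thesis by (simp add: t lookup_boundary cobd_def pos_sign_def eq_commute[of b])
qed

lemma top_cells: "x \<in> cells d d \<longleftrightarrow> (\<exists>v. x = (v, {1..d}) \<and> (\<forall>i. i \<notin> {1..d} \<longrightarrow> v i = 0))"
proof -
  have "I \<subseteq> {1..d} \<and> card I = d \<longleftrightarrow> I = {1..d}" for I
    using card_subset_eq[of "{1..d}" I] by auto
  thus ?thesis by (cases x) (auto simp: cells_def)
qed

text \<open>
  The integrands that occur are finite sums of cochains each of which is concentrated on a single
  top cell, so that an integral over the infinite lattice becomes a finite sum.
\<close>

lemma integral_sum_point_supported: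
  assumes C: "finite C" and X: "\<And>c. c \<in> C \<Longrightarrow> X c \<in> cells d d"
    and f: "\<And>c x. c \<in> C \<Longrightarrow> x \<in> cells d d \<Longrightarrow> f c x \<noteq> 0 \<Longrightarrow> x = X c"
    and g: "\<And>x. x \<in> cells d d \<Longrightarrow> g x = (\<Sum>c\<in>C. f c x)"
  shows "finite {x \<in> cells d d. g x \<noteq> 0}" "integral_cochain d g = (\<Sum>c\<in>C. f c (X c))"
proof -
  have sub: "{x \<in> cells d d. g x \<noteq> 0} \<subseteq> X ` C"
  proof
    fix x assume x: "x \<in> {x \<in> cells d d. g x \<noteq> 0}"
    then obtain c where "c \<in> C" "f c x \<noteq> 0" using g sum.not_neutral_contains_not_neutral
      by (metis (mono_tags, lifting) mem_Collect_eq)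
    thus "x \<in> X ` C" using f x by blast
  qed
  thus "finite {x \<in> cells d d. g x \<noteq> 0}" using C finite_subset by blast
  have "integral_cochain d g = (\<Sum>x\<in>X ` C. g x)" unfolding integral_cochain_def
    by (rule sum.mono_neutral_left) (use C sub X in auto)
  also have "\<dots> = (\<Sum>x\<in>X ` C. \<Sum>c\<in>C. f c x)" by (intro sum.cong refl g) (use X in auto)
  also have "\<dots> = (\<Sum>c\<in>C. \<Sum>x\<in>X ` C. f c x)" by (rule sum.swap)
  also have "\<dots> = (\<Sum>c\<in>C. f c (X c))"
  proof (intro sum.cong refl)
    fix c assume c: "c \<in> C"
    have "(\<Sum>x\<in>X ` C. f c x) = (\<Sum>x\<in>{X c}. f c x)"
    proof (rule sum.mono_neutral_right)
      show "\<forall>x\<in>X ` C - {X c}. f c x = 0" using f[OF c] X by blast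
    qed (use C c in auto)
    thus "(\<Sum>x\<in>X ` C. f c x) = f c (X c)" by simp
  qed
  finally show "integral_cochain d g = (\<Sum>c\<in>C. f c (X c))" .
qed

lemma integral_diff:
  assumes "finite {x \<in> cells d d. f x \<noteq> 0}" "finite {x \<in> cells d d. g x \<noteq> 0}"
  shows "integral_cochain d (\<lambda>x. f x - g x) = integral_cochain d f - integral_cochain d g"
proof -
  let ?U = "{x \<in> cells d d. f x \<noteq> 0} \<union> {x \<in> cells d d. g x \<noteq> 0}"
  have U: "integral_cochain d h = sum h ?U" if "\<And>x. f x = 0 \<Longrightarrow> g x = 0 \<Longrightarrow> h x = 0" for h
    unfolding integral_cochain_def by (rule sum.mono_neutral_left) (use assms that in auto)
  show ?thesis by (simp add: U sum_subtractf)
qed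

lemma integral_cup_indic:
  assumes a: "a \<in> cells d n" and d: "d = 2 * n"
  shows "of_int (integral_cochain d (cup n (indic b) (indic a))) = (cup_dual d (chi b) a :: 'r::comm_ring_1)"
proof -
  obtain u J where a': "a = (u, J)" by (cases a)
  have J: "J \<subseteq> {1..d}" "card J = n" using a a' by (auto simp: cells_def)
  let ?I = "{1..d} - J"
  have I: "card ?I = n" using J d by (simp add: card_Diff_subset finite_subset[OF J(1)])
  have JI: "{1..d} - ?I = J" using J by auto
  let ?f = "\<lambda>(c::unit) (v, K::nat set). (- 1) ^ inversions J ?I * of_bool ((v, ?I) = b) * of_bool (shift v ?I = u) :: int"
  have 1: "cup n (indic b) (indic a) x = (\<Sum>c\<in>{()}. ?f c x)" if x: "x \<in> cells d d" for x
  proof -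
    obtain v where v: "x = (v, {1..d})" using x top_cells by auto
    have "cup n (indic b) (indic a) x = (\<Sum>I\<in>{?I}. (- 1) ^ inversions ({1..d} - I) I *
        indic b (v, I) * indic a (shift v I, {1..d} - I))"
      unfolding v cup_def prod.case by (rule sum.mono_neutral_right) (use I in \<open>auto simp: a' indic_def\<close>)
    thus ?thesis using JI by (simp add: v indic_def a')
  qed
  have X: "(unshift u ?I, {1..d}) \<in> cells d d"
    using a by (auto simp: top_cells unshift_def cells_def a')
  have "integral_cochain d (cup n (indic b) (indic a)) = (\<Sum>c\<in>{()}. ?f c (unshift u ?I, {1..d}))"
    by (rule integral_sum_point_supported(2)[where X = "\<lambda>_. (unshift u ?I, {1..d})", OF _ _ _ 1])
      (use X in \<open>auto simp: top_cells split: if_splits\<close>)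
  thus ?thesis by (simp add: cup_dual_def a')
qed

text \<open>
  The factor \<open>indic a\<close> forces \<open>c \<in> J\<close> and fixes both index sets and, for each \<open>c\<close>, the base point.
  The remaining sum over \<open>c \<in> J\<close> is the one in \<open>homotopy\<close>.
\<close>

lemma integral_cup1_left:
  assumes a: "a \<in> cells d n" and d: "d = 2 * n"
  shows "finite {x \<in> cells d d. cup1 (n + 1) n (indic t) (indic a) x \<noteq> 0}"
    and "of_int (integral_cochain d (cup1 (n + 1) n (indic t) (indic a)))
      = (cup_dual d (homotopy d (above d) (chi t)) a :: 'r::comm_ring_1)"
proof -
  obtain u J where a': "a = (u, J)" by (cases a)
  have J: "J \<subseteq> {1..d}" "card J = n" and u: "\<And>i. i \<notin> {1..d} \<Longrightarrow> u i = 0" using a a' by (auto simp: cells_def)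
  have fJ: "finite J" using J finite_subset by blast
  let ?I = "{1..d} - J"
  have I: "card ?I = n" using J d by (simp add: card_Diff_subset fJ)
  let ?f = "\<lambda>c (v, K::nat set). (- 1) ^ (n - 1 + inversions (J - {c}) ?I) *
     of_bool ((shift v {j \<in> J - {c}. c < j}, insert c ?I) = t) * of_bool (shift v {i \<in> ?I. i < c} = u) :: int"
  have 1: "cup1 (n + 1) n (indic t) (indic a) x = (\<Sum>c\<in>J. ?f c x)" if x: "x \<in> cells d d" for x
  proof -
    obtain v where v: "x = (v, {1..d})" using x top_cells by auto
    let ?g = "\<lambda>c I. (- 1) ^ (n - 1 + inversions ({1..d} - {c} - I) I) *
       indic t (shift v {j \<in> {1..d} - {c} - I. c < j}, insert c I) *
       indic a (shift v {i \<in> I. i < c}, insert c ({1..d} - {c} - I))"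
    have g0: "?g c I = 0" if "c \<in> {1..d}" "I \<subseteq> {1..d} - {c}" "c \<notin> J \<or> I \<noteq> ?I" for c I
    proof -
      have "insert c ({1..d} - {c} - I) \<noteq> J" using that by blast
      thus ?thesis by (simp add: indic_def a')
    qed
    have g1: "?g c ?I = ?f c x" if c: "c \<in> J" for c
    proof -
      have "{1..d} - {c} - ?I = J - {c}" using J by auto
      moreover have "insert c (J - {c}) = J" using c by auto
      ultimately show ?thesis by (simp add: indic_def a' v)
    qed
    have "cup1 (n + 1) n (indic t) (indic a) x = (\<Sum>c\<in>{1..d}. \<Sum>I | I \<subseteq> {1..d} - {c} \<and> card I = n. ?g c I)"
      unfolding v cup1_def by (simp add: Let_def)
    also have "\<dots> = (\<Sum>c\<in>J. \<Sum>I | I \<subseteq> {1..d} - {c} \<and> card I = n. ?g c I)"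
      by (rule sum.mono_neutral_right) (use J g0 in \<open>auto intro!: sum.neutral simp del: atLeastAtMost_iff\<close>)
    also have "\<dots> = (\<Sum>c\<in>J. ?f c x)"
    proof (intro sum.cong refl)
      fix c assume c: "c \<in> J"
      have "(\<Sum>I | I \<subseteq> {1..d} - {c} \<and> card I = n. ?g c I) = (\<Sum>I\<in>{?I}. ?g c I)"
      proof (rule sum.mono_neutral_right)
        show "\<forall>I\<in>{I. I \<subseteq> {1..d} - {c} \<and> card I = n} - {?I}. ?g c I = 0"
          using g0[of c] c J(1) by blast
      qed (use I c in auto)
      thus "(\<Sum>I | I \<subseteq> {1..d} - {c} \<and> card I = n. ?g c I) = ?f c x" using g1[OF c] by simp
    qed
    finally show ?thesis .
  qed
  let ?X = "\<lambda>c. (unshift u {i \<in> ?I. i < c}, {1..d})"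
  have X: "?X c \<in> cells d d" for c
    using u by (auto simp: top_cells unshift_def)
  have 2: "x = ?X c" if "x \<in> cells d d" "?f c x \<noteq> 0" for c x
    using that by (auto simp: top_cells split: if_splits)
  note int = integral_sum_point_supported[where f = ?f and X = ?X, OF fJ X 2 1]
  show "finite {x \<in> cells d d. cup1 (n + 1) n (indic t) (indic a) x \<noteq> 0}" by (rule int(1))
  have "of_int (integral_cochain d (cup1 (n + 1) n (indic t) (indic a))) = (\<Sum>c\<in>J. (of_int (?f c (?X c)) :: 'r))"
    by (subst int(2)) simp_all
  also have "\<dots> = (\<Sum>c\<in>J. (- 1) ^ inversions J ?I * (pos_sign c (insert c ?I) *
      chi t (shift (unshift u ?I) (above d c), insert c ?I)))"
  proof (intro sum.cong refl)
    fix c assume c: "c \<in> J"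
    have "shift (unshift u {i \<in> ?I. i < c}) {j \<in> J - {c}. c < j} = shift (unshift u ?I) (above d c)"
      using J c by (auto simp: shift_def unshift_def fun_eq_iff)
    moreover have "(- 1) ^ (n - 1 + inversions (J - {c}) ?I) = ((- 1) ^ inversions J ?I * pos_sign c (insert c ?I) :: 'r)"
    proof -
      let ?g = "card {i \<in> ?I. c < i}" and ?l = "card {i \<in> ?I. i < c}" and ?A = "inversions (J - {c}) ?I"
      have "inversions J ?I = ?A + ?g"
        using inversions_insert_left[of "J - {c}" ?I c] c fJ by (simp add: insert_absorb)
      moreover have "pos_sign c (insert c ?I) = - ((- 1) ^ ?l :: 'r)"
        using c by (intro pos_sign_insert_self) auto
      ultimately have "(- 1) ^ inversions J ?I * pos_sign c (insert c ?I) = ((- 1) ^ (?A + ?g + Suc ?l) :: 'r)"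
        by (simp only: power_add power_Suc) simp
      moreover have "?l + ?g = n" using card_less_greater[of ?I c] c I by simp
      moreover have "n > 0" using c J fJ by (auto simp: card_gt_0_iff)
      ultimately show ?thesis by (simp only:) (rule minus_one_power_cong, presburger)
    qed
    ultimately show "of_int (?f c (?X c)) = (- 1) ^ inversions J ?I * (pos_sign c (insert c ?I) *
      (chi t (shift (unshift u ?I) (above d c), insert c ?I) :: 'r))" by simp
  qed
  also have "\<dots> = cup_dual d (homotopy d (above d) (chi t)) a"
  proof -
    have "{1..d} - ?I = J" using J by auto
    thus ?thesis by (simp only: cup_dual_def homotopy_def a' prod.case sum_distrib_left)
  qed
  finally show "of_int (integral_cochain d (cup1 (n + 1) n (indic t) (indic a)))
      = (cup_dual d (homotopy d (above d) (chi t)) a :: 'r)" .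
qed

text \<open>
  Here \<open>indic a\<close> is the first factor, so the roles of the directions before and after \<open>c\<close> are
  interchanged. Oddness of \<open>n\<close> enters through \<open>inv(J - c, I) + inv(I, J - c) = (n - 1) n\<close> being even.
\<close>

lemma integral_cup1_right:
  assumes a: "a \<in> cells d n" and d: "d = 2 * n" and n: "odd n"
  shows "finite {x \<in> cells d d. cup1 n (n + 1) (indic a) (indic t) x \<noteq> 0}"
    and "of_int (integral_cochain d (cup1 n (n + 1) (indic a) (indic t)))
      = - (cup_dual d (homotopy d below (chi t)) a :: 'r::comm_ring_1)"
proof -
  obtain u J where a': "a = (u, J)" by (cases a)
  have J: "J \<subseteq> {1..d}" "card J = n" and u: "\<And>i. i \<notin> {1..d} \<Longrightarrow> u i = 0" using a a' by (auto simp: cells_def)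
  have fJ: "finite J" using J finite_subset by blast
  let ?I = "{1..d} - J"
  have I: "card ?I = n" using J d by (simp add: card_Diff_subset fJ)
  let ?f = "\<lambda>c (v, K::nat set). (- 1) ^ (n + inversions ?I (J - {c})) *
     of_bool (shift v {j \<in> ?I. c < j} = u) * of_bool ((shift v {i \<in> J - {c}. i < c}, insert c ?I) = t) :: int"
  have 1: "cup1 n (n + 1) (indic a) (indic t) x = (\<Sum>c\<in>J. ?f c x)" if x: "x \<in> cells d d" for x
  proof -
    obtain v where v: "x = (v, {1..d})" using x top_cells by auto
    let ?g = "\<lambda>c I. (- 1) ^ (n + inversions ({1..d} - {c} - I) I) *
       indic a (shift v {j \<in> {1..d} - {c} - I. c < j}, insert c I) *
       indic t (shift v {i \<in> I. i < c}, insert c ({1..d} - {c} - I))"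
    have g0: "?g c I = 0" if "c \<in> {1..d}" "I \<subseteq> {1..d} - {c}" "c \<notin> J \<or> I \<noteq> J - {c}" for c I
    proof -
      have "insert c I \<noteq> J" using that by blast
      thus ?thesis by (simp add: indic_def a')
    qed
    have g1: "?g c (J - {c}) = ?f c x" if c: "c \<in> J" for c
    proof -
      have "{1..d} - {c} - (J - {c}) = ?I" using c by auto
      moreover have "insert c (J - {c}) = J" using c by auto
      ultimately show ?thesis by (simp add: indic_def a' v)
    qed
    have "cup1 n (n + 1) (indic a) (indic t) x = (\<Sum>c\<in>{1..d}. \<Sum>I | I \<subseteq> {1..d} - {c} \<and> card I = n - 1. ?g c I)"
      unfolding v cup1_def by (simp add: Let_def)
    also have "\<dots> = (\<Sum>c\<in>J. \<Sum>I | I \<subseteq> {1..d} - {c} \<and> card I = n - 1. ?g c I)"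
      by (rule sum.mono_neutral_right) (use J g0 in \<open>auto intro!: sum.neutral simp del: atLeastAtMost_iff\<close>)
    also have "\<dots> = (\<Sum>c\<in>J. ?f c x)"
    proof (intro sum.cong refl)
      fix c assume c: "c \<in> J"
      have "(\<Sum>I | I \<subseteq> {1..d} - {c} \<and> card I = n - 1. ?g c I) = (\<Sum>I\<in>{J - {c}}. ?g c I)"
      proof (rule sum.mono_neutral_right)
        show "\<forall>I\<in>{I. I \<subseteq> {1..d} - {c} \<and> card I = n - 1} - {J - {c}}. ?g c I = 0"
          using g0[of c] c J(1) by blast
      qed (use J c fJ in auto)
      thus "(\<Sum>I | I \<subseteq> {1..d} - {c} \<and> card I = n - 1. ?g c I) = ?f c x" using g1[OF c] by simp
    qed
    finally show ?thesis .
  qed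
  let ?X = "\<lambda>c. (unshift u {j \<in> ?I. c < j}, {1..d})"
  have X: "?X c \<in> cells d d" for c
    using u by (auto simp: top_cells unshift_def)
  have 2: "x = ?X c" if "x \<in> cells d d" "?f c x \<noteq> 0" for c x
    using that by (auto simp: top_cells split: if_splits)
  note int = integral_sum_point_supported[where f = ?f and X = ?X, OF fJ X 2 1]
  show "finite {x \<in> cells d d. cup1 n (n + 1) (indic a) (indic t) x \<noteq> 0}" by (rule int(1))
  have "of_int (integral_cochain d (cup1 n (n + 1) (indic a) (indic t))) = (\<Sum>c\<in>J. (of_int (?f c (?X c)) :: 'r))"
    by (subst int(2)) simp_all
  also have "\<dots> = (\<Sum>c\<in>J. - ((- 1) ^ inversions J ?I * (pos_sign c (insert c ?I) *
      chi t (shift (unshift u ?I) (below c), insert c ?I))))"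
  proof (intro sum.cong refl)
    fix c assume c: "c \<in> J"
    have "shift (unshift u {j \<in> ?I. c < j}) {i \<in> J - {c}. i < c} = shift (unshift u ?I) (below c)"
      using J c by (auto simp: shift_def unshift_def fun_eq_iff)
    moreover have "(- 1) ^ (n + inversions ?I (J - {c})) = - ((- 1) ^ inversions J ?I * pos_sign c (insert c ?I) :: 'r)"
    proof -
      have "inversions J ?I = inversions (J - {c}) ?I + card {i \<in> ?I. c < i}"
        using inversions_insert_left[of "J - {c}" ?I c] c fJ by (simp add: insert_absorb)
      moreover have "pos_sign c (insert c ?I) = - ((- 1) ^ card {i \<in> ?I. i < c} :: 'r)"
        using c by (intro pos_sign_insert_self) auto
      moreover have "card {i \<in> ?I. i < c} + card {i \<in> ?I. c < i} = n"
        using card_less_greater[of ?I c] c I by simp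
      moreover have "inversions (J - {c}) ?I + inversions ?I (J - {c}) = (n - 1) * n"
        using inversions_swap[of "J - {c}" ?I] fJ c J I by auto
      hence "even (inversions (J - {c}) ?I + inversions ?I (J - {c}))" using n by simp
      ultimately show ?thesis
        by (simp flip: power_add) (rule minus_one_power_cong, simp, presburger)
    qed
    ultimately show "of_int (?f c (?X c)) = - ((- 1) ^ inversions J ?I * (pos_sign c (insert c ?I) *
      (chi t (shift (unshift u ?I) (below c), insert c ?I) :: 'r)))" by simp
  qed
  also have "\<dots> = - cup_dual d (homotopy d below (chi t)) a"
  proof -
    have "{1..d} - ?I = J" using J by auto
    thus ?thesis by (simp only: cup_dual_def homotopy_def a' prod.case sum_distrib_left sum_negf)
  qed
  finally show "of_int (integral_cochain d (cup1 n (n + 1) (indic a) (indic t)))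
      = - (cup_dual d (homotopy d below (chi t)) a :: 'r)" .
qed

lemma integral_cup1_difference:
  fixes k :: "'r::field"
  assumes 2: "(2::'r) \<noteq> 0" and a: "a \<in> cells d n" and d: "d = 2 * n" and n: "odd n"
  shows "k / 2 * of_int (integral_cochain d
      (\<lambda>x. cup1 n (n + 1) (indic a) (indic t) x - cup1 (n + 1) n (indic t) (indic a) x))
    = - k * cup_dual d (mean_homotopy d (chi t)) a"
proof -
  note L = integral_cup1_left[OF a d, of t] and R = integral_cup1_right[OF a d n, of t]
  have "of_int (integral_cochain d
      (\<lambda>x. cup1 n (n + 1) (indic a) (indic t) x - cup1 (n + 1) n (indic t) (indic a) x))
    = - (cup_dual d (homotopy d (above d) (chi t)) a + cup_dual d (homotopy d below (chi t)) a :: 'r)"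
    unfolding integral_diff[OF R(1) L(1)] of_int_diff R(2) L(2) by simp
  moreover have "cup_dual d (mean_homotopy d (chi t)) a
      = inverse 2 * (cup_dual d (homotopy d (above d) (chi t)) a + cup_dual d (homotopy d below (chi t)) a :: 'r)"
    by (simp only: mean_homotopy_eq cochain_linear_scale[OF cochain_linear_cup_dual] cochain_linear_add[OF cochain_linear_cup_dual])
  ultimately show ?thesis using 2 by (simp only:) (simp add: field_simps)
qed

text \<open>
  The right-hand side is the exponent of \<open>Z\<^sub>b\<close> read off from the definition of the generator at \<open>a\<close>.
  Only finitely many \<open>t\<close> contribute, and summing over them reassembles \<open>\<delta> b\<close> from indicators.
\<close>

lemma exponent_map_via_integrals:
  fixes k :: "'r::field"
  assumes 2: "(2::'r) \<noteq> 0" and a: "a \<in> cells d n" and d: "d = 2 * n" and n: "odd n"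
    and T: "finite T" "T \<subseteq> cells d (n + 1)" "{t \<in> cells d (n + 1). cell_dist d a t \<le> 2 * int d} \<subseteq> T"
  shows "exponent_map d k (chi b) a = k * of_int (integral_cochain d (cup n (indic b) (indic a)))
     + (\<Sum>t\<in>T. k / 2 * of_int (integral_cochain d
      (\<lambda>x. cup1 n (n + 1) (indic a) (indic t) x - cup1 (n + 1) n (indic t) (indic a) x))
       * of_int (coboundary (indic b) t))"
proof -
  have "cochain_linear (\<lambda>x. cup_dual d (mean_homotopy d x) :: cell \<Rightarrow> 'r)"
    by (rule cochain_linear_comp[OF cochain_linear_cup_dual cochain_linear_mean_homotopy])
  moreover have "cochain_local d (int d + int d) (Suc n) n (\<lambda>x. cup_dual d (mean_homotopy d x) :: cell \<Rightarrow> 'r)"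
    by (rule cochain_local_comp[OF cochain_local_cup_dual[OF d] cochain_local_mean_homotopy])
  ultimately have "cup_dual d (mean_homotopy d (cobd (chi b))) a = (\<Sum>t\<in>T. cobd (chi b) t * (cup_dual d (mean_homotopy d (chi t)) a :: 'r))"
    using a T by (intro local_linear_expand[where R = "int d + int d"]) auto
  moreover have "cup_dual d (homotopy_correction d (chi b)) a = cup_dual d (chi b) a - (cup_dual d (mean_homotopy d (cobd (chi b))) a :: 'r)"
    by (simp only: homotopy_correction_def cochain_linear_diff[OF cochain_linear_cup_dual])
  ultimately have "exponent_map d k (chi b) a = k * cup_dual d (chi b) a
      + (\<Sum>t\<in>T. - k * (cup_dual d (mean_homotopy d (chi t)) a) * cobd (chi b) t)"
    by (simp add: exponent_map_def right_diff_distrib sum_distrib_left sum_negf mult_ac)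
  thus ?thesis
    by (simp only: integral_cup1_difference[OF 2 a d n] coboundary_indic integral_cup_indic[OF a d])
qed

section \<open>Weyl operators\<close>

definition omega :: "'p::prime_card mod_ring \<Rightarrow> complex" where
  "omega m = cis (2 * pi * of_int (to_int_mod_ring m) / of_nat CARD('p))"

lemma cis_mod_card:
  "cis (2 * pi * of_int (j mod int CARD('p::prime_card)) / of_nat CARD('p)) = cis (2 * pi * of_int j / of_nat CARD('p))"
proof -
  let ?p = "int CARD('p)"
  have j: "real_of_int j = of_int (j mod ?p) + of_nat CARD('p) * of_int (j div ?p)"
    by (metis add.commute mult_div_mod_eq of_int_add of_int_mult of_int_of_nat_eq)
  have p: "real CARD('p) \<noteq> 0" by simp
  have "2 * pi * of_int j / of_nat CARD('p)
      = 2 * pi * of_int (j mod ?p) / of_nat CARD('p) + 2 * pi * of_int (j div ?p)"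
    unfolding j using p by (simp add: field_simps)
  thus ?thesis by (simp flip: cis_mult)
qed

lemma omega_add: "omega (a + b) = omega a * omega b"
  by (simp add: omega_def to_int_mod_ring_add cis_mod_card cis_mult add_divide_distrib distrib_left)

lemma omega_diff: "omega (a - b) = omega a * omega (- b)"
  by (simp flip: omega_add)

lemma omega_zero [simp]: "omega 0 = 1"
  by (simp add: omega_def)

lemma norm_omega [simp]: "cmod (omega m) = 1"
  by (simp add: omega_def)

lemma omega_sum: "finite F \<Longrightarrow> omega (sum f F) = (\<Prod>c\<in>F. omega (f c))"
  by (induction F rule: finite_induct) (simp_all add: omega_add)

lemma omega_one_neq: "omega (1 :: 'p::prime_card mod_ring) \<noteq> 1"
proof
  have one: "to_int_mod_ring (1 :: 'p mod_ring) = 1" by simp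
  have p: "CARD('p) \<ge> 2" by (rule prime_ge_2_nat[OF prime_card])
  assume "omega (1 :: 'p mod_ring) = 1"
  hence "cis (2 * pi / real CARD('p)) = 1" by (simp add: omega_def one)
  hence "cos (2 * pi / real CARD('p)) = 1" by (metis cis.sel(1) one_complex.sel(1))
  moreover have "cos (2 * pi / real CARD('p)) < cos 0"
    by (rule cos_monotone_0_pi) (use p in \<open>auto simp: field_simps\<close>)
  ultimately show False by simp
qed

text \<open>
  For \<open>a \<noteq> 0\<close> multiplication by \<open>a\<close> permutes \<open>\<int>\<^sub>p\<close>, and the sum of all values of a nontrivial character
  vanishes because a translation multiplies it by \<open>omega 1 \<noteq> 1\<close>.
\<close>

lemma omega_orthogonality:
  fixes a :: "'p::prime_card mod_ring"
  shows "(\<Sum>z\<in>UNIV. omega (z * a)) = (if a = 0 then of_nat CARD('p) else 0)"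
proof (cases "a = 0")
  case False
  have "bij (\<lambda>z. z * a)" by (rule bij_betw_byWitness[of _ "\<lambda>z. z / a"]) (use False in auto)
  hence "(\<Sum>z\<in>UNIV. omega (z * a)) = (\<Sum>z\<in>UNIV. omega (z :: 'p mod_ring))"
    by (rule sum.reindex_bij_betw[where g = omega])
  also have "\<dots> = 0"
  proof -
    have "bij (\<lambda>z. z + (1 :: 'p mod_ring))" by (rule bij_betw_byWitness[of _ "\<lambda>z. z - 1"]) auto
    hence "(\<Sum>z\<in>UNIV. omega (z + (1 :: 'p mod_ring))) = (\<Sum>z\<in>UNIV. omega (z :: 'p mod_ring))"
      by (rule sum.reindex_bij_betw[where g = omega])
    hence "(\<Sum>z\<in>UNIV. omega (z :: 'p mod_ring)) * omega (1 :: 'p mod_ring) = (\<Sum>z\<in>UNIV. omega (z :: 'p mod_ring))"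
      by (simp add: omega_add sum_distrib_right)
    thus ?thesis using omega_one_neq[where ?'p = 'p] by (metis mult_cancel_left1)
  qed
  finally show ?thesis using False by simp
qed simp

text \<open>
  Meaningful for \<open>z\<close> of finite support; on infinite supports the sum defaults to \<open>0\<close>.
\<close>

definition dot :: "('a \<Rightarrow> 'p::prime_card mod_ring) \<Rightarrow> ('a \<Rightarrow> 'p mod_ring) \<Rightarrow> 'p mod_ring" where
  "dot z s = (\<Sum>c | z c \<noteq> 0. z c * s c)"

lemma dot_eq:
  assumes "finite F" "\<And>c. c \<notin> F \<Longrightarrow> z c = 0"
  shows "dot z s = (\<Sum>c\<in>F. z c * s c)"
  unfolding dot_def by (rule sum.mono_neutral_left) (use assms in auto)

lemma dot_diff_right: "dot z (\<lambda>c. s c - x c) = dot z s - dot z x"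
  by (simp add: dot_def right_diff_distrib sum_subtractf)

lemma dot_add_left:
  assumes "finite {c. z c \<noteq> 0}" "finite {c. z' c \<noteq> 0}"
  shows "dot (\<lambda>c. z c + z' c) s = dot z s + dot z' s"
proof -
  let ?F = "{c. z c \<noteq> 0} \<union> {c. z' c \<noteq> 0}"
  have "dot (\<lambda>c. z c + z' c) s = (\<Sum>c\<in>?F. (z c + z' c) * s c)" "dot z s = (\<Sum>c\<in>?F. z c * s c)"
    "dot z' s = (\<Sum>c\<in>?F. z' c * s c)" by (rule dot_eq; use assms in auto)+
  thus ?thesis by (simp add: distrib_right sum.distrib)
qed

lemma dot_zero_left [simp]: "dot (\<lambda>c. 0) s = 0"
  by (simp add: dot_def)

lemma dot_zero_right [simp]: "dot z (\<lambda>c. 0) = 0"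
  by (simp add: dot_def)

lemma dot_indicator_right:
  assumes "finite {c. z c \<noteq> 0}"
  shows "dot z (\<lambda>c. of_bool (c = a)) = z a"
proof -
  have "dot z (\<lambda>c. of_bool (c = a)) = (\<Sum>c\<in>insert a {c. z c \<noteq> 0}. z c * of_bool (c = a))"
    by (rule dot_eq) (use assms in auto)
  also have "\<dots> = (\<Sum>c\<in>{a}. z c * of_bool (c = a))"
    by (rule sum.mono_neutral_right) (use assms in auto)
  finally show ?thesis by simp
qed

definition weyl :: "('a \<Rightarrow> 'p::prime_card mod_ring) \<Rightarrow> ('a \<Rightarrow> 'p mod_ring) \<Rightarrow> ('a, 'p) qop" where
  "weyl x z = (\<lambda>\<psi> s. omega (dot z s) * \<psi> (\<lambda>c. s c - x c))"

lemma weyl_comp: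
  assumes "finite {c. z c \<noteq> 0}" "finite {c. z' c \<noteq> 0}"
  shows "weyl x z \<circ> weyl x' z' = op_scale (omega (- dot z' x)) (weyl (\<lambda>c. x c + x' c) (\<lambda>c. z c + z' c))"
  unfolding comp_def weyl_def op_scale_def dot_add_left[OF assms] dot_diff_right omega_diff omega_add diff_diff_eq
  by (intro ext) (simp only: mult_ac)

lemma weyl_id: "weyl (\<lambda>c. 0) (\<lambda>c. 0) = id"
  by (simp add: weyl_def fun_eq_iff)

lemma weyl_pauli_X: "weyl (\<lambda>b. of_bool (b = c)) (\<lambda>b. 0) = pauli_X c"
proof -
  have "(\<lambda>b. s b - of_bool (b = c)) = s(c := s c - 1)" for s :: "'a \<Rightarrow> 'b mod_ring" by auto
  thus ?thesis by (simp add: weyl_def pauli_X_def)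
qed

lemma weyl_pauli_Z: "weyl (\<lambda>b. 0) (\<lambda>b. of_bool (b = c)) = pauli_Z c"
proof -
  have "dot (\<lambda>b. of_bool (b = c)) s = (\<Sum>b\<in>{c}. of_bool (b = c) * s b)" for s :: "'a \<Rightarrow> 'b mod_ring"
    by (rule dot_eq) auto
  thus ?thesis by (simp add: weyl_def pauli_Z_def omega_def fun_eq_iff)
qed

lemma weyl_Z_comp:
  assumes "finite {c. z c \<noteq> 0}" "finite {c. z' c \<noteq> 0}"
  shows "weyl (\<lambda>c. 0) z \<circ> weyl (\<lambda>c. 0) z' = weyl (\<lambda>c. 0) (\<lambda>c. z c + z' c)"
  by (subst weyl_comp[OF assms]) (simp add: op_scale_def)

lemma weyl_Z_funpow:
  assumes "finite {c. z c \<noteq> 0}"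
  shows "weyl (\<lambda>c. 0) z ^^ m = weyl (\<lambda>c. 0) (\<lambda>c. of_nat m * z c)"
proof (induction m)
  case 0
  thus ?case by (simp add: weyl_id)
next
  case (Suc m)
  have "finite {c. of_nat m * z c \<noteq> 0}" by (rule finite_subset[OF _ assms]) auto
  thus ?case using Suc weyl_Z_comp[OF assms] by (simp add: distrib_right)
qed

lemma of_nat_to_int_mod_ring: "of_nat (nat (to_int_mod_ring m)) = (m :: 'p::prime_card mod_ring)"
proof -
  have "to_int_mod_ring m \<in> range (to_int_mod_ring :: 'p mod_ring \<Rightarrow> int)" by blast
  hence "to_int_mod_ring m \<ge> 0" by (simp add: range_to_int_mod_ring)
  hence "of_nat (nat (to_int_mod_ring m)) = (of_int (to_int_mod_ring m) :: 'p mod_ring)"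
    by (metis int_nat_eq of_int_of_nat_eq)
  thus ?thesis by (simp add: of_int_of_int_mod_ring)
qed

lemma op_pow_weyl_Z:
  assumes "finite {c. z c \<noteq> 0}"
  shows "op_pow (weyl (\<lambda>c. 0) z) m = weyl (\<lambda>c. 0) (\<lambda>c. m * z c)"
  by (simp add: op_pow_def weyl_Z_funpow[OF assms] of_nat_to_int_mod_ring)

lemma finite_support_sum:
  assumes "finite T" "\<And>t. t \<in> T \<Longrightarrow> finite {b. y t b \<noteq> (0 :: 'b::comm_monoid_add)}"
  shows "finite {b. (\<Sum>t\<in>T. y t b) \<noteq> 0}"
proof (rule finite_subset)
  show "{b. (\<Sum>t\<in>T. y t b) \<noteq> 0} \<subseteq> (\<Union>t\<in>T. {b. y t b \<noteq> 0})"
    by (auto dest: sum.not_neutral_contains_not_neutral)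
  show "finite (\<Union>t\<in>T. {b. y t b \<noteq> 0})" using assms by blast
qed

lemma fold_weyl_Z:
  assumes "finite A" "\<And>i. i \<in> A \<Longrightarrow> finite {c. y i c \<noteq> 0}" and G: "\<And>i. i \<in> A \<Longrightarrow> G i = weyl (\<lambda>c. 0) (y i)"
  shows "Finite_Set.fold (\<lambda>i T. G i \<circ> T) id A = weyl (\<lambda>c. 0) (\<lambda>c. \<Sum>i\<in>A. y i c)"
proof -
  interpret comp_fun_commute_on A "\<lambda>i T. G i \<circ> T"
  proof
    fix i j assume "i \<in> A" "j \<in> A"
    hence "G j \<circ> G i = G i \<circ> G j"
      by (simp add: G weyl_Z_comp assms(2) add.commute)
    thus "(\<lambda>T. G j \<circ> T) \<circ> (\<lambda>T. G i \<circ> T) = (\<lambda>T. G i \<circ> T) \<circ> (\<lambda>T. G j \<circ> T)"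
      by (auto simp: fun_eq_iff)
  qed
  have gen: "Finite_Set.fold (\<lambda>i T. G i \<circ> T) id B = weyl (\<lambda>c. 0) (\<lambda>c. \<Sum>i\<in>B. y i c)"
    if "finite B" "B \<subseteq> A" for B
    using that
  proof (induction B rule: finite_induct)
    case (insert i B)
    have "finite {c. (\<Sum>j\<in>B. y j c) \<noteq> 0}"
      by (rule finite_support_sum) (use insert.hyps insert.prems assms(2) in auto)
    hence w: "weyl (\<lambda>c. 0) (y i) \<circ> weyl (\<lambda>c. 0) (\<lambda>c. \<Sum>i\<in>B. y i c)
        = weyl (\<lambda>c. 0) (\<lambda>c. y i c + (\<Sum>i\<in>B. y i c))"
      using insert.prems assms(2)[of i] by (intro weyl_Z_comp) auto
    have "Finite_Set.fold (\<lambda>i T. G i \<circ> T) id (insert i B) = G i \<circ> Finite_Set.fold (\<lambda>i T. G i \<circ> T) id B"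
      by (rule fold_insert) (use insert in auto)
    also have "Finite_Set.fold (\<lambda>i T. G i \<circ> T) id B = weyl (\<lambda>c. 0) (\<lambda>c. \<Sum>i\<in>B. y i c)"
      by (rule insert.IH) (use insert.prems in auto)
    also have "G i = weyl (\<lambda>c. 0) (y i)" using insert.prems by (intro G) auto
    also note w
    finally show ?case using insert.hyps by simp
  qed (simp add: weyl_id)
  show ?thesis by (rule gen[OF assms(1) order_refl])
qed

text \<open>
  The product in \<open>op_prod\<close> ranges over the factors different from the identity. These need not be
  the indices with \<open>y i \<noteq> 0\<close> known beforehand, so the factors in \<open>T\<close> that happen to be the identity
  are put back in.
\<close>

lemma op_prod_weyl_Z:
  assumes T: "finite T" "T \<subseteq> I" and y: "\<And>i. i \<in> T \<Longrightarrow> finite {c. y i c \<noteq> 0}"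
    and 0: "\<And>i c. i \<in> I - T \<Longrightarrow> y i c = 0" and G: "\<And>i. i \<in> I \<Longrightarrow> G i = weyl (\<lambda>c. 0) (y i)"
  shows "op_prod G I = weyl (\<lambda>c. 0) (\<lambda>c. \<Sum>i\<in>T. y i c)"
proof -
  let ?A = "{i \<in> I. G i \<noteq> id}"
  have A: "?A \<subseteq> T"
  proof
    fix i assume i: "i \<in> ?A"
    show "i \<in> T"
    proof (rule ccontr)
      assume "i \<notin> T"
      hence "y i = (\<lambda>c. 0)" using 0 i by auto
      thus False using i G[of i] by (simp add: weyl_id)
    qed
  qed
  have fin: "finite {c. (\<Sum>i\<in>B. y i c) \<noteq> 0}" if "B \<subseteq> T" for B
    by (rule finite_support_sum) (use that y finite_subset[OF that T(1)] in auto)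
  \<comment> \<open>Indices with \<open>G i = id\<close> contribute the identity even where \<open>y i\<close> is not known to vanish.\<close>
  have rest: "weyl (\<lambda>c. 0) (\<lambda>c. \<Sum>i\<in>B. y i c) = id" if "finite B" "B \<subseteq> T - ?A" for B
    using that
  proof (induction B rule: finite_induct)
    case (insert i B)
    have "i \<in> I" "G i = id" using insert.prems T by auto
    hence "weyl (\<lambda>c. 0) (y i) = id" using G by metis
    moreover have "weyl (\<lambda>c. 0) (\<lambda>c. y i c + (\<Sum>j\<in>B. y j c)) = weyl (\<lambda>c. 0) (y i) \<circ> weyl (\<lambda>c. 0) (\<lambda>c. \<Sum>j\<in>B. y j c)"
      using insert.prems by (subst weyl_Z_comp) (auto intro!: y fin)
    ultimately show ?case using insert by simp
  qed (simp add: weyl_id)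
  have "op_prod G I = weyl (\<lambda>c. 0) (\<lambda>c. \<Sum>i\<in>?A. y i c)"
    unfolding op_prod_def by (rule fold_weyl_Z) (use A T y G finite_subset in auto)
  also have "\<dots> = weyl (\<lambda>c. 0) (\<lambda>c. \<Sum>i\<in>T - ?A. y i c) \<circ> weyl (\<lambda>c. 0) (\<lambda>c. \<Sum>i\<in>?A. y i c)"
    using T by (subst rest) auto
  also have "\<dots> = weyl (\<lambda>c. 0) (\<lambda>c. (\<Sum>i\<in>T - ?A. y i c) + (\<Sum>i\<in>?A. y i c))"
    by (rule weyl_Z_comp) (use A in \<open>auto intro!: fin\<close>)
  also have "\<dots> = weyl (\<lambda>c. 0) (\<lambda>c. \<Sum>i\<in>T. y i c)"
    by (simp only: sum.subset_diff[OF A T(1)])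
  finally show ?thesis .
qed

lemma op_prod_pauli_Z:
  fixes f :: "'a \<Rightarrow> 'p::prime_card mod_ring"
  assumes "finite F" "F \<subseteq> \<Lambda>" "\<And>b. b \<notin> F \<Longrightarrow> f b = 0" "\<And>b. b \<in> \<Lambda> \<Longrightarrow> g b = f b"
  shows "op_prod (\<lambda>b. op_pow (pauli_Z b) (g b)) \<Lambda> = weyl (\<lambda>b. 0) f"
proof -
  have fin: "finite {c. of_bool (c = b) \<noteq> (0 :: 'p mod_ring)}" for b :: 'a by simp
  have "op_prod (\<lambda>b. op_pow (pauli_Z b) (g b)) \<Lambda> = weyl (\<lambda>c. 0) (\<lambda>c. \<Sum>b\<in>F. f b * of_bool (c = b))"
  proof (rule op_prod_weyl_Z[OF assms(1,2)])
    show "op_pow (pauli_Z b) (g b) = weyl (\<lambda>c. 0) (\<lambda>c. f b * of_bool (c = b))" if "b \<in> \<Lambda>" for b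
      by (simp only: weyl_pauli_Z[symmetric] op_pow_weyl_Z[OF fin] assms(4)[OF that])
  qed (use assms(3) in auto)
  also have "(\<lambda>c. \<Sum>b\<in>F. f b * of_bool (c = b)) = f"
  proof
    fix c
    show "(\<Sum>b\<in>F. f b * of_bool (c = b)) = f c"
    proof (cases "c \<in> F")
      case True
      have "(\<Sum>b\<in>F. f b * of_bool (c = b)) = (\<Sum>b\<in>{c}. f b * of_bool (c = b))"
        by (rule sum.mono_neutral_right) (use True assms(1) in auto)
      thus ?thesis by simp
    next
      case False
      thus ?thesis using assms(3) by (auto intro!: sum.neutral)
    qed
  qed
  finally show ?thesis .
qed

section \<open>Products of Weyl operators up to phase\<close>

text \<open>
  Equality up to a phase, with finite supports included so that such operators can be multiplied.
\<close>

definition is_weyl :: "('a, 'p::prime_card) qop \<Rightarrow> ('a \<Rightarrow> 'p mod_ring) \<Rightarrow> ('a \<Rightarrow> 'p mod_ring) \<Rightarrow> bool" where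
  "is_weyl T x z \<longleftrightarrow> finite {c. x c \<noteq> 0} \<and> finite {c. z c \<noteq> 0} \<and> (\<exists>\<theta>. cmod \<theta> = 1 \<and> T = op_scale \<theta> (weyl x z))"

lemma is_weylI: "finite {c. x c \<noteq> 0} \<Longrightarrow> finite {c. z c \<noteq> 0} \<Longrightarrow> is_weyl (weyl x z) x z"
  unfolding is_weyl_def by (intro conjI exI[of _ 1]) (auto simp: op_scale_def)

lemma is_weyl_id: "is_weyl id (\<lambda>c. 0) (\<lambda>c. 0)"
  using is_weylI[of "\<lambda>c. 0" "\<lambda>c. 0"] by (simp add: weyl_id)

lemma finite_support_add:
  fixes x y :: "'a \<Rightarrow> 'b::monoid_add"
  shows "finite {c. x c \<noteq> 0} \<Longrightarrow> finite {c. y c \<noteq> 0} \<Longrightarrow> finite {c. x c + y c \<noteq> 0}"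
  by (rule finite_subset[of _ "{c. x c \<noteq> 0} \<union> {c. y c \<noteq> 0}"]) auto

lemma is_weyl_comp:
  assumes "is_weyl T x z" "is_weyl T' x' z'"
  shows "is_weyl (T \<circ> T') (\<lambda>c. x c + x' c) (\<lambda>c. z c + z' c)"
proof -
  obtain \<theta> \<theta>' where T: "cmod \<theta> = 1" "T = op_scale \<theta> (weyl x z)" "cmod \<theta>' = 1" "T' = op_scale \<theta>' (weyl x' z')"
    using assms unfolding is_weyl_def by blast
  have fin: "finite {c. x c \<noteq> 0}" "finite {c. z c \<noteq> 0}" "finite {c. x' c \<noteq> 0}" "finite {c. z' c \<noteq> 0}"
    using assms unfolding is_weyl_def by blast+
  have "T \<circ> T' = op_scale (\<theta> * \<theta>') (weyl x z \<circ> weyl x' z')"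
    unfolding T by (simp add: fun_eq_iff op_scale_def weyl_def)
  also have "\<dots> = op_scale (\<theta> * \<theta>' * omega (- dot z' x)) (weyl (\<lambda>c. x c + x' c) (\<lambda>c. z c + z' c))"
    unfolding weyl_comp[OF fin(2,4)] by (simp add: op_scale_def fun_eq_iff)
  finally have "T \<circ> T' = \<dots>" .
  moreover have "cmod (\<theta> * \<theta>' * omega (- dot z' x)) = 1" using T by (simp add: norm_mult)
  ultimately show ?thesis unfolding is_weyl_def
    using finite_support_add[OF fin(1,3)] finite_support_add[OF fin(2,4)] by blast
qed

lemma is_weyl_funpow: "is_weyl T x z \<Longrightarrow> is_weyl (T ^^ m) (\<lambda>c. of_nat m * x c) (\<lambda>c. of_nat m * z c)"
proof (induction m)
  case 0
  thus ?case using is_weyl_id by (simp add: id_def)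
next
  case (Suc m)
  from is_weyl_comp[OF Suc.prems Suc.IH[OF Suc.prems]] show ?case by (simp add: distrib_right o_def)
qed

text \<open>
  The commutator phase of two Weyl operators is the difference of the two pairings.
\<close>

lemma is_weyl_commute:
  assumes "is_weyl T x z" "is_weyl T' x' z'" "dot z' x = dot z x'"
  shows "T \<circ> T' = T' \<circ> T"
proof -
  obtain \<theta> \<theta>' where T: "T = op_scale \<theta> (weyl x z)" "T' = op_scale \<theta>' (weyl x' z')"
    using assms unfolding is_weyl_def by blast
  have fin: "finite {c. z c \<noteq> 0}" "finite {c. z' c \<noteq> 0}" using assms unfolding is_weyl_def by blast+
  have c: "weyl x z (weyl x' z' \<psi>) = weyl x' z' (weyl x z \<psi>)" for \<psi>
    using fun_cong[OF weyl_comp[OF fin], of x x' \<psi>] fun_cong[OF weyl_comp[OF fin(2,1)], of x' x \<psi>] assms(3)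
    by (simp add: add.commute)
  have s: "weyl x z (\<lambda>s. \<alpha> * \<psi> s) = (\<lambda>s. \<alpha> * weyl x z \<psi> s)" for \<alpha> and x z :: "'a \<Rightarrow> 'b mod_ring" and \<psi>
    by (simp add: weyl_def fun_eq_iff)
  show ?thesis unfolding T by (simp add: fun_eq_iff op_scale_def s c mult.left_commute)
qed

lemma is_weyl_linear:
  assumes "is_weyl T x z"
  shows "T (\<lambda>s. \<alpha> * \<psi> s + \<phi> s) = (\<lambda>s. \<alpha> * T \<psi> s + T \<phi> s)"
proof -
  obtain \<theta> where "T = op_scale \<theta> (weyl x z)" using assms unfolding is_weyl_def by blast
  thus ?thesis by (simp add: op_scale_def weyl_def fun_eq_iff distrib_left mult.left_commute)
qed

definition word :: "(('a, 'p::prime_card) qop \<times> nat) list \<Rightarrow> ('a, 'p) qop" where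
  "word ops = foldr (\<lambda>(T, m) Q. (T ^^ m) \<circ> Q) ops id"

lemma word_Nil [simp]: "word [] = id"
  by (simp add: word_def)

lemma word_Cons [simp]: "word ((T, m) # ops) = (T ^^ m) \<circ> word ops"
  by (simp add: word_def)

lemma word_append: "word (xs @ ys) = word xs \<circ> word ys"
proof (induction xs)
  case (Cons a xs)
  thus ?case by (cases a) (simp add: comp_assoc)
qed simp

lemma is_weyl_word:
  assumes "finite F" "\<And>a. a \<in> F \<Longrightarrow> is_weyl (g a) (x a) (z a)"
  shows "\<exists>ops. (\<forall>(T, m)\<in>set ops. T \<in> g ` F) \<and>
    is_weyl (word ops) (\<lambda>c. \<Sum>a\<in>F. u a * x a c) (\<lambda>c. \<Sum>a\<in>F. u a * z a c)"
  using assms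
proof (induction F rule: finite_induct)
  case empty
  thus ?case using is_weyl_id by (intro exI[of _ "[]"]) (simp add: id_def)
next
  case (insert a F)
  then obtain ops where ops: "\<forall>(T, m)\<in>set ops. T \<in> g ` F"
    "is_weyl (word ops) (\<lambda>c. \<Sum>a\<in>F. u a * x a c) (\<lambda>c. \<Sum>a\<in>F. u a * z a c)" by auto
  let ?m = "nat (to_int_mod_ring (u a))"
  have "is_weyl (g a ^^ ?m) (\<lambda>c. u a * x a c) (\<lambda>c. u a * z a c)"
    using is_weyl_funpow[OF insert.prems, of a ?m] by (simp add: of_nat_to_int_mod_ring)
  from is_weyl_comp[OF this ops(2)] show ?case using insert.hyps ops(1)
    by (intro exI[of _ "(g a, ?m) # ops"]) (auto simp: o_def)
qed

section \<open>Local operators are spanned by Weyl operators\<close>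

text \<open>
  The condition in \<open>supported_on\<close> for one fixed finite set.
\<close>

definition acts_on :: "'a set \<Rightarrow> ('a, 'p::prime_card) qop \<Rightarrow> bool" where
  "acts_on F T \<longleftrightarrow> (\<exists>M :: ('a, 'p) config \<Rightarrow> ('a, 'p) config \<Rightarrow> complex.
      \<forall>\<psi> s. T \<psi> s = (\<Sum>r \<in> F \<rightarrow>\<^sub>E UNIV. M (restrict s F) r * \<psi> (override_on s r F)))"

lemma supported_on_iff: "supported_on S T \<longleftrightarrow> (\<exists>F. finite F \<and> F \<subseteq> S \<and> acts_on F T)"
  unfolding supported_on_def acts_on_def by blast

lemma finite_configs: "finite F \<Longrightarrow> finite (F \<rightarrow>\<^sub>E (UNIV :: 'p::prime_card mod_ring set))"
  by (intro finite_PiE) auto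

lemma acts_on_weyl:
  assumes F: "finite F" and x: "\<And>c. c \<notin> F \<Longrightarrow> x c = 0" and z: "\<And>c. c \<notin> F \<Longrightarrow> z c = 0"
  shows "acts_on F (weyl x z)"
  unfolding acts_on_def
proof (intro exI allI)
  fix \<psi> :: "('a, 'b) wave" and s
  let ?M = "\<lambda>u r. omega (\<Sum>c\<in>F. z c * u c) * of_bool (r = restrict (\<lambda>c. u c - x c) F)"
  let ?r = "restrict (\<lambda>c. s c - x c) F"
  have r: "restrict (\<lambda>c. restrict s F c - x c) F = ?r" by auto
  have o: "override_on s ?r F = (\<lambda>c. s c - x c)" using x by (auto simp: override_on_def fun_eq_iff)
  have d: "dot z s = (\<Sum>c\<in>F. z c * s c)" by (rule dot_eq[OF F z])
  have e: "(\<Sum>c\<in>F. z c * restrict s F c) = (\<Sum>c\<in>F. z c * s c)" by (intro sum.cong) auto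
  have "(\<Sum>r \<in> F \<rightarrow>\<^sub>E UNIV. ?M (restrict s F) r * \<psi> (override_on s r F))
      = (\<Sum>r \<in> {?r}. ?M (restrict s F) r * \<psi> (override_on s r F))"
    by (rule sum.mono_neutral_right) (use finite_configs[OF F] in \<open>auto simp: r\<close>)
  also have "\<dots> = weyl x z \<psi> s" unfolding weyl_def by (simp add: r o d e del: restrict_apply restrict_apply')
  finally show "weyl x z \<psi> s = (\<Sum>r \<in> F \<rightarrow>\<^sub>E UNIV. ?M (restrict s F) r * \<psi> (override_on s r F))" ..
qed

lemma acts_on_scale:
  assumes "acts_on F T"
  shows "acts_on F (op_scale \<alpha> T)"
proof -
  obtain M where M: "\<And>\<psi> s. T \<psi> s = (\<Sum>r \<in> F \<rightarrow>\<^sub>E UNIV. M (restrict s F) r * \<psi> (override_on s r F))"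
    using assms unfolding acts_on_def by blast
  show ?thesis unfolding acts_on_def
    by (rule exI[of _ "\<lambda>u r. \<alpha> * M u r"]) (simp add: op_scale_def M sum_distrib_left mult.assoc)
qed

lemma acts_on_add:
  assumes "acts_on F T" "acts_on F T'"
  shows "acts_on F (op_add T T')"
proof -
  obtain M where M: "\<And>\<psi> s. T \<psi> s = (\<Sum>r \<in> F \<rightarrow>\<^sub>E UNIV. M (restrict s F) r * \<psi> (override_on s r F))"
    using assms unfolding acts_on_def by blast
  obtain M' where M': "\<And>\<psi> s. T' \<psi> s = (\<Sum>r \<in> F \<rightarrow>\<^sub>E UNIV. M' (restrict s F) r * \<psi> (override_on s r F))"
    using assms unfolding acts_on_def by blast
  show ?thesis unfolding acts_on_def
    by (rule exI[of _ "\<lambda>u r. M u r + M' u r"]) (simp add: op_add_def M M' sum.distrib distrib_right)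
qed

lemma acts_on_comp:
  assumes "acts_on F T" "acts_on F T'"
  shows "acts_on F (T \<circ> T')"
proof -
  obtain M where M: "\<And>\<psi> s. T \<psi> s = (\<Sum>r \<in> F \<rightarrow>\<^sub>E UNIV. M (restrict s F) r * \<psi> (override_on s r F))"
    using assms unfolding acts_on_def by blast
  obtain M' where M': "\<And>\<psi> s. T' \<psi> s = (\<Sum>r \<in> F \<rightarrow>\<^sub>E UNIV. M' (restrict s F) r * \<psi> (override_on s r F))"
    using assms unfolding acts_on_def by blast
  show ?thesis unfolding acts_on_def
  proof (intro exI allI)
    fix \<psi> s
    have o: "override_on (override_on s r F) q F = override_on s q F" for r q :: "'a \<Rightarrow> 'b mod_ring"
      by (auto simp: override_on_def)
    have re: "restrict (override_on s r F) F = r" if "r \<in> F \<rightarrow>\<^sub>E UNIV" for r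
      using that by (auto simp: override_on_def restrict_def PiE_def extensional_def fun_eq_iff)
    have "(T \<circ> T') \<psi> s = (\<Sum>r \<in> F \<rightarrow>\<^sub>E UNIV. M (restrict s F) r *
        (\<Sum>q \<in> F \<rightarrow>\<^sub>E UNIV. M' r q * \<psi> (override_on s q F)))"
      unfolding comp_def M by (intro sum.cong refl) (simp add: M' re o)
    also have "\<dots> = (\<Sum>r \<in> F \<rightarrow>\<^sub>E UNIV. \<Sum>q \<in> F \<rightarrow>\<^sub>E UNIV. M (restrict s F) r * M' r q * \<psi> (override_on s q F))"
      by (simp add: sum_distrib_left mult.assoc)
    also have "\<dots> = (\<Sum>q \<in> F \<rightarrow>\<^sub>E UNIV. \<Sum>r \<in> F \<rightarrow>\<^sub>E UNIV. M (restrict s F) r * M' r q * \<psi> (override_on s q F))"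
      by (rule sum.swap)
    also have "\<dots> = (\<Sum>q \<in> F \<rightarrow>\<^sub>E UNIV. (\<Sum>r \<in> F \<rightarrow>\<^sub>E UNIV. M (restrict s F) r * M' r q) * \<psi> (override_on s q F))"
      by (simp add: sum_distrib_right)
    finally show "(T \<circ> T') \<psi> s = (\<Sum>q \<in> F \<rightarrow>\<^sub>E UNIV.
        (\<lambda>u q. \<Sum>r \<in> F \<rightarrow>\<^sub>E UNIV. M u r * M' r q) (restrict s F) q * \<psi> (override_on s q F))" .
  qed
qed

lemma acts_on_zero: "acts_on F (\<lambda>\<psi> s. 0)"
  unfolding acts_on_def by (rule exI[of _ "\<lambda>u r. 0"]) simp

lemma op_sum_Suc: "op_sum f {..<Suc N} = op_add (op_sum f {..<N}) (f N)"
  by (simp add: op_sum_def op_add_def fun_eq_iff)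

lemma acts_on_op_sum: "(\<And>i. i < (N::nat) \<Longrightarrow> acts_on F (f i)) \<Longrightarrow> acts_on F (op_sum f {..<N})"
proof (induction N)
  case 0
  thus ?case using acts_on_zero by (simp add: op_sum_def)
next
  case (Suc N)
  thus ?case unfolding op_sum_Suc by (intro acts_on_add) auto
qed

text \<open>
  Fourier inversion on \<open>\<int>\<^sub>p\<^sup>F\<close>: a product of one orthogonality relation for each site.
\<close>

lemma config_indicator:
  fixes s u :: "'a \<Rightarrow> 'p::prime_card mod_ring"
  assumes F: "finite F"
  shows "(\<Sum>z \<in> F \<rightarrow>\<^sub>E UNIV. omega (\<Sum>c\<in>F. z c * (s c - u c)))
    = (if \<forall>c\<in>F. s c = u c then of_nat CARD('p) ^ card F else 0)"
proof -
  have "(\<Sum>z \<in> F \<rightarrow>\<^sub>E UNIV. omega (\<Sum>c\<in>F. z c * (s c - u c)))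
      = (\<Sum>z \<in> F \<rightarrow>\<^sub>E UNIV. \<Prod>c\<in>F. omega (z c * (s c - u c)))" by (simp add: omega_sum[OF F])
  also have "\<dots> = (\<Prod>c\<in>F. \<Sum>z\<in>UNIV. omega (z * (s c - u c)))"
    by (rule prod_sum_PiE[symmetric, OF F]) simp
  also have "\<dots> = (\<Prod>c\<in>F. if s c = u c then of_nat CARD('p) else 0)"
    by (simp add: omega_orthogonality)
  also have "\<dots> = (if \<forall>c\<in>F. s c = u c then of_nat CARD('p) ^ card F else 0)"
    using F by (auto intro!: prod_zero)
  finally show ?thesis .
qed

text \<open>
  The matrix unit that takes the configuration \<open>r\<close> on \<open>F\<close> to \<open>u\<close> is the shift by \<open>u - r\<close> followed by
  the projection onto \<open>u\<close>, and \<open>config_indicator\<close> writes this projection as a combination of products of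
  \<open>Z\<close>. The summation index is a triple of configurations \<open>(u, r, z)\<close>.
\<close>

lemma acts_on_expansion:
  fixes T :: "('a, 'p::prime_card) qop"
  assumes F: "finite F" and T: "acts_on F T"
  shows "\<exists>(N::nat) \<alpha> x z. (\<forall>i<N. \<forall>c. c \<notin> F \<longrightarrow> x i c = 0 \<and> z i c = 0) \<and>
    T = op_sum (\<lambda>i. op_scale (\<alpha> i) (weyl (x i) (z i))) {..<N}"
proof -
  obtain M where M: "\<And>\<psi> s. T \<psi> s = (\<Sum>r \<in> F \<rightarrow>\<^sub>E UNIV. M (restrict s F) r * \<psi> (override_on s r F))"
    using T unfolding acts_on_def by blast
  let ?C = "F \<rightarrow>\<^sub>E (UNIV :: 'p mod_ring set)"
  let ?D = "?C \<times> ?C \<times> ?C"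
  \<comment> \<open>The number of configurations on \<open>F\<close>, which normalizes the Fourier sum.\<close>
  define q :: complex where "q = of_nat CARD('p) ^ card F"
  have q: "q \<noteq> 0" by (simp add: q_def)
  define X :: "('a \<Rightarrow> 'p mod_ring) \<times> ('a \<Rightarrow> 'p mod_ring) \<times> ('a \<Rightarrow> 'p mod_ring) \<Rightarrow> 'a \<Rightarrow> 'p mod_ring"
    where "X = (\<lambda>(u, r, z) c. if c \<in> F then u c - r c else 0)"
  define Z :: "('a \<Rightarrow> 'p mod_ring) \<times> ('a \<Rightarrow> 'p mod_ring) \<times> ('a \<Rightarrow> 'p mod_ring) \<Rightarrow> 'a \<Rightarrow> 'p mod_ring"
    where "Z = (\<lambda>(u, r, z) c. if c \<in> F then z c else 0)"
  define A where "A = (\<lambda>(u, r, z). M u r / q * omega (- (\<Sum>c\<in>F. z c * u c)))"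
  have finD: "finite ?D" using finite_configs[OF F] by auto
  have main: "T \<psi> s = (\<Sum>i\<in>?D. A i * weyl (X i) (Z i) \<psi> s)" for \<psi> s
  proof -
    have "(\<Sum>i\<in>?D. A i * weyl (X i) (Z i) \<psi> s)
        = (\<Sum>u\<in>?C. \<Sum>r\<in>?C. \<Sum>z\<in>?C. A (u, r, z) * weyl (X (u, r, z)) (Z (u, r, z)) \<psi> s)"
      by (simp add: sum.cartesian_product)
    also have "\<dots> = (\<Sum>u\<in>?C. \<Sum>r\<in>?C. if u = restrict s F then M u r * \<psi> (override_on s r F) else 0)"
    proof (intro sum.cong refl)
      fix u r assume u: "u \<in> ?C" and r: "r \<in> ?C"
      have "(\<Sum>z\<in>?C. A (u, r, z) * weyl (X (u, r, z)) (Z (u, r, z)) \<psi> s)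
          = (\<Sum>z\<in>?C. M u r / q * \<psi> (\<lambda>c. s c - X (u, r, undefined) c) * omega (\<Sum>c\<in>F. z c * (s c - u c)))"
      proof (intro sum.cong refl)
        fix z
        have "dot (Z (u, r, z)) s = (\<Sum>c\<in>F. Z (u, r, z) c * s c)" by (rule dot_eq[OF F]) (simp add: Z_def)
        also have "\<dots> = (\<Sum>c\<in>F. z c * s c)" by (intro sum.cong) (auto simp: Z_def)
        finally have d: "dot (Z (u, r, z)) s = (\<Sum>c\<in>F. z c * s c)" .
        have "(\<Sum>c\<in>F. z c * (s c - u c)) = (\<Sum>c\<in>F. z c * s c) - (\<Sum>c\<in>F. z c * u c)"
          by (simp add: right_diff_distrib sum_subtractf)
        hence "omega (\<Sum>c\<in>F. z c * (s c - u c)) = omega (\<Sum>c\<in>F. z c * s c) * omega (- (\<Sum>c\<in>F. z c * u c))"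
          by (simp only: omega_diff)
        moreover have "X (u, r, z) = X (u, r, undefined)" by (simp add: X_def)
        ultimately show "A (u, r, z) * weyl (X (u, r, z)) (Z (u, r, z)) \<psi> s
          = M u r / q * \<psi> (\<lambda>c. s c - X (u, r, undefined) c) * omega (\<Sum>c\<in>F. z c * (s c - u c))"
          by (simp only: A_def weyl_def prod.case d mult_ac)
      qed
      also have "\<dots> = M u r / q * \<psi> (\<lambda>c. s c - X (u, r, undefined) c) * (if \<forall>c\<in>F. s c = u c then q else 0)"
        unfolding sum_distrib_left[symmetric] config_indicator[OF F] q_def ..
      also have "\<dots> = (if u = restrict s F then M u r * \<psi> (override_on s r F) else 0)"
      proof (cases "u = restrict s F")
        case True
        have "(\<lambda>c. s c - X (u, r, undefined) c) = override_on s r F"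
          using True by (auto simp: X_def override_on_def fun_eq_iff)
        thus ?thesis using True q by simp
      next
        case False
        moreover have "u = restrict s F" if "\<forall>c\<in>F. s c = u c"
          using that u by (auto simp: PiE_def extensional_def fun_eq_iff)
        ultimately have "\<not> (\<forall>c\<in>F. s c = u c)" by blast
        thus ?thesis using False by (simp only: if_False mult_zero_right)
      qed
      finally show "(\<Sum>z\<in>?C. A (u, r, z) * weyl (X (u, r, z)) (Z (u, r, z)) \<psi> s)
          = (if u = restrict s F then M u r * \<psi> (override_on s r F) else 0)" .
    qed
    also have "\<dots> = (\<Sum>u\<in>{restrict s F}. \<Sum>r\<in>?C. if u = restrict s F then M u r * \<psi> (override_on s r F) else 0)"
      by (rule sum.mono_neutral_right) (use finite_configs[OF F] in auto)
    also have "\<dots> = T \<psi> s" by (simp add: M)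
    finally show ?thesis by simp
  qed
  obtain h where h: "bij_betw h {..<card ?D} ?D"
    using ex_bij_betw_nat_finite[OF finD] by (auto simp: lessThan_atLeast0)
  have "T = op_sum (\<lambda>i. op_scale (A (h i)) (weyl (X (h i)) (Z (h i)))) {..<card ?D}"
    by (intro ext) (simp add: main op_sum_def op_scale_def sum.reindex_bij_betw[OF h, symmetric])
  moreover have "\<forall>i<card ?D. \<forall>c. c \<notin> F \<longrightarrow> X (h i) c = 0 \<and> Z (h i) c = 0"
    by (auto simp: X_def Z_def split: prod.splits)
  ultimately show ?thesis
    by (intro exI[of _ "card ?D"] exI[of _ "\<lambda>i. A (h i)"] exI[of _ "\<lambda>i. X (h i)"] exI[of _ "\<lambda>i. Z (h i)"] conjI)
qed

text \<open>
  For a single Weyl operator the set on which it acts can be enlarged at will, and Weyl operators span.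
\<close>

lemma acts_on_mono:
  assumes "acts_on F T" "F \<subseteq> F'" "finite F'"
  shows "acts_on F' T"
proof -
  obtain N \<alpha> x z where w: "\<forall>i<(N::nat). \<forall>c. c \<notin> F \<longrightarrow> x i c = 0 \<and> z i c = 0"
    "T = op_sum (\<lambda>i. op_scale (\<alpha> i) (weyl (x i) (z i))) {..<N}"
    using acts_on_expansion[OF finite_subset[OF assms(2,3)] assms(1)] by blast
  show ?thesis unfolding w(2)
    by (intro acts_on_op_sum acts_on_scale acts_on_weyl assms(3)) (use w(1) assms(2) in auto)
qed

lemma supported_on_mono: "supported_on S T \<Longrightarrow> S \<subseteq> S' \<Longrightarrow> supported_on S' T"
  unfolding supported_on_def by (meson order_trans)

lemma supported_on_common:
  assumes "supported_on S T" "supported_on S T'"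
  obtains F where "finite F" "F \<subseteq> S" "acts_on F T" "acts_on F T'"
proof -
  obtain F F' where "finite F" "F \<subseteq> S" "acts_on F T" "finite F'" "F' \<subseteq> S" "acts_on F' T'"
    using assms unfolding supported_on_iff by blast
  thus ?thesis using acts_on_mono[of F T "F \<union> F'"] acts_on_mono[of F' T' "F \<union> F'"]
    by (intro that[of "F \<union> F'"]) auto
qed

lemma supported_on_comp: "supported_on S T \<Longrightarrow> supported_on S T' \<Longrightarrow> supported_on S (T \<circ> T')"
  by (erule (1) supported_on_common) (use acts_on_comp supported_on_iff in blast)

lemma supported_on_add: "supported_on S T \<Longrightarrow> supported_on S T' \<Longrightarrow> supported_on S (op_add T T')"
  by (erule (1) supported_on_common) (use acts_on_add supported_on_iff in blast)

lemma supported_on_scale: "supported_on S T \<Longrightarrow> supported_on S (op_scale \<alpha> T)"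
  unfolding supported_on_iff using acts_on_scale by blast

lemma supported_on_is_weyl:
  assumes "is_weyl T x z" "{c. x c \<noteq> 0} \<subseteq> S" "{c. z c \<noteq> 0} \<subseteq> S"
  shows "supported_on S T"
proof -
  obtain \<theta> where T: "T = op_scale \<theta> (weyl x z)" and f: "finite {c. x c \<noteq> 0}" "finite {c. z c \<noteq> 0}"
    using assms(1) unfolding is_weyl_def by blast
  have "acts_on ({c. x c \<noteq> 0} \<union> {c. z c \<noteq> 0}) (weyl x z)" by (rule acts_on_weyl) (use f in auto)
  hence "supported_on S (weyl x z)" unfolding supported_on_iff using f assms(2,3) by blast
  thus ?thesis unfolding T by (rule supported_on_scale)
qed

lemma supported_on_id: "supported_on S id"
  by (rule supported_on_is_weyl[OF is_weyl_id]) auto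

lemma supported_on_funpow: "supported_on S T \<Longrightarrow> supported_on S (T ^^ m)"
proof (induction m)
  case 0
  thus ?case using supported_on_id by (simp add: id_def)
next
  case (Suc m)
  thus ?case using supported_on_comp[of S T "T ^^ m"] by (simp add: o_def)
qed

lemma supported_on_word: "(\<And>T m. (T, m) \<in> set ops \<Longrightarrow> supported_on S T) \<Longrightarrow> supported_on S (word ops)"
proof (induction ops)
  case Nil
  thus ?case using supported_on_id by (simp add: id_def)
next
  case (Cons a ops)
  obtain T m where a: "a = (T, m)" by (cases a)
  have "supported_on S (T ^^ m)" by (rule supported_on_funpow, rule Cons.prems[of T m]) (simp add: a)
  moreover have "supported_on S (word ops)" by (rule Cons.IH, rule Cons.prems) auto
  ultimately have "supported_on S (T ^^ m \<circ> word ops)" by (rule supported_on_comp)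
  thus ?case by (simp only: a word_Cons)
qed

section \<open>Subalgebras and commutants\<close>

lemma subalgebra_local_ops: "subalgebra (local_ops \<Lambda>)"
  unfolding subalgebra_def local_ops_def
  using supported_on_id supported_on_add supported_on_comp supported_on_scale by blast

lemma subalgebra_hull: "subalgebra (subalgebra hull G)"
  by (rule hull_in) (simp add: subalgebra_def)

lemma subalgebra_word:
  assumes "subalgebra B" "\<And>T m. (T, m) \<in> set ops \<Longrightarrow> T \<in> B"
  shows "word ops \<in> B"
  using assms(2)
proof (induction ops)
  case Nil
  show ?case using assms(1) by (simp only: subalgebra_def word_Nil)
next
  case (Cons a ops)
  obtain T m where a: "a = (T, m)" by (cases a)
  have "T \<in> B" by (rule Cons.prems[of T m]) (simp add: a)
  have "T ^^ j \<in> B" for j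
  proof (induction j)
    case 0
    have "T ^^ 0 = id" by (simp add: id_def)
    thus ?case using assms(1) by (simp only: subalgebra_def)
  next
    case (Suc j)
    have "T ^^ Suc j = T \<circ> T ^^ j" by (simp add: o_def)
    thus ?case using assms(1) Suc \<open>T \<in> B\<close> by (simp only: subalgebra_def)
  qed
  moreover have "word ops \<in> B" by (rule Cons.IH, rule Cons.prems) auto
  ultimately have "T ^^ m \<circ> word ops \<in> B" using assms(1) by (simp only: subalgebra_def)
  thus ?case by (simp only: a word_Cons)
qed

text \<open>
  Passing from generators to their sums and multiples uses that Weyl operators are linear.
\<close>

lemma commute_hull:
  assumes T: "is_weyl T x z" and c: "\<And>S. S \<in> G \<Longrightarrow> S \<circ> T = T \<circ> S" and S: "S \<in> subalgebra hull G"
  shows "S \<circ> T = T \<circ> S"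
  using S
proof (rule hull_induct)
  show "S \<circ> T = T \<circ> S" if "S \<in> G" for S using c that .
  have l: "T (\<lambda>s. \<alpha> * \<psi> s + \<phi> s) = (\<lambda>s. \<alpha> * T \<psi> s + T \<phi> s)" for \<alpha> \<psi> \<phi> by (rule is_weyl_linear[OF T])
  have 0: "T (\<lambda>s. 0) = (\<lambda>s. 0)" using l[of "- 1" "\<lambda>s. 0" "\<lambda>s. 0"] by simp
  have add: "T (\<lambda>s. \<psi> s + \<phi> s) = (\<lambda>s. T \<psi> s + T \<phi> s)" for \<psi> \<phi> using l[of 1 \<psi> \<phi>] by simp
  have sc: "T (\<lambda>s. \<alpha> * \<psi> s) = (\<lambda>s. \<alpha> * T \<psi> s)" for \<alpha> \<psi> using l[of \<alpha> \<psi> "\<lambda>s. 0"] by (simp add: 0)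
  show "subalgebra {S. S \<circ> T = T \<circ> S}"
    unfolding subalgebra_def
  proof (intro conjI ballI allI)
    fix S S' assume "S \<in> {S. S \<circ> T = T \<circ> S}" "S' \<in> {S. S \<circ> T = T \<circ> S}"
    hence *: "S (T \<psi>) = T (S \<psi>)" "S' (T \<psi>) = T (S' \<psi>)" for \<psi> by (simp_all add: fun_eq_iff)
    show "op_add S S' \<in> {S. S \<circ> T = T \<circ> S}" "S \<circ> S' \<in> {S. S \<circ> T = T \<circ> S}"
      by (simp_all add: op_add_def fun_eq_iff * add)
  next
    fix \<alpha> S assume "S \<in> {S. S \<circ> T = T \<circ> S}"
    hence *: "S (T \<psi>) = T (S \<psi>)" for \<psi> by (simp add: fun_eq_iff)
    show "op_scale \<alpha> S \<in> {S. S \<circ> T = T \<circ> S}" by (simp add: op_scale_def fun_eq_iff * sc)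
  qed simp
qed

lemma commute_word:
  assumes "\<And>T m. (T, m) \<in> set ops \<Longrightarrow> S \<circ> T = T \<circ> S"
  shows "S \<circ> word ops = word ops \<circ> S"
  using assms
proof (induction ops)
  case (Cons a ops)
  obtain T m where a: "a = (T, m)" by (cases a)
  have T: "S (T \<psi>) = T (S \<psi>)" for \<psi> using Cons.prems[of T m] a by (simp add: fun_eq_iff)
  have pw: "S ((T ^^ j) \<psi>) = (T ^^ j) (S \<psi>)" for j \<psi> by (induction j) (simp_all add: T)
  have "S \<circ> word ops = word ops \<circ> S" by (rule Cons.IH, rule Cons.prems) auto
  hence "S (word ops \<psi>) = word ops (S \<psi>)" for \<psi> by (simp add: fun_eq_iff)
  thus ?case by (simp only: a word_Cons comp_def pw)
qed simp

lemma word_is_weyl: "(\<And>T m. (T, m) \<in> set ops \<Longrightarrow> \<exists>x z. is_weyl T x z) \<Longrightarrow> \<exists>x z. is_weyl (word ops) x z"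
proof (induction ops)
  case Nil
  thus ?case using is_weyl_id unfolding word_Nil by blast
next
  case (Cons a ops)
  obtain T m where a: "a = (T, m)" by (cases a)
  obtain x z where "is_weyl T x z" using Cons.prems[of T m] a by auto
  hence T: "is_weyl (T ^^ m) (\<lambda>c. of_nat m * x c) (\<lambda>c. of_nat m * z c)" by (rule is_weyl_funpow)
  have "\<exists>x z. is_weyl (word ops) x z" by (rule Cons.IH, rule Cons.prems) auto
  thus ?case unfolding a word_Cons using is_weyl_comp[OF T] by blast
qed

section \<open>Invertibility from an antisymmetric, locally invertible exponent matrix\<close>

text \<open>
  With \<open>y\<close> a local solution of \<open>w y = z\<close>, assembled from the solutions \<open>r c\<close> for single sites, the exponents
  \<open>u = (x + y) / 2\<close> for the \<open>A\<^sub>a\<close> and \<open>v = (x - y) / 2\<close> for the \<open>B\<^sub>a\<close> satisfy \<open>u + v = x\<close> and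
  \<open>w (u - v) = z\<close>.
\<close>

lemma weyl_generation:
  fixes w :: "'a \<Rightarrow> 'a \<Rightarrow> 'p::prime_card mod_ring" and D :: "'a \<Rightarrow> 'a \<Rightarrow> int"
  assumes 2: "(2 :: 'p mod_ring) \<noteq> 0"
    and A: "\<And>a. a \<in> \<Lambda> \<Longrightarrow> is_weyl (A a) (\<lambda>b. of_bool (b = a)) (w a)"
    and B: "\<And>a. a \<in> \<Lambda> \<Longrightarrow> is_weyl (B a) (\<lambda>b. of_bool (b = a)) (\<lambda>b. - w a b)"
    and D: "\<And>a. D a a = 0" and R: "0 \<le> R"
    and r: "\<And>c a. c \<in> \<Lambda> \<Longrightarrow> r c a \<noteq> 0 \<Longrightarrow> a \<in> \<Lambda> \<and> D a c \<le> R"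
    and r_fin: "\<And>c. c \<in> \<Lambda> \<Longrightarrow> finite {a. r c a \<noteq> 0}"
    and r_solve: "\<And>c b. c \<in> \<Lambda> \<Longrightarrow> (\<Sum>a | r c a \<noteq> 0. r c a * w a b) = of_bool (b = c)"
    and F: "finite F" "F \<subseteq> \<Lambda>" and x: "\<And>c. c \<notin> F \<Longrightarrow> x c = 0" and z: "\<And>c. c \<notin> F \<Longrightarrow> z c = 0"
  shows "\<exists>as bs. (\<forall>(T, m)\<in>set as. T \<in> A ` {a \<in> \<Lambda>. \<exists>c\<in>F. D a c \<le> R}) \<and>
    (\<forall>(T, m)\<in>set bs. T \<in> B ` {a \<in> \<Lambda>. \<exists>c\<in>F. D a c \<le> R}) \<and> is_weyl (word as \<circ> word bs) x z"
proof -
  define U where "U = F \<union> (\<Union>c\<in>F. {a. r c a \<noteq> 0})"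
  have U: "finite U" using F r_fin by (auto simp: U_def)
  have Usub: "U \<subseteq> {a \<in> \<Lambda>. \<exists>c\<in>F. D a c \<le> R}"
    using F r D R unfolding U_def by fastforce
  define y where "y = (\<lambda>a. \<Sum>c\<in>F. z c * r c a)"
  have y: "(\<Sum>a\<in>U. y a * w a b) = z b" for b
  proof -
    have "(\<Sum>a\<in>U. y a * w a b) = (\<Sum>a\<in>U. \<Sum>c\<in>F. z c * (r c a * w a b))"
      by (simp add: y_def sum_distrib_right mult.assoc)
    also have "\<dots> = (\<Sum>c\<in>F. z c * (\<Sum>a\<in>U. r c a * w a b))"
      by (subst sum.swap) (simp add: sum_distrib_left)
    also have "\<dots> = (\<Sum>c\<in>F. z c * of_bool (b = c))"
    proof (intro sum.cong refl arg_cong[where f = "\<lambda>t. _ * t"])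
      fix c assume c: "c \<in> F"
      have "(\<Sum>a\<in>U. r c a * w a b) = (\<Sum>a | r c a \<noteq> 0. r c a * w a b)"
        by (rule sum.mono_neutral_right) (use U c in \<open>auto simp: U_def\<close>)
      thus "(\<Sum>a\<in>U. r c a * w a b) = of_bool (b = c)" using r_solve c F by auto
    qed
    also have "\<dots> = z b"
    proof (cases "b \<in> F")
      case True
      have "(\<Sum>c\<in>F. z c * of_bool (b = c)) = (\<Sum>c\<in>{b}. z c * of_bool (b = c))"
        by (rule sum.mono_neutral_right) (use True F in auto)
      thus ?thesis by simp
    next
      case False
      thus ?thesis using z by (auto intro!: sum.neutral)
    qed
    finally show ?thesis .
  qed
  define u v where "u = (\<lambda>a. (x a + y a) / 2)" and "v = (\<lambda>a. (x a - y a) / 2)"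
  have uv: "u a + v a = x a" "u a - v a = y a" for a
    using 2 by (simp_all add: u_def v_def flip: add_divide_distrib diff_divide_distrib mult_2)
  have y0: "y c = 0" if "c \<notin> U" for c
    unfolding y_def by (rule sum.neutral) (use that in \<open>auto simp: U_def\<close>)
  have out: "u c = 0" "v c = 0" if "c \<notin> U" for c
    using that x[of c] y0[of c] by (auto simp: u_def v_def U_def)
  have delta: "(\<Sum>a\<in>U. t a * of_bool (c = a)) = t c" if "\<And>c. c \<notin> U \<Longrightarrow> t c = 0" for t :: "'a \<Rightarrow> 'p mod_ring" and c
  proof (cases "c \<in> U")
    case True
    have "(\<Sum>a\<in>U. t a * of_bool (c = a)) = (\<Sum>a\<in>{c}. t a * of_bool (c = a))"
      by (rule sum.mono_neutral_right) (use True U in auto)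
    thus ?thesis by simp
  next
    case False
    thus ?thesis using that by (auto intro!: sum.neutral)
  qed
  obtain as where as: "\<forall>(T, m)\<in>set as. T \<in> A ` U"
    "is_weyl (word as) (\<lambda>c. \<Sum>a\<in>U. u a * of_bool (c = a)) (\<lambda>c. \<Sum>a\<in>U. u a * w a c)"
    using is_weyl_word[OF U, of A "\<lambda>a b. of_bool (b = a)" w u] A Usub by blast
  obtain bs where bs: "\<forall>(T, m)\<in>set bs. T \<in> B ` U"
    "is_weyl (word bs) (\<lambda>c. \<Sum>a\<in>U. v a * of_bool (c = a)) (\<lambda>c. \<Sum>a\<in>U. v a * - w a c)"
    using is_weyl_word[OF U, of B "\<lambda>a b. of_bool (b = a)" "\<lambda>a b. - w a b" v] B Usub by blast
  have zz: "(\<Sum>a\<in>U. u a * w a c) + (\<Sum>a\<in>U. v a * - w a c) = z c" for c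
  proof -
    have "(\<Sum>a\<in>U. u a * w a c) + (\<Sum>a\<in>U. v a * - w a c) = (\<Sum>a\<in>U. (u a - v a) * w a c)"
      by (simp add: left_diff_distrib sum_subtractf sum_negf)
    thus ?thesis by (simp only: uv y)
  qed
  have "(\<Sum>a\<in>U. u a * of_bool (c = a)) = u c" "(\<Sum>a\<in>U. v a * of_bool (c = a)) = v c" for c
    by (intro delta out; assumption)+
  hence "is_weyl (word as \<circ> word bs) x z"
    using is_weyl_comp[OF as(2) bs(2)] by (simp only: uv zz)
  moreover have "\<forall>(T, m)\<in>set as. T \<in> A ` {a \<in> \<Lambda>. \<exists>c\<in>F. D a c \<le> R}"
    using as(1) image_mono[OF Usub, of A] by blast
  moreover have "\<forall>(T, m)\<in>set bs. T \<in> B ` {a \<in> \<Lambda>. \<exists>c\<in>F. D a c \<le> R}"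
    using bs(1) image_mono[OF Usub, of B] by blast
  ultimately show ?thesis by blast
qed

text \<open>
  The lattice enters only through the matrix \<open>w\<close>: it must be antisymmetric, of finite range \<open>Q\<close>, and
  have an inverse \<open>r\<close> of finite range \<open>R\<close>. A Weyl operator on a finite set \<open>F\<close> is then a product of
  generators based within \<open>R\<close> of \<open>F\<close>, each of which extends by another \<open>Q\<close>.
\<close>

lemma invertible_weyl_subalgebra:
  fixes w :: "'a \<Rightarrow> 'a \<Rightarrow> 'p::prime_card mod_ring" and D :: "'a \<Rightarrow> 'a \<Rightarrow> int"
  assumes 2: "(2 :: 'p mod_ring) \<noteq> 0"
    and A: "\<And>a. a \<in> \<Lambda> \<Longrightarrow> is_weyl (A a) (\<lambda>b. of_bool (b = a)) (w a)"
    and B: "\<And>a. a \<in> \<Lambda> \<Longrightarrow> is_weyl (B a) (\<lambda>b. of_bool (b = a)) (\<lambda>b. - w a b)"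
    and antisym: "\<And>a b. a \<in> \<Lambda> \<Longrightarrow> b \<in> \<Lambda> \<Longrightarrow> w a b = - w b a"
    and w: "\<And>a b. a \<in> \<Lambda> \<Longrightarrow> w a b \<noteq> 0 \<Longrightarrow> b \<in> \<Lambda> \<and> D b a \<le> Q"
    and D: "\<And>a. D a a = 0" "\<And>a b c. D a c \<le> D a b + D b c" and R: "0 \<le> R" "0 \<le> Q"
    and r: "\<And>c a. c \<in> \<Lambda> \<Longrightarrow> r c a \<noteq> 0 \<Longrightarrow> a \<in> \<Lambda> \<and> D a c \<le> R"
    and r_fin: "\<And>c. c \<in> \<Lambda> \<Longrightarrow> finite {a. r c a \<noteq> 0}"
    and r_solve: "\<And>c b. c \<in> \<Lambda> \<Longrightarrow> (\<Sum>a | r c a \<noteq> 0. r c a * w a b) = of_bool (b = c)"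
  shows "invertible_subalgebra \<Lambda> D (subalgebra hull (A ` \<Lambda>))"
    and "\<And>a b. a \<in> \<Lambda> \<Longrightarrow> b \<in> \<Lambda> \<Longrightarrow> A a \<circ> B b = B b \<circ> A a"
    and "\<And>c P. c \<in> \<Lambda> \<Longrightarrow> P \<in> {pauli_X c, pauli_Z c} \<Longrightarrow>
      \<exists>\<theta> (ops :: (('a, 'p) qop \<times> nat) list). cmod \<theta> = 1 \<and>
        (\<forall>(T, m)\<in>set ops. T \<in> A ` \<Lambda> \<union> B ` \<Lambda> \<and> supported_on (nbhd \<Lambda> D (Q + R) {c}) T) \<and>
        P = op_scale \<theta> (foldr (\<lambda>(T, m) Q. (T ^^ m) \<circ> Q) ops id)"
proof -
  have gen: "\<exists>as bs. (\<forall>(T, m)\<in>set as. T \<in> A ` {a \<in> \<Lambda>. \<exists>c\<in>F. D a c \<le> R}) \<and>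
      (\<forall>(T, m)\<in>set bs. T \<in> B ` {a \<in> \<Lambda>. \<exists>c\<in>F. D a c \<le> R}) \<and> is_weyl (word as \<circ> word bs) x z"
    if "finite F" "F \<subseteq> \<Lambda>" "\<And>c. c \<notin> F \<Longrightarrow> x c = 0" "\<And>c. c \<notin> F \<Longrightarrow> z c = 0" for F x z
    by (rule weyl_generation[where A = A and B = B and w = w and D = D and r = r and \<Lambda> = \<Lambda> and R = R, OF 2 A B D(1) R(1) r r_fin r_solve])
      (use that in auto)
  have suppA: "supported_on (nbhd \<Lambda> D (Q + R) S) (A a)" and suppB: "supported_on (nbhd \<Lambda> D (Q + R) S) (B a)"
    if a: "a \<in> \<Lambda>" "c \<in> S" "D a c \<le> R" for a c S
  proof -
    have "a \<in> nbhd \<Lambda> D (Q + R) S" using a R(2) unfolding nbhd_def by force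
    moreover have "b \<in> nbhd \<Lambda> D (Q + R) S" if "w a b \<noteq> 0" for b
    proof -
      have "b \<in> \<Lambda>" "D b c \<le> Q + R" using w[OF a(1) that] D(2)[of b c a] a(3) by auto
      thus ?thesis using a(2) unfolding nbhd_def by blast
    qed
    ultimately have "{b. of_bool (b = a) \<noteq> (0 :: 'p mod_ring)} \<subseteq> nbhd \<Lambda> D (Q + R) S"
      "{b. w a b \<noteq> 0} \<subseteq> nbhd \<Lambda> D (Q + R) S" "{b. - w a b \<noteq> 0} \<subseteq> nbhd \<Lambda> D (Q + R) S" by auto
    thus "supported_on (nbhd \<Lambda> D (Q + R) S) (A a)" "supported_on (nbhd \<Lambda> D (Q + R) S) (B a)"
      using supported_on_is_weyl[OF A[OF a(1)]] supported_on_is_weyl[OF B[OF a(1)]] by blast+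
  qed
  have local: "A a \<in> local_ops \<Lambda>" "B a \<in> local_ops \<Lambda>" if "a \<in> \<Lambda>" for a
  proof -
    have "nbhd \<Lambda> D (Q + R) {a} \<subseteq> \<Lambda>" by (auto simp: nbhd_def)
    thus "A a \<in> local_ops \<Lambda>" "B a \<in> local_ops \<Lambda>"
      using suppA[OF that, of a "{a}"] suppB[OF that, of a "{a}"] D(1)[of a] R(1) supported_on_mono
      unfolding local_ops_def by auto
  qed
  show comm: "A a \<circ> B b = B b \<circ> A a" if ab: "a \<in> \<Lambda>" "b \<in> \<Lambda>" for a b
  proof (rule is_weyl_commute[OF A[OF ab(1)] B[OF ab(2)]])
    have f: "finite {c. w a c \<noteq> 0}" "finite {c. - w b c \<noteq> 0}"
      using A[OF ab(1)] B[OF ab(2)] unfolding is_weyl_def by blast+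
    show "dot (\<lambda>c. - w b c) (\<lambda>c. of_bool (c = a)) = dot (w a) (\<lambda>c. of_bool (c = b))"
      unfolding dot_indicator_right[OF f(1)] dot_indicator_right[OF f(2)]
      using antisym[OF ab] by simp
  qed
  let ?H = "subalgebra hull (A ` \<Lambda>)"
  have Bcomm: "word bs \<in> commutant \<Lambda> ?H"
    if bs: "\<forall>(T, m)\<in>set bs. T \<in> B ` \<Lambda>" and W: "is_weyl (word bs) x z" for bs x z
  proof -
    have "word bs \<in> local_ops \<Lambda>"
      by (rule subalgebra_word[OF subalgebra_local_ops]) (use bs local in auto)
    moreover have "S \<circ> word bs = word bs \<circ> S" if "S \<in> ?H" for S
      using W _ that
    proof (rule commute_hull)
      fix S assume "S \<in> A ` \<Lambda>"
      thus "S \<circ> word bs = word bs \<circ> S" by (intro commute_word) (use bs comm in auto)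
    qed
    ultimately show ?thesis unfolding commutant_def by blast
  qed
  have Asub: "A a \<in> ?H" if "a \<in> \<Lambda>" for a using that by (intro hull_inc) auto
  show "invertible_subalgebra \<Lambda> D ?H"
    unfolding invertible_subalgebra_def
  proof (intro conjI exI[of _ "Q + R"] allI impI)
    show "subalgebra ?H" by (rule subalgebra_hull)
    show "?H \<subseteq> local_ops \<Lambda>" by (rule hull_minimal) (use local subalgebra_local_ops in auto)
    fix S :: "'a set" and T :: "('a, 'p) qop" assume "S \<subseteq> \<Lambda> \<and> supported_on S T"
    then obtain F where F: "finite F" "F \<subseteq> S" "S \<subseteq> \<Lambda>" "acts_on F T" unfolding supported_on_iff by blast
    obtain N \<alpha> x z where xz: "\<forall>i<(N::nat). \<forall>c. c \<notin> F \<longrightarrow> x i c = 0 \<and> z i c = 0"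
      and T: "T = op_sum (\<lambda>i. op_scale (\<alpha> i) (weyl (x i) (z i))) {..<N}"
      using acts_on_expansion[OF F(1,4)] by blast
    have "\<exists>a b. op_scale (\<alpha> i) (weyl (x i) (z i)) = a \<circ> b \<and> a \<in> ?H \<and> b \<in> commutant \<Lambda> ?H \<and>
        supported_on (nbhd \<Lambda> D (Q + R) S) a \<and> supported_on (nbhd \<Lambda> D (Q + R) S) b" if i: "i < N" for i
    proof -
      have "F \<subseteq> \<Lambda>" using F by blast
      then obtain as bs where as: "\<forall>(T, m)\<in>set as. T \<in> A ` {a \<in> \<Lambda>. \<exists>c\<in>F. D a c \<le> R}"
        and bs: "\<forall>(T, m)\<in>set bs. T \<in> B ` {a \<in> \<Lambda>. \<exists>c\<in>F. D a c \<le> R}"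
        and W: "is_weyl (word as \<circ> word bs) (x i) (z i)"
        using gen[OF F(1), of "x i" "z i"] xz i by auto
      obtain \<theta> where \<theta>: "cmod \<theta> = 1" "word as \<circ> word bs = op_scale \<theta> (weyl (x i) (z i))"
        using W unfolding is_weyl_def by blast
      have "\<theta> \<noteq> 0" using \<theta>(1) by auto
      hence "op_scale (\<alpha> i) (weyl (x i) (z i)) = op_scale (\<alpha> i / \<theta>) (word as \<circ> word bs)"
        unfolding \<theta>(2) by (simp add: op_scale_def fun_eq_iff)
      also have "\<dots> = op_scale (\<alpha> i / \<theta>) (word as) \<circ> word bs" by (simp add: op_scale_def fun_eq_iff)
      finally have eq: "op_scale (\<alpha> i) (weyl (x i) (z i)) = op_scale (\<alpha> i / \<theta>) (word as) \<circ> word bs" .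
      have "word as \<in> ?H" by (rule subalgebra_word[OF subalgebra_hull]) (use as Asub in fastforce)
      hence 1: "op_scale (\<alpha> i / \<theta>) (word as) \<in> ?H" using subalgebra_hull unfolding subalgebra_def by blast
      have bs': "\<forall>(T, m)\<in>set bs. T \<in> B ` \<Lambda>" using bs by blast
      have "\<exists>x z. is_weyl (word bs) x z"
      proof (rule word_is_weyl)
        fix T m assume "(T, m) \<in> set bs"
        then obtain a where "a \<in> \<Lambda>" "T = B a" using bs' by auto
        thus "\<exists>x z. is_weyl T x z" using B by blast
      qed
      hence 2: "word bs \<in> commutant \<Lambda> ?H" using Bcomm[OF bs'] by blast
      have "supported_on (nbhd \<Lambda> D (Q + R) S) (word as)"
      proof (rule supported_on_word)
        fix T m assume "(T, m) \<in> set as"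
        then obtain a c where "a \<in> \<Lambda>" "c \<in> F" "D a c \<le> R" "T = A a" using as by auto
        thus "supported_on (nbhd \<Lambda> D (Q + R) S) T" using suppA[of a c S] F(2) by auto
      qed
      hence 3: "supported_on (nbhd \<Lambda> D (Q + R) S) (op_scale (\<alpha> i / \<theta>) (word as))"
        by (rule supported_on_scale)
      have "supported_on (nbhd \<Lambda> D (Q + R) S) (word bs)"
      proof (rule supported_on_word)
        fix T m assume "(T, m) \<in> set bs"
        then obtain a c where "a \<in> \<Lambda>" "c \<in> F" "D a c \<le> R" "T = B a" using bs by auto
        thus "supported_on (nbhd \<Lambda> D (Q + R) S) T" using suppB[of a c S] F(2) by auto
      qed
      thus ?thesis using eq 1 2 3 by blast
    qed
    then obtain a b where ab: "\<And>i. i < N \<Longrightarrow> op_scale (\<alpha> i) (weyl (x i) (z i)) = a i \<circ> b i \<and> a i \<in> ?H \<and>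
        b i \<in> commutant \<Lambda> ?H \<and> supported_on (nbhd \<Lambda> D (Q + R) S) (a i) \<and> supported_on (nbhd \<Lambda> D (Q + R) S) (b i)"
      by metis
    have "T = op_sum (\<lambda>i. a i \<circ> b i) {..<N}"
      unfolding T op_sum_def
    proof (intro ext sum.cong refl)
      fix \<psi> s i assume "i \<in> {..<N}"
      hence "op_scale (\<alpha> i) (weyl (x i) (z i)) = a i \<circ> b i" using ab by auto
      thus "op_scale (\<alpha> i) (weyl (x i) (z i)) \<psi> s = (a i \<circ> b i) \<psi> s" by (rule arg_cong)
    qed
    thus "\<exists>(N::nat) a b. T = op_sum (\<lambda>i. a i \<circ> b i) {..<N} \<and> (\<forall>i<N. a i \<in> ?H \<and> b i \<in> commutant \<Lambda> ?H \<and>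
        supported_on (nbhd \<Lambda> D (Q + R) S) (a i) \<and> supported_on (nbhd \<Lambda> D (Q + R) S) (b i))"
      by (intro exI[of _ N] exI[of _ a] exI[of _ b] conjI) (use ab in simp_all)
  qed
  show "\<exists>\<theta> (ops :: (('a, 'p) qop \<times> nat) list). cmod \<theta> = 1 \<and>
        (\<forall>(T, m)\<in>set ops. T \<in> A ` \<Lambda> \<union> B ` \<Lambda> \<and> supported_on (nbhd \<Lambda> D (Q + R) {c}) T) \<and>
        P = op_scale \<theta> (foldr (\<lambda>(T, m) Q. (T ^^ m) \<circ> Q) ops id)"
    if c: "c \<in> \<Lambda>" and P: "P \<in> {pauli_X c, pauli_Z c}" for c P
  proof -
    obtain x z where xz: "P = weyl x z" "\<And>b. b \<notin> {c} \<Longrightarrow> x b = 0" "\<And>b. b \<notin> {c} \<Longrightarrow> z b = 0"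
    proof (cases "P = pauli_X c")
      case True
      show ?thesis by (rule that[of "\<lambda>b. of_bool (b = c)" "\<lambda>b. 0"]) (simp_all add: True weyl_pauli_X)
    next
      case False
      hence "P = pauli_Z c" using P by simp
      thus ?thesis by (intro that[of "\<lambda>b. 0" "\<lambda>b. of_bool (b = c)"]) (simp_all add: weyl_pauli_Z)
    qed
    have "{c} \<subseteq> \<Lambda>" using c by simp
    then obtain as bs where as: "\<forall>(T, m)\<in>set as. T \<in> A ` {a \<in> \<Lambda>. \<exists>c\<in>{c}. D a c \<le> R}"
      and bs: "\<forall>(T, m)\<in>set bs. T \<in> B ` {a \<in> \<Lambda>. \<exists>c\<in>{c}. D a c \<le> R}"
      and W: "is_weyl (word as \<circ> word bs) x z"
      using gen[of "{c}" x z] xz(2,3) by auto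
    obtain \<theta> where \<theta>: "cmod \<theta> = 1" "word as \<circ> word bs = op_scale \<theta> (weyl x z)"
      using W unfolding is_weyl_def by blast
    have "\<theta> \<noteq> 0" using \<theta>(1) by auto
    hence "P = op_scale (1 / \<theta>) (word (as @ bs))"
      unfolding word_append \<theta>(2) xz(1) by (simp add: op_scale_def fun_eq_iff)
    moreover have "cmod (1 / \<theta>) = 1" using \<theta>(1) by (simp add: norm_divide)
    moreover have "T \<in> A ` \<Lambda> \<union> B ` \<Lambda> \<and> supported_on (nbhd \<Lambda> D (Q + R) {c}) T" if "(T, m) \<in> set (as @ bs)" for T m
    proof -
      have "T \<in> A ` {a \<in> \<Lambda>. D a c \<le> R} \<or> T \<in> B ` {a \<in> \<Lambda>. D a c \<le> R}" using that as bs by auto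
      thus ?thesis using suppA[of _ c "{c}"] suppB[of _ c "{c}"] by blast
    qed
    ultimately show ?thesis
      by (intro exI[of _ "1 / \<theta>"] exI[of _ "as @ bs"]) (auto simp: word_def)
  qed
qed

section \<open>The generators as Weyl operators\<close>

lemma cobd_support:
  assumes "t \<in> cells d (Suc m)"
  shows "finite {b. cobd (chi b) t \<noteq> (0 :: 'r::field)}" "{b. cobd (chi b) t \<noteq> (0 :: 'r)} \<subseteq> cells d m"
proof -
  have *: "b \<in> cells d m \<and> cell_dist d t b \<le> int d" if "cobd (chi b) t \<noteq> (0 :: 'r)" for b
    using cochain_local_cobd[of d m, where ?'a = 'r] assms that unfolding cochain_local_def by fastforce
  show "{b. cobd (chi b) t \<noteq> (0 :: 'r)} \<subseteq> cells d m" using * by blast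
  show "finite {b. cobd (chi b) t \<noteq> (0 :: 'r)}"
    by (rule finite_subset[OF _ finite_ball'[of d m t "int d"]]) (use * in auto)
qed

lemma Z_boundary_weyl:
  assumes "t \<in> cells d (Suc n)"
  shows "Z_boundary d n t = weyl (\<lambda>b. 0) (\<lambda>b. cobd (chi b) t :: 'p::prime_card mod_ring)"
  unfolding Z_boundary_def coboundary_indic
  by (rule op_prod_pauli_Z[OF cobd_support[OF assms, where ?'r = "'p mod_ring"]]) auto

text \<open>
  Cut off outside the \<open>n\<close>-cells, where \<open>exponent_map\<close> may take nonzero values but no qudits sit.
\<close>

definition A_exponent :: "nat \<Rightarrow> nat \<Rightarrow> 'r::field \<Rightarrow> cell \<Rightarrow> cell \<Rightarrow> 'r" where
  "A_exponent d n k a b = (if b \<in> cells d n then exponent_map d k (chi b) a else 0)"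

lemma A_exponent_support:
  assumes "a \<in> cells d n" "d = 2 * n" "A_exponent d n k a b \<noteq> 0"
  shows "b \<in> cells d n \<and> cell_dist d b a \<le> 3 * int d"
proof -
  have b: "b \<in> cells d n" "exponent_map d k (chi b) a \<noteq> 0"
    using assms(3) by (auto simp: A_exponent_def split: if_splits)
  then obtain c where "cell_dist d a c \<le> 3 * int d" "chi b c \<noteq> (0::'a)"
    using cochain_local_exponent_map[OF assms(2), of k] assms(1) unfolding cochain_local_def by blast
  thus ?thesis using b by (auto simp: cell_dist_commute split: if_splits)
qed

text \<open>
  All \<open>Z\<close>-factors of the generator commute and multiply without phases. The only phase comes from
  moving \<open>X\<^sub>a\<close> past \<open>Z\<^sub>a\<close>.
\<close>

lemma A_op_weyl:
  fixes k :: "'p::prime_card mod_ring"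
  assumes 2: "(2 :: 'p mod_ring) \<noteq> 0" and a: "a \<in> cells d n" and d: "d = 2 * n" and n: "odd n"
  shows "is_weyl (A_op d n k a) (\<lambda>b. of_bool (b = a)) (A_exponent d n k a)"
proof -
  let ?C = "cells d n" and ?C' = "cells d (n + 1)"
  let ?f = "\<lambda>b. if b \<in> ?C then k * of_int (integral_cochain d (cup n (indic b) (indic a))) else 0 :: 'p mod_ring"
  let ?q = "\<lambda>t. k / 2 * of_int (integral_cochain d
        (\<lambda>x. cup1 n (n + 1) (indic a) (indic t) x - cup1 (n + 1) n (indic t) (indic a) x)) :: 'p mod_ring"
  define T where "T = {t \<in> ?C'. cell_dist d a t \<le> 2 * int d}"
  have T: "finite T" "T \<subseteq> ?C'" using finite_ball' by (auto simp: T_def)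
  have f_near: "cell_dist d a b \<le> int d" if "?f b \<noteq> 0" for b
  proof -
    have "cup_dual d (chi b) a \<noteq> (0 :: 'p mod_ring)"
      using that integral_cup_indic[OF a d, of b, where ?'r = "'p mod_ring"] by (auto split: if_splits)
    then obtain c where "cell_dist d a c \<le> int d" "chi b c \<noteq> (0 :: 'p mod_ring)"
      using cochain_local_cup_dual[OF d, where ?'a = "'p mod_ring"] a unfolding cochain_local_def by blast
    thus ?thesis by (auto split: if_splits)
  qed
  have f_fin: "finite {b. ?f b \<noteq> 0}"
    by (rule finite_subset[OF _ finite_ball'[of d n a "int d"]]) (use f_near in \<open>auto split: if_splits\<close>)
  have 1: "op_prod (\<lambda>c'. op_pow (pauli_Z c') (k * of_int (integral_cochain d (cup n (indic c') (indic a))))) ?C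
      = weyl (\<lambda>b. 0) ?f"
    by (rule op_prod_pauli_Z[OF f_fin]) (auto split: if_splits)
  have q0: "?q t = 0" if t: "t \<in> ?C' - T" for t
  proof (rule ccontr)
    assume "?q t \<noteq> 0"
    hence "cup_dual d (mean_homotopy d (chi t)) a \<noteq> (0 :: 'p mod_ring)" unfolding integral_cup1_difference[OF 2 a d n]
      by auto
    moreover have "cochain_local d (int d + int d) (Suc n) n (\<lambda>x. cup_dual d (mean_homotopy d x) :: cell \<Rightarrow> 'p mod_ring)"
      by (rule cochain_local_comp[OF cochain_local_cup_dual[OF d] cochain_local_mean_homotopy])
    ultimately obtain c where "cell_dist d a c \<le> int d + int d" "chi t c \<noteq> (0 :: 'p mod_ring)"
      using a unfolding cochain_local_def by blast
    thus False using t by (auto simp: T_def split: if_splits)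
  qed
  let ?y = "\<lambda>t b. if t \<in> ?C' then ?q t * cobd (chi b) t else 0"
  have y_fin: "finite {b. ?y t b \<noteq> 0}" if "t \<in> ?C'" for t
    by (rule finite_subset[OF _ cobd_support(1)[of t d n, where ?'r = "'p mod_ring"]]) (use that in auto)
  have 3: "op_prod (\<lambda>t. op_pow (Z_boundary d n t) (?q t)) ?C' = weyl (\<lambda>b. 0) (\<lambda>b. \<Sum>t\<in>T. ?y t b)"
  proof (rule op_prod_weyl_Z[OF T])
    show "op_pow (Z_boundary d n t) (?q t) = weyl (\<lambda>b. 0) (?y t)" if t: "t \<in> ?C'" for t
      using t cobd_support(1)[of t d n, where ?'r = "'p mod_ring"]
      by (simp add: Z_boundary_weyl op_pow_weyl_Z)
  qed (use y_fin T q0 in auto)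
  have sy_fin: "finite {b. (\<Sum>t\<in>T. ?y t b) \<noteq> 0}"
    by (rule finite_support_sum[OF T(1) y_fin]) (use T(2) in blast)
  have w: "A_exponent d n k a b = ?f b + (\<Sum>t\<in>T. ?y t b)" for b
  proof (cases "b \<in> ?C")
    case True
    have "(\<Sum>t\<in>T. ?y t b) = (\<Sum>t\<in>T. ?q t * cobd (chi b) t)"
      by (intro sum.cong refl if_P subsetD[OF T(2)])
    thus ?thesis using True exponent_map_via_integrals[OF 2 a d n T, of k b]
      by (simp add: A_exponent_def T_def coboundary_indic)
  next
    case False
    have "(\<Sum>t\<in>T. ?y t b) = 0"
    proof (intro sum.neutral ballI)
      fix t assume "t \<in> T"
      hence "t \<in> cells d (Suc n)" using T(2) by auto
      from cobd_support(2)[OF this, where ?'r = "'p mod_ring"] False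
      have "cobd (chi b) t = (0 :: 'p mod_ring)" by blast
      thus "?y t b = 0" by simp
    qed
    thus ?thesis using False by (simp add: A_exponent_def)
  qed
  have "is_weyl (pauli_X a \<circ> weyl (\<lambda>b. 0) ?f \<circ> weyl (\<lambda>b. 0) (\<lambda>b. \<Sum>t\<in>T. ?y t b))
      (\<lambda>b. of_bool (b = a) + 0 + 0) (\<lambda>b. 0 + ?f b + (\<Sum>t\<in>T. ?y t b))"
    unfolding weyl_pauli_X[symmetric]
    by (intro is_weyl_comp is_weylI f_fin sy_fin) simp_all
  thus ?thesis unfolding A_op_def 1 3 by (simp only: add_0_left add_0_right w[symmetric])
qed

lemma two_neq_zero:
  assumes "odd CARD('p::prime_card)"
  shows "(2 :: 'p mod_ring) \<noteq> 0"
proof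
  assume "(2 :: 'p mod_ring) = 0"
  hence "CARD('p) dvd 2" using of_nat_0_mod_ring_dvd[of 2, where 'a = 'p] by simp
  hence "CARD('p) = 1 \<or> CARD('p) = 2" using prime_nat_iff[of 2] by auto
  thus False using assms prime_card[where 'a = 'p] by auto
qed

theorem mainTheorem6:
  fixes k :: "'p::prime_card mod_ring" and l n d :: nat
  assumes "odd CARD('p)" and "k \<noteq> 0" and "l \<ge> 1" and "n = 2 * l - 1" and "d = 2 * n"
  shows "invertible_subalgebra (cells d n) (cell_dist d) (subalgebra hull (A_op d n k ` cells d n)) \<and>
    (\<forall>c\<in>cells d n. \<forall>c'\<in>cells d n. A_op d n k c \<circ> A_bar d n k c' = A_bar d n k c' \<circ> A_op d n k c) \<and>
    (\<exists>\<rho>. \<forall>c\<in>cells d n. \<forall>P\<in>{pauli_X c, pauli_Z c}.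
      \<exists>\<theta> (ops :: ((cell, 'p) qop \<times> nat) list). cmod \<theta> = 1 \<and>
        (\<forall>(T, m)\<in>set ops. T \<in> A_op d n k ` cells d n \<union> A_bar d n k ` cells d n \<and>
          supported_on (nbhd (cells d n) (cell_dist d) \<rho> {c}) T) \<and>
        P = op_scale \<theta> (foldr (\<lambda>(T, m) Q. (T ^^ m) \<circ> Q) ops id))"
proof -
  let ?C = "cells d n"
  note 2 = two_neq_zero[OF assms(1)] and d = assms(5)
  have n: "odd n" using assms(3,4) by simp
  let ?w = "A_exponent d n k"
  have A: "is_weyl (A_op d n k a) (\<lambda>b. of_bool (b = a)) (?w a)" if "a \<in> ?C" for a
    by (rule A_op_weyl[OF 2 that d n])
  have B: "is_weyl (A_bar d n k a) (\<lambda>b. of_bool (b = a)) (\<lambda>b. - ?w a b)" if "a \<in> ?C" for a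
  proof -
    have "A_exponent d n (- k) a = (\<lambda>b. - ?w a b)" by (auto simp: A_exponent_def exponent_map_def)
    thus ?thesis using A_op_weyl[OF 2 that d n, of "- k"] by simp
  qed
  have anti: "?w a b = - ?w b a" if "a \<in> ?C" "b \<in> ?C" for a b
    using exponent_map_antisym[OF 2 that d n, of k] that by (simp add: A_exponent_def)
  have "\<exists>r. (\<forall>a. r a \<noteq> 0 \<longrightarrow> a \<in> ?C \<and> cell_dist d a c \<le> 3 * int d) \<and>
      (\<forall>b. (\<Sum>a | r a \<noteq> 0. r a * ?w a b) = of_bool (b = c))" if c: "c \<in> ?C" for c
  proof -
    obtain r where r: "\<forall>a. r a \<noteq> 0 \<longrightarrow> a \<in> ?C \<and> cell_dist d a c \<le> 3 * int d"
      and s: "\<forall>b\<in>?C. (\<Sum>a | a \<in> ?C \<and> cell_dist d a c \<le> 3 * int d. r a * exponent_map d k (chi b) a) = chi c b"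
      using exponent_map_solve[OF 2 assms(2) d n c] by blast
    have "(\<Sum>a | r a \<noteq> 0. r a * ?w a b) = of_bool (b = c)" for b
    proof (cases "b \<in> ?C")
      case True
      have "(\<Sum>a | r a \<noteq> 0. r a * ?w a b)
          = (\<Sum>a | a \<in> ?C \<and> cell_dist d a c \<le> 3 * int d. r a * exponent_map d k (chi b) a)"
        by (rule sum.mono_neutral_cong_left) (use r True finite_ball in \<open>auto simp: A_exponent_def\<close>)
      thus ?thesis using s True by simp
    next
      case False
      thus ?thesis using c by (auto simp: A_exponent_def)
    qed
    thus ?thesis using r by blast
  qed
  hence "\<forall>c\<in>?C. \<exists>r. (\<forall>a. r a \<noteq> 0 \<longrightarrow> a \<in> ?C \<and> cell_dist d a c \<le> 3 * int d) \<and>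
      (\<forall>b. (\<Sum>a | r a \<noteq> 0. r a * ?w a b) = of_bool (b = c))" by (intro ballI)
  from bchoice[OF this] obtain r where rs: "\<forall>c\<in>?C. (\<forall>a. r c a \<noteq> 0 \<longrightarrow> a \<in> ?C \<and> cell_dist d a c \<le> 3 * int d) \<and>
      (\<forall>b. (\<Sum>a | r c a \<noteq> 0. r c a * ?w a b) = of_bool (b = c))" by (elim exE)
  have r: "a \<in> ?C \<and> cell_dist d a c \<le> 3 * int d" if "c \<in> ?C" "r c a \<noteq> 0" for c a
    by (rule bspec[OF rs that(1), THEN conjunct1, THEN spec, THEN mp, OF that(2)])
  have s: "(\<Sum>a | r c a \<noteq> 0. r c a * ?w a b) = of_bool (b = c)" if "c \<in> ?C" for c b
    by (rule bspec[OF rs that, THEN conjunct2, THEN spec])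
  have fin: "finite {a. r c a \<noteq> 0}" if "c \<in> ?C" for c
  proof (rule finite_subset[OF _ finite_ball[of d n c "3 * int d"]])
    show "{a. r c a \<noteq> 0} \<subseteq> {a \<in> ?C. cell_dist d a c \<le> 3 * int d}" using r[OF that] by blast
  qed
  have R: "0 \<le> 3 * int d" by simp
  note main = invertible_weyl_subalgebra[where \<Lambda> = ?C and D = "cell_dist d" and w = ?w and A = "A_op d n k"
      and B = "A_bar d n k" and Q = "3 * int d" and R = "3 * int d" and r = r]
  show ?thesis
  proof (intro conjI ballI exI[of _ "3 * int d + 3 * int d"])
    show "invertible_subalgebra ?C (cell_dist d) (subalgebra hull (A_op d n k ` ?C))"
      by (rule main(1)[OF 2 A B anti A_exponent_support[OF _ d] cell_dist_self cell_dist_triangle R R r fin s]; assumption)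
    fix c assume c: "c \<in> ?C"
    show "A_op d n k c \<circ> A_bar d n k c' = A_bar d n k c' \<circ> A_op d n k c" if "c' \<in> ?C" for c'
      by (rule main(2)[OF 2 A B anti A_exponent_support[OF _ d] cell_dist_self cell_dist_triangle R R r fin s c that]; assumption)
    fix P :: "(cell, 'p) qop" assume P: "P \<in> {pauli_X c, pauli_Z c}"
    show "\<exists>\<theta> (ops :: ((cell, 'p) qop \<times> nat) list). cmod \<theta> = 1 \<and>
        (\<forall>(T, m)\<in>set ops. T \<in> A_op d n k ` ?C \<union> A_bar d n k ` ?C \<and>
          supported_on (nbhd ?C (cell_dist d) (3 * int d + 3 * int d) {c}) T) \<and>
        P = op_scale \<theta> (foldr (\<lambda>(T, m) Q. (T ^^ m) \<circ> Q) ops id)"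
      by (rule main(3)[OF 2 A B anti A_exponent_support[OF _ d] cell_dist_self cell_dist_triangle R R r fin s c P]; assumption)
  qed
qed

end
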